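(* Let $p>1$, let $f\in h^p$, and let $C$ be any convex curve in $\mathbb{D}$. If $p\ge 2$, then $$\int_C |f(z)|^p\,|dz|\le 4\int_{\mathbb{T}}|f(z)|^p\,|dz|,$$ and if $1<p<2$, then $$\int_C |f(z)|^p\,|dz|\le 2\sec^p\left(\frac{\pi}{2p}\right)\int_{\mathbb{T}}|f(z)|^p\,|dz|.$$
   Context: $\mathbb{D}=\{z\in\mathbb{C}:|z|<1\}$ and $\mathbb{T}=\{z\in\mathbb{C}:|z|=1\}$. A complex-valued function $f=u+iv$ is harmonic in $\mathbb{D}$ if $u,v$ are real-valued harmonic functions in $\mathbb{D}$. For $p>0$, $h^p$ is the set of complex-valued harmonic functions $f$ in $\mathbb{D}$ with $\sup_{0<r<1}M_p(r,f)<\infty$, where $M_p(r,f)=\left(\frac{1}{2\pi}\int_0^{2\pi}|f(re^{i\theta})|^p\,d\theta\right)^{1/p}$. On $\mathbb{T}$, $f(e^{i\theta})$ denotes the radial limit $\lim_{r\to1^-}f(re^{i\theta})$ (existing for almost every $\theta$ here), and $\int_{\mathbb{T}}|f(z)|^p|dz|=\int_0^{2\pi}|f(e^{i\theta})|^p\,d\theta$. A convex curve in $\mathbb{D}$ is a curve contained in $\mathbb{D}$, traversed once, that is the boundary of a bounded convex set or an arc of such a boundary; line segments (e.g. the diameter $-1<x<1$) are included. $|dz|$ is arc length. *)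

theory Defs
  imports "HOL-Analysis.Analysis"
begin

definition real_harmonic_on :: "(complex \<Rightarrow> real) \<Rightarrow> complex set \<Rightarrow> bool" where
  "real_harmonic_on u S \<longleftrightarrow>
     (\<exists>ux uy uxx uxy uyx uyy :: complex \<Rightarrow> real.
        (\<forall>z\<in>S. (u has_derivative (\<lambda>h. ux z * Re h + uy z * Im h)) (at z)) \<and>
        (\<forall>z\<in>S. (ux has_derivative (\<lambda>h. uxx z * Re h + uxy z * Im h)) (at z)) \<and>
        (\<forall>z\<in>S. (uy has_derivative (\<lambda>h. uyx z * Re h + uyy z * Im h)) (at z)) \<and>
        continuous_on S uxx \<and> continuous_on S uxy \<and>
        continuous_on S uyx \<and> continuous_on S uyy \<and>
        (\<forall>z\<in>S. uxx z + uyy z = 0))"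

definition harmonic_on :: "(complex \<Rightarrow> complex) \<Rightarrow> complex set \<Rightarrow> bool" where
  "harmonic_on f S \<longleftrightarrow>
     real_harmonic_on (\<lambda>z. Re (f z)) S \<and> real_harmonic_on (\<lambda>z. Im (f z)) S"

definition integral_mean :: "real \<Rightarrow> real \<Rightarrow> (complex \<Rightarrow> complex) \<Rightarrow> real" where
  "integral_mean p r f =
     (1 / (2 * pi) * integral {0..2*pi} (\<lambda>\<theta>. norm (f (of_real r * cis \<theta>)) powr p)) powr (1 / p)"

definition harmonic_hardy :: "real \<Rightarrow> (complex \<Rightarrow> complex) set" where
  "harmonic_hardy p =
     {f. harmonic_on f (ball 0 1) \<and> bdd_above ((\<lambda>r. integral_mean p r f) ` {0<..<1})}"

text \<open>Where the radial limit fails to exist, the value below is a constant independent of the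
  boundary point; for the functions of interest this concerns a null set only.\<close>

definition radial_limit :: "(complex \<Rightarrow> complex) \<Rightarrow> complex \<Rightarrow> complex" where
  "radial_limit f \<zeta> = Lim (at_left 1) (\<lambda>r::real. f (of_real r * \<zeta>))"

definition circle_integral_powr :: "real \<Rightarrow> (complex \<Rightarrow> complex) \<Rightarrow> ennreal" where
  "circle_integral_powr p f =
     (\<integral>\<^sup>+\<theta>\<in>{0..2*pi}. ennreal (norm (radial_limit f (cis \<theta>)) powr p) \<partial>lborel)"

text \<open>A curve is given by a parametrization on a real interval, which need not be compact: the
  open diameter of the disc, for instance, is a curve in the disc without end points.\<close>

definition curve_length :: "(real \<Rightarrow> complex) \<Rightarrow> real set \<Rightarrow> ennreal" where
  "curve_length \<gamma> A =
     (SUP ts \<in> {ts. sorted ts \<and> set ts \<subseteq> A}.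
        \<Sum>i<length ts - 1. ennreal (dist (\<gamma> (ts ! i)) (\<gamma> (ts ! Suc i))))"

text \<open>The measure on the parameter interval giving each compact subinterval the length of the
  corresponding piece of the curve. It exists and is unique for continuous curves that are
  locally rectifiable, in particular for all convex curves.\<close>

definition arc_length_measure :: "(real \<Rightarrow> complex) \<Rightarrow> real set \<Rightarrow> real measure" where
  "arc_length_measure \<gamma> A =
     extend_measure A {(a, b). a \<in> A \<and> b \<in> A \<and> a \<le> b}
       (\<lambda>(a, b). {a..b}) (\<lambda>(a, b). curve_length \<gamma> {a..b})"

definition curve_integral_powr ::
    "real \<Rightarrow> (real \<Rightarrow> complex) \<Rightarrow> real set \<Rightarrow> (complex \<Rightarrow> complex) \<Rightarrow> ennreal" where
  "curve_integral_powr p \<gamma> A f =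
     (\<integral>\<^sup>+t. ennreal (norm (f (\<gamma> t)) powr p) \<partial>arc_length_measure \<gamma> A)"

text \<open>The third condition says that the curve is traversed once: a point may be repeated only as
  the common end point of a closed curve. Such a curve inside the frontier of a bounded convex set
  is an arc of it or all of it. For a convex set with empty interior the frontier is its closure,
  a line segment.\<close>

definition convex_curve :: "(real \<Rightarrow> complex) \<Rightarrow> real set \<Rightarrow> bool" where
  "convex_curve \<gamma> A \<longleftrightarrow>
     is_interval A \<and> continuous_on A \<gamma> \<and>
     (\<forall>s\<in>A. \<forall>t\<in>A. s < t \<and> \<gamma> s = \<gamma> t \<longrightarrow> A = {s..t}) \<and>
     (\<exists>K. convex K \<and> bounded K \<and> \<gamma> ` A \<subseteq> frontier K)"

end

theory Submission
  imports Defs "HOL-Complex_Analysis.Complex_Analysis"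
begin

text \<open>For \<open>G\<close> analytic on a neighbourhood of the closed disc and a unit tangent \<open>\<tau>\<close> at \<open>z\<close>, Cauchy's
  formula for \<open>G\<close> and the vanishing of the integral of \<open>G\<close> against the conjugate kernel (which is
  analytic on the disc) give \<open>\<tau> G(z) = (1/\<pi>) \<integral> G(\<zeta>) Im (\<tau>/(\<zeta> - z)) d\<zeta>\<close>. The kernel is the rate of change
  of the direction in which \<open>\<zeta>\<close> sees \<open>z\<close>; along a convex curve this direction has total variation
  at most \<open>2\<pi>\<close>, since almost every ray meets the curve at most twice. Hence
  \<open>\<integral>\<^sub>C |G| \<le> 2 \<integral>\<^sub>T |G|\<close>.

  For \<open>f\<close> harmonic put \<open>s = max 1 (p/2)\<close> and \<open>t = p/s\<close>, so that \<open>1 < t \<le> 2\<close>. Then \<open>|f|\<^sup>s\<close> is dominated by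
  the positive Poisson integral \<open>w = Re S\<close> of its boundary values, and
  \<open>|S|\<^sup>t \<le> sec\<^sup>t(\<pi>/(2t)) w\<^sup>t - tan(\<pi>/(2t)) Re S\<^sup>t\<close>, where the last term has nonnegative mean. Applying
  the analytic case to \<open>G = S\<^sup>t\<close> proves the bound for the dilations of \<open>f\<close>. These converge
  in \<open>L\<^sup>p\<close> on the circle by uniform convexity, and almost everywhere radially by a weak type maximal
  inequality, which lets the dilation parameter tend to 1.\<close>

section \<open>Total angle subtended by a convex curve\<close>

text \<open>The integral of \<open>|G|\<close> along the curve is handled as the length of
  \<open>W \<circ> \<gamma>\<close> for a primitive \<open>W\<close> of \<open>G\<close>. That
  length is a supremum over inscribed polygons, so no tangent is ever formed and only finite sums of
  differences of viewing angles have to be estimated. The factor 2 is \<open>2 * pi / pi\<close>: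
  almost every direction is hit at most twice, the directions fill an interval of length pi, and the
  kernel carries \<open>1 / pi\<close>. The exponent \<open>t\<close> is capped at 2 because the
  trigonometric inequality rests on the concavity of \<open>y cot y\<close> on
  \<open>(0, pi)\<close> between \<open>x\<close> and \<open>2 * x\<close>, with
  \<open>x < pi / 2\<close>. At \<open>t = 2\<close> the secant factor is
  \<open>1 / cos\<^sup>2 (pi / 4) = 2\<close>, whence the constant 4. The boundary integral is
  defined by radial limits, while every estimate inside the disc sees only circles of radius below
  1. Passing between the two takes both the existence of the limits almost everywhere and
  convergence in the mean.\<close>

lemma frontier_supporting_line:
  fixes K :: "complex set"
  assumes K: "convex K" and b: "b \<in> frontier K"
  obtains a where "a \<noteq> 0" "\<And>x. x \<in> closure K \<Longrightarrow> inner a x \<le> inner a b"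
proof (cases "interior K = {}")
  case True
  \<comment> \<open>A set without interior lies in a line, whose normal supports the set at each of
    its points. In the other case interior and relative interior agree and the supporting hyperplane
    of the closure is used, with its sign reversed.\<close>
  obtain a c where a: "a \<noteq> 0" "K \<subseteq> {x. inner a x = c}"
    using empty_interior_subset_hyperplane[OF K True] by metis
  have "closure K \<subseteq> {x. inner a x = c}"
    by (rule closure_minimal[OF a(2)]) (rule closed_hyperplane)
  hence eq: "inner a x = c" if "x \<in> closure K" for x using that by auto
  have "b \<in> closure K" using b by (simp add: frontier_def)
  hence "inner a b = c" by (rule eq)
  hence "inner a x \<le> inner a b" if "x \<in> closure K" for x using eq[OF that] by simp
  thus thesis by (rule that[OF a(1)])
next
  case False
  have "b \<in> closure K" "b \<notin> interior K" using b by (auto simp: frontier_def)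
  moreover have "rel_interior K = interior K"
    using False by (rule rel_interior_nonempty_interior)
  ultimately obtain a where "a \<noteq> 0" "\<And>x. x \<in> closure K \<Longrightarrow> inner a b \<le> inner a x"
    using supporting_hyperplane_rel_boundary[of "closure K" b] K
    by (metis convex_closure convex_rel_interior_closure closure_closure)
  thus thesis using that[of "-a"] by auto
qed

text \<open>A support functional at the middle one of three collinear points is affine along their
  line and largest in the middle, so it is constant on the whole line. The line passes through
  \<open>\<zeta>\<close>, so the support line can be described by its value at
  \<open>\<zeta>\<close>.\<close>

lemma ray_supporting_line:
  fixes K :: "complex set"
  assumes K: "convex K" and \<rho>: "\<rho>1 < \<rho>2" "\<rho>2 < \<rho>3"
    and f1: "\<zeta> - of_real \<rho>1 * d \<in> closure K"
    and f2: "\<zeta> - of_real \<rho>2 * d \<in> frontier K"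
    and f3: "\<zeta> - of_real \<rho>3 * d \<in> closure K"
  obtains a where "a \<noteq> 0" "inner a d = 0" "\<And>x. x \<in> closure K \<Longrightarrow> inner a x \<le> inner a \<zeta>"
proof -
  obtain a where a: "a \<noteq> 0" "\<And>x. x \<in> closure K \<Longrightarrow> inner a x \<le> inner a (\<zeta> - of_real \<rho>2 * d)"
    using frontier_supporting_line[OF K f2] by metis
  have e: "inner a (\<zeta> - of_real \<rho> * d) = inner a \<zeta> - \<rho> * inner a d" for \<rho>
    by (simp add: inner_diff_right scaleR_conv_of_real[symmetric])
  have "(\<rho>2 - \<rho>1) * inner a d \<le> 0" "(\<rho>3 - \<rho>2) * inner a d \<ge> 0"
    using a(2)[OF f1] a(2)[OF f3] unfolding e by (auto simp: algebra_simps)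
  hence "inner a d = 0" using \<rho> by (simp add: mult_le_0_iff zero_le_mult_iff)
  thus thesis using a by (intro that[of a]) (auto simp: e)
qed

text \<open>A support line through \<open>\<zeta>\<close> in the direction \<open>c2\<close> keeps
  the closure on one closed side, while points seen from \<open>\<zeta>\<close> in directions
  \<open>c1 < c2\<close> and \<open>c3 > c2\<close> lie strictly on opposite sides. Hence at most
  two directions can carry three frontier points each.\<close>

lemma three_supporting_rays_False:
  fixes K :: "complex set"
  assumes c: "-pi/2 < c1" "c1 < c2" "c2 < c3" "c3 < pi/2" and z: "\<zeta> \<noteq> 0"
    and a: "a \<noteq> 0" "inner a (\<zeta> * cis c2) = 0" "\<And>x. x \<in> closure K \<Longrightarrow> inner a x \<le> inner a \<zeta>"
    and p1: "\<zeta> - of_real \<rho>1 * (\<zeta> * cis c1) \<in> closure K" "\<rho>1 > 0"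
    and p3: "\<zeta> - of_real \<rho>3 * (\<zeta> * cis c3) \<in> closure K" "\<rho>3 > 0"
  shows False
proof -
  define \<beta> where "\<beta> = a * cnj (\<zeta> * cis c2)"
  \<comment> \<open>\<open>a\<close> is perpendicular to the direction \<open>c2\<close>, so
    \<open>\<beta>\<close> is purely imaginary and only the sine of the angle difference survives.
    Its sign separates \<open>c1\<close> from \<open>c3\<close>.\<close>
  have in_eq: "inner a (\<zeta> * cis c) = Im \<beta> * sin (c - c2)" for c
  proof -
    have "inner a (\<zeta> * cis c) = Re (a * cnj (\<zeta> * cis c))"
      by (simp add: inner_complex_def algebra_simps)
    also have "cnj (\<zeta> * cis c) = cnj (\<zeta> * cis c2) * cis (c2 - c)"
      by (simp add: cis_cnj cis_mult)
    also have "Re (a * (cnj (\<zeta> * cis c2) * cis (c2 - c))) = Re \<beta> * cos (c2 - c) - Im \<beta> * sin (c2 - c)"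
      unfolding \<beta>_def mult.assoc[symmetric] by simp
    also have "Re \<beta> = 0" using a(2) by (simp add: \<beta>_def inner_complex_def algebra_simps)
    finally show ?thesis using sin_minus[of "c2 - c"] by simp
  qed
  have "\<beta> \<noteq> 0" using a z by (simp add: \<beta>_def)
  moreover have "Re \<beta> = 0" using a(2) by (simp add: \<beta>_def inner_complex_def algebra_simps)
  ultimately have I: "Im \<beta> \<noteq> 0" by (simp add: complex_eq_iff)
  have e: "inner a (\<zeta> - of_real \<rho> * d) = inner a \<zeta> - \<rho> * inner a d" for \<rho> d
    by (simp add: inner_diff_right scaleR_conv_of_real[symmetric])
  have 1: "\<rho>1 * (Im \<beta> * sin (c1 - c2)) \<ge> 0"
    using a(3)[OF p1(1)] by (simp add: e in_eq)
  have 3: "\<rho>3 * (Im \<beta> * sin (c3 - c2)) \<ge> 0"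
    using a(3)[OF p3(1)] by (simp add: e in_eq)
  have s3: "sin (c3 - c2) > 0" using c by (intro sin_gt_zero) auto
  have "sin (c2 - c1) > 0" using c by (intro sin_gt_zero) auto
  hence s1: "sin (c1 - c2) < 0" using sin_minus[of "c2 - c1"] by simp
  show False
    using 1 3 s1 s3 I p1(2) p3(2) by (auto simp: zero_le_mult_iff)
qed

text \<open>For \<open>norm \<zeta> = 1\<close> one has
  \<open>1 - z * cnj \<zeta> = (\<zeta> - z) / \<zeta>\<close>, so this is the signed angle at
  \<open>\<zeta>\<close> between the chord to \<open>z\<close> and the radius to the centre. For
  \<open>z\<close> in the disc the argument of \<open>Ln\<close> has positive real part, so no jump
  of \<open>2 * pi\<close> can enter the variation.\<close>

definition visual_angle :: "complex \<Rightarrow> complex \<Rightarrow> real" where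
  "visual_angle \<zeta> z = Im (Ln (1 - z * cnj \<zeta>))"

lemma Re_one_minus_pos:
  assumes "norm z < 1" "norm \<zeta> \<le> 1" shows "Re (1 - z * cnj \<zeta>) > 0"
proof -
  have "\<bar>Re (z * cnj \<zeta>)\<bar> \<le> norm (z * cnj \<zeta>)" by (rule abs_Re_le_cmod)
  also have "\<dots> \<le> norm z * 1" unfolding norm_mult using assms by (intro mult_left_mono) auto
  finally show ?thesis using assms by simp
qed

lemma visual_angle_bounds:
  assumes "norm z < 1" "norm \<zeta> = 1"
  shows "\<bar>visual_angle \<zeta> z\<bar> < pi/2"
proof -
  have "Re (1 - z * cnj \<zeta>) > 0" using assms by (intro Re_one_minus_pos) auto
  thus ?thesis unfolding visual_angle_def
    using Re_Ln_pos_lt[of "1 - z * cnj \<zeta>"] by (metis less_irrefl zero_complex.sel(1))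
qed

lemma visual_angle_ray:
  assumes "norm z < 1" "norm \<zeta> = 1"
  shows "z = \<zeta> - of_real (norm (1 - z * cnj \<zeta>)) * (\<zeta> * cis (visual_angle \<zeta> z))" "norm (1 - z * cnj \<zeta>) > 0"
proof -
  have nz: "1 - z * cnj \<zeta> \<noteq> 0"
    using Re_one_minus_pos[of z \<zeta>] assms by (metis less_irrefl order_refl zero_complex.sel(1))
  thus "norm (1 - z * cnj \<zeta>) > 0" by simp
  have "1 - z * cnj \<zeta> = of_real (norm (1 - z * cnj \<zeta>)) * cis (visual_angle \<zeta> z)"
    using nz by (metis visual_angle_def Arg_eq_Im_Ln Arg_eq exp_eq_polar cis_conv_exp)
  hence "\<zeta> - \<zeta> * (1 - z * cnj \<zeta>) = \<zeta> - of_real (norm (1 - z * cnj \<zeta>)) * (\<zeta> * cis (visual_angle \<zeta> z))"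
    by (simp add: mult.left_commute)
  moreover have "\<zeta> * cnj \<zeta> = 1" using assms complex_norm_square[of \<zeta>] by simp
  hence "\<zeta> - \<zeta> * (1 - z * cnj \<zeta>) = z" by (simp add: algebra_simps)
  ultimately show "z = \<zeta> - of_real (norm (1 - z * cnj \<zeta>)) * (\<zeta> * cis (visual_angle \<zeta> z))" by simp
qed

section \<open>Counting crossings of a level\<close>

lemma finite_if_no_three:
  fixes B :: "real set"
  assumes "\<And>x y z. x \<in> B \<Longrightarrow> y \<in> B \<Longrightarrow> z \<in> B \<Longrightarrow> x < y \<Longrightarrow> y < z \<Longrightarrow> False"
  shows "finite B"
proof (rule ccontr)
  assume "infinite B"
  then obtain T where T: "T \<subseteq> B" "finite T" "card T = 3" using infinite_arbitrarily_large by blast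
  then obtain x y z where "T = {x,y,z}" "x \<noteq> y" "y \<noteq> z" "x \<noteq> z" by (auto simp: card_3_iff)
  thus False using assms T(1)
    by (smt (verit) insert_subset)
qed

lemma card_le_2_if_no_three:
  fixes B :: "nat set"
  assumes "finite B" "\<And>x y z. x \<in> B \<Longrightarrow> y \<in> B \<Longrightarrow> z \<in> B \<Longrightarrow> x < y \<Longrightarrow> y < z \<Longrightarrow> False"
  shows "card B \<le> 2"
proof (rule ccontr)
  assume "\<not> card B \<le> 2"
  then obtain T where T: "T \<subseteq> B" "card T = 3"
    by (metis obtain_subset_with_card_n not_less_eq_eq numeral_2_eq_2 numeral_3_eq_3)
  then obtain x y z where "T = {x,y,z}" "x \<noteq> y" "y \<noteq> z" "x \<noteq> z" by (auto simp: card_3_iff)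
  thus False using assms(2) T(1)
    by (metis insert_subset linorder_neqE_nat)
qed

text \<open>Banach's indicatrix: the total length of the steps is the integral over all levels
  \<open>c\<close> of the number of steps that jump across \<open>c\<close>. The finite set
  \<open>B\<close> is null, so the count has to be bounded only outside \<open>B\<close>.\<close>

lemma sum_abs_diff_le_crossings:
  fixes x :: "nat \<Rightarrow> real"
  assumes B: "finite B" and le: "a \<le> b" and x: "\<And>i. i \<le> n \<Longrightarrow> a \<le> x i \<and> x i \<le> b"
    and cr: "\<And>c. c \<notin> B \<Longrightarrow> card {i\<in>{..<n}. min (x i) (x (Suc i)) < c \<and> c < max (x i) (x (Suc i))} \<le> m"
  shows "(\<Sum>i<n. \<bar>x (Suc i) - x i\<bar>) \<le> m * (b - a)"
proof -
  define J where "J i = {min (x i) (x (Suc i))<..<max (x i) (x (Suc i))}" for i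
  have "emeasure lborel (J i) = ennreal \<bar>x (Suc i) - x i\<bar>" for i
    by (auto simp: J_def max_def min_def)
  hence "ennreal (\<Sum>i<n. \<bar>x (Suc i) - x i\<bar>) = (\<Sum>i<n. emeasure lborel (J i))"
    by simp
  also have "\<dots> = (\<Sum>i<n. \<integral>\<^sup>+c. indicator (J i) c \<partial>lborel)"
    by (simp add: J_def)
  also have "\<dots> = (\<integral>\<^sup>+c. (\<Sum>i<n. indicator (J i) c) \<partial>lborel)"
    by (rule nn_integral_sum[symmetric]) (simp add: J_def)
  also have "\<dots> \<le> (\<integral>\<^sup>+c. of_nat m * indicator {a..b} c \<partial>lborel)"
  proof (rule nn_integral_mono_AE)
    have "AE c in lborel. c \<notin> B"
      by (rule AE_not_in) (use B in \<open>simp add: finite_imp_null_set_lborel\<close>)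
    thus "AE c in lborel. (\<Sum>i<n. indicator (J i) c :: ennreal) \<le> of_nat m * indicator {a..b} c"
    proof eventually_elim
      case (elim c)
      have s: "(\<Sum>i<n. indicator (J i) c :: ennreal) = of_nat (card {i\<in>{..<n}. c \<in> J i})"
        by (simp add: indicator_def sum.If_cases Int_def)
      show ?case
      proof (cases "c \<in> {a..b}")
        case True
        have "{i\<in>{..<n}. c \<in> J i} = {i\<in>{..<n}. min (x i) (x (Suc i)) < c \<and> c < max (x i) (x (Suc i))}"
          by (auto simp: J_def)
        hence "card {i\<in>{..<n}. c \<in> J i} \<le> m" using cr[OF elim] by simp
        thus ?thesis using True by (simp add: s)
      next
        case False
        have "c \<notin> J i" if "i < n" for i
          using x[of i] x[of "Suc i"] that False by (auto simp: J_def)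
        hence "{i\<in>{..<n}. c \<in> J i} = {}" by auto
        thus ?thesis by (simp add: s)
      qed
    qed
  qed
  also have "\<dots> = of_nat m * ennreal (b - a)"
    using le by (simp add: nn_integral_cmult)
  also have "\<dots> = ennreal (m * (b - a))"
    by (simp add: ennreal_mult' ennreal_of_nat_eq_real_of_nat)
  finally show ?thesis using le by (subst (asm) ennreal_le_iff) auto
qed

text \<open>Outside finitely many directions a ray from \<open>\<zeta>\<close> carries at most two
  frontier points of \<open>K\<close>, hence at most two parameters of the curve. A segment pointing
  at \<open>\<zeta>\<close>, all of it on one ray, is covered by the exceptional directions. The
  angles fill an interval of length pi, so the indicatrix gives \<open>2 * pi\<close>.\<close>

lemma visual_angle_variation:
  assumes C: "convex_curve \<gamma> A" and D: "\<gamma> ` A \<subseteq> ball 0 1" and z: "norm \<zeta> = 1"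
    and ts: "sorted ts" "set ts \<subseteq> A"
  shows "(\<Sum>i<length ts - 1. \<bar>visual_angle \<zeta> (\<gamma> (ts ! Suc i)) - visual_angle \<zeta> (\<gamma> (ts ! i))\<bar>) \<le> 2 * pi"
proof (cases "ts = []")
  case False
  obtain K where K: "convex K" "\<gamma> ` A \<subseteq> frontier K" using C by (auto simp: convex_curve_def)
  define \<psi> where "\<psi> t = visual_angle \<zeta> (\<gamma> t)" for t
  have n1: "norm (\<gamma> t) < 1" if "t \<in> A" for t using D that by auto
  have cont: "continuous_on A \<psi>"
    unfolding \<psi>_def visual_angle_def
  proof (intro continuous_intros)
    show "continuous_on A \<gamma>" using C by (simp add: convex_curve_def)
    show "1 - \<gamma> t * cnj \<zeta> \<notin> \<real>\<^sub>\<le>\<^sub>0" if "t \<in> A" for t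
      using Re_one_minus_pos[OF n1[OF that], of \<zeta>] z by (auto simp: complex_nonpos_Reals_iff)
  qed
  define three where "three c \<longleftrightarrow> (\<exists>\<rho>1 \<rho>2 \<rho>3. 0 < \<rho>1 \<and> \<rho>1 < \<rho>2 \<and> \<rho>2 < \<rho>3 \<and>
     (\<forall>\<rho>\<in>{\<rho>1,\<rho>2,\<rho>3}. \<zeta> - of_real \<rho> * (\<zeta> * cis c) \<in> frontier K))" for c
  define B0 where "B0 = {c. \<bar>c\<bar> < pi/2 \<and> three c}"
  have cl: "frontier K \<subseteq> closure K" by (simp add: frontier_def)
  have "finite B0"
  proof (rule finite_if_no_three)
    fix c1 c2 c3 assume c: "c1 \<in> B0" "c2 \<in> B0" "c3 \<in> B0" "c1 < c2" "c2 < c3"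
    from c(2) obtain \<rho>1 \<rho>2 \<rho>3 where r: "\<rho>1 < \<rho>2" "\<rho>2 < \<rho>3"
       "\<forall>\<rho>\<in>{\<rho>1,\<rho>2,\<rho>3}. \<zeta> - of_real \<rho> * (\<zeta> * cis c2) \<in> frontier K"
      unfolding B0_def three_def by blast
    obtain a where a: "a \<noteq> 0" "inner a (\<zeta> * cis c2) = 0" "\<And>x. x \<in> closure K \<Longrightarrow> inner a x \<le> inner a \<zeta>"
      using ray_supporting_line[OF K(1) r(1,2), of \<zeta> "\<zeta> * cis c2"] r(3) cl by blast
    obtain s1 where s1: "s1 > 0" "\<zeta> - of_real s1 * (\<zeta> * cis c1) \<in> frontier K"
      using c(1) unfolding B0_def three_def by blast
    obtain s3 where s3: "s3 > 0" "\<zeta> - of_real s3 * (\<zeta> * cis c3) \<in> frontier K"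
      using c(3) unfolding B0_def three_def by blast
    show False
      by (rule three_supporting_rays_False[OF _ c(4,5) _ _ a, where ?\<rho>1.0 = s1 and ?\<rho>3.0 = s3])
         (use c s1 s3 cl z in \<open>auto simp: B0_def\<close>)
  qed
  define B where "B = B0 \<union> \<psi> ` set ts"
  define x where "x i = \<psi> (ts ! i)" for i
  define n where "n = length ts - 1"
  have nth: "ts ! i \<in> A" if "i \<le> n" for i
  proof -
    have "i < length ts" using that False by (cases ts) (auto simp: n_def)
    thus ?thesis using ts(2) by (auto simp: subset_iff)
  qed
  have interval: "is_interval A" using C by (simp add: convex_curve_def)
  have "(\<Sum>i<n. \<bar>x (Suc i) - x i\<bar>) \<le> (2::nat) * (pi/2 - (-pi/2))"
  proof (rule sum_abs_diff_le_crossings)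
    show "finite B" using \<open>finite B0\<close> by (simp add: B_def)
    show "-pi/2 \<le> pi/2" by simp
    show "- pi/2 \<le> x i \<and> x i \<le> pi/2" if "i \<le> n" for i
      using visual_angle_bounds[OF n1[OF nth[OF that]] z] by (auto simp: x_def \<psi>_def)
    fix c assume cB: "c \<notin> B"
    define I where "I = {i \<in> {..<n}. min (x i) (x (Suc i)) < c \<and> c < max (x i) (x (Suc i))}"
    have hit: "\<exists>t. ts ! i < t \<and> t < ts ! Suc i \<and> \<psi> t = c \<and> t \<in> A" if "i \<in> I" for i
    proof -
      have i: "i < n" "ts ! i \<in> A" "ts ! Suc i \<in> A" using that nth[of i] nth[of "Suc i"] by (auto simp: I_def)
      have le: "ts ! i \<le> ts ! Suc i" using ts(1) i(1) by (auto simp: n_def intro: sorted_nth_mono)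
      have sub: "{ts ! i..ts ! Suc i} \<subseteq> A" using interval_subset_is_interval[OF interval, of "ts ! i" "ts ! Suc i"] i(2,3) by simp
      have ct: "continuous_on {ts ! i..ts ! Suc i} \<psi>" using cont sub continuous_on_subset by blast
      have "\<exists>t\<ge>ts ! i. t \<le> ts ! Suc i \<and> \<psi> t = c"
      proof (cases "x i \<le> x (Suc i)")
        case True thus ?thesis using that le ct by (intro IVT') (auto simp: I_def x_def)
      next
        case False thus ?thesis using that le ct by (intro IVT2') (auto simp: I_def x_def)
      qed
      then obtain t where t: "ts ! i \<le> t" "t \<le> ts ! Suc i" "\<psi> t = c" by blast
      have "ts ! i \<in> set ts" "ts ! Suc i \<in> set ts" using i(1) by (auto simp: n_def)
      hence "t \<noteq> ts ! i" "t \<noteq> ts ! Suc i" using t(3) cB by (auto simp: B_def)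
      thus ?thesis using t sub by (intro exI[of _ t]) auto
    qed
    show "card {i \<in> {..<n}. min (x i) (x (Suc i)) < c \<and> c < max (x i) (x (Suc i))} \<le> 2"
      unfolding I_def[symmetric]
    proof (rule card_le_2_if_no_three)
      show "finite I" by (simp add: I_def)
      fix i j k assume ijk: "i \<in> I" "j \<in> I" "k \<in> I" "i < j" "j < k"
      obtain r s t where r: "ts ! i < r" "r < ts ! Suc i" "\<psi> r = c" "r \<in> A"
        and s: "ts ! j < s" "s < ts ! Suc j" "\<psi> s = c" "s \<in> A"
        and t: "ts ! k < t" "t < ts ! Suc k" "\<psi> t = c" "t \<in> A"
        using hit ijk by meson
      have lt: "j < length ts" "k < length ts" using ijk by (auto simp: I_def n_def)
      have rs: "r < s" using r s sorted_nth_mono[OF ts(1), of "Suc i" j] ijk lt by linarith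
      have st: "s < t" using t s sorted_nth_mono[OF ts(1), of "Suc j" k] ijk lt by linarith
      have iA: "ts ! i \<in> A" "ts ! Suc k \<in> A" using ijk nth[of i] nth[of "Suc k"] by (auto simp: I_def)
      \<comment> \<open>Equal points could only be the two ends of a closed curve and would force
        \<open>A = {u..v}\<close>, but the node \<open>ts ! i\<close> lies in \<open>A\<close>
        strictly to the left of all three parameters.\<close>
      have inj: "\<gamma> u \<noteq> \<gamma> v" if "u \<in> {r,s,t}" "v \<in> {r,s,t}" "u < v" for u v
      proof
        assume "\<gamma> u = \<gamma> v"
        hence "A = {u..v}" using C that r s t by (auto simp: convex_curve_def)
        hence "u \<le> ts ! i" using iA by auto
        thus False using that(1) r(1) rs st by auto
      qed
      define R where "R t = norm (1 - \<gamma> t * cnj \<zeta>)" for t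
      have ray: "\<gamma> u = \<zeta> - of_real (R u) * (\<zeta> * cis c) \<and> R u > 0 \<and> \<gamma> u \<in> frontier K" if "u \<in> {r,s,t}" for u
      proof -
        have u: "u \<in> A" "visual_angle \<zeta> (\<gamma> u) = c" using that r s t by (auto simp: \<psi>_def)
        show ?thesis using visual_angle_ray[OF n1[OF u(1)] z] u K(2) by (auto simp: R_def)
      qed
      have d: "R r \<noteq> R s" "R s \<noteq> R t" "R r \<noteq> R t"
        using ray[of r] ray[of s] ray[of t] inj[of r s] inj[of s t] inj[of r t] rs st by auto
      have "\<exists>u\<in>{r,s,t}. \<exists>v\<in>{r,s,t}. \<exists>w\<in>{r,s,t}. R u < R v \<and> R v < R w"
        using d by simp (smt (verit))
      then obtain u v w where uvw: "u \<in> {r,s,t}" "v \<in> {r,s,t}" "w \<in> {r,s,t}" "R u < R v" "R v < R w" by blast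
      have "three c" unfolding three_def
        by (rule exI[of _ "R u"], rule exI[of _ "R v"], rule exI[of _ "R w"])
           (use uvw ray[OF uvw(1)] ray[OF uvw(2)] ray[OF uvw(3)] in auto)
      moreover have "\<bar>c\<bar> < pi/2" using visual_angle_bounds[OF n1[OF r(4)] z] r(3) by (simp add: \<psi>_def)
      ultimately show False using cB by (simp add: B_def B0_def)
    qed
  qed
  thus ?thesis by (simp add: x_def n_def \<psi>_def)
qed auto

section \<open>Arc length\<close>

lemma curve_length_mono: "I \<subseteq> J \<Longrightarrow> curve_length \<gamma> I \<le> curve_length \<gamma> J"
  unfolding curve_length_def by (rule SUP_subset_mono) auto

text \<open>A polygon inscribed in the first piece followed by one inscribed in the second is
  inscribed in the whole, and the joining edge can only add length.\<close>

lemma curve_length_add_le: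
  assumes "a \<le> b" "b \<le> c"
  shows "curve_length \<gamma> {a..b} + curve_length \<gamma> {b..c} \<le> curve_length \<gamma> {a..c}"
proof -
  define S where "S ts = (\<Sum>i<length ts - 1. ennreal (dist (\<gamma> (ts ! i)) (\<gamma> (ts ! Suc i))))" for ts :: "real list"
  define L where "L I = {ts. sorted ts \<and> set ts \<subseteq> I}" for I :: "real set"
  have cl: "curve_length \<gamma> I = (SUP ts\<in>L I. S ts)" for I
    by (simp add: curve_length_def S_def L_def)
  have ne: "L I \<noteq> {}" for I unfolding L_def by (auto intro: exI[of _ "[]"])
  have app: "S ts + S us \<le> S (ts @ us)" for ts us
  proof (cases "ts = [] \<or> us = []")
    case False
    define m k where "m = length ts" and "k = length us"
    have mk: "m > 0" "k > 0" using False by (auto simp: m_def k_def)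
    define T where "T i = ennreal (dist (\<gamma> ((ts @ us) ! i)) (\<gamma> ((ts @ us) ! Suc i)))" for i
    have "S ts = (\<Sum>i<m-1. T i)"
      by (auto simp: S_def T_def m_def nth_append simp del: sum_ennreal intro!: sum.cong)
    moreover have "S us = (\<Sum>i<k-1. T (i + m))"
      by (auto simp: S_def T_def m_def k_def nth_append simp del: sum_ennreal intro!: sum.cong)
    moreover have "(\<Sum>i<k-1. T (i + m)) = (\<Sum>i=m..<m+k-1. T i)"
      using sum.shift_bounds_nat_ivl[of T 0 m "k-1"] mk by (simp add: lessThan_atLeast0 add.commute)
    moreover have "(\<Sum>i<m-1. T i) + (\<Sum>i=m..<m+k-1. T i) = (\<Sum>i\<in>{..<m-1} \<union> {m..<m+k-1}. T i)"
      by (rule sum.union_disjoint[symmetric]) auto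
    \<comment> \<open>The index \<open>m - 1\<close> belongs to the joining edge and is absent on
      the left.\<close>
    moreover have "(\<Sum>i\<in>{..<m-1} \<union> {m..<m+k-1}. T i) \<le> (\<Sum>i<m+k-1. T i)"
      by (rule sum_mono2) (use mk in auto)
    ultimately show ?thesis by (simp add: S_def[of "ts @ us"] T_def m_def k_def)
  qed (auto simp: S_def)
  have 1: "S ts + S us \<le> curve_length \<gamma> {a..c}" if "ts \<in> L {a..b}" "us \<in> L {b..c}" for ts us
  proof -
    have "ts @ us \<in> L {a..c}" using that assms by (force simp: L_def sorted_append)
    thus ?thesis unfolding cl using app[of ts us] by (meson SUP_upper order_trans)
  qed
  have 2: "S ts + curve_length \<gamma> {b..c} \<le> curve_length \<gamma> {a..c}" if "ts \<in> L {a..b}" for ts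
    unfolding cl[of "{b..c}"] using ne 1[OF that]
    by (subst ennreal_SUP_add_right) (auto intro!: SUP_least)
  show ?thesis
    unfolding cl[of "{a..b}"] using ne 2
    by (subst ennreal_SUP_add_left[symmetric]) (auto intro!: SUP_least)
qed

lemma sum_curve_length_le:
  assumes "\<And>i. i < n \<Longrightarrow> s i \<le> s (Suc i)"
  shows "(\<Sum>i<n. curve_length \<gamma> {s i..s (Suc i)}) \<le> curve_length \<gamma> {s 0..s n}"
  using assms
proof (induction n)
  case (Suc n)
  have "s 0 \<le> s m" if "m \<le> n" for m
    using that
  proof (induction m)
    case (Suc m)
    thus ?case using Suc.prems \<open>\<And>i. i < Suc n \<Longrightarrow> s i \<le> s (Suc i)\<close>[of m] by simp
  qed simp
  hence mono: "s 0 \<le> s n" by simp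
  have "(\<Sum>i<Suc n. curve_length \<gamma> {s i..s (Suc i)}) \<le> curve_length \<gamma> {s 0..s n} + curve_length \<gamma> {s n..s (Suc n)}"
    using Suc by (simp add: add_right_mono)
  also have "\<dots> \<le> curve_length \<gamma> {s 0..s (Suc n)}"
    using mono Suc.prems by (intro curve_length_add_le) auto
  finally show ?case .
qed auto

text \<open>Edge by edge comparison of inscribed polygons. It is meant for a short piece of the
  curve and its image under a primitive \<open>W\<close> of \<open>G\<close>, which stretches
  distances by at least a factor slightly below \<open>|G|\<close>.\<close>

lemma curve_length_scale_le:
  assumes k: "k \<ge> 0" and le: "\<And>s t. s \<in> I \<Longrightarrow> t \<in> I \<Longrightarrow> k * dist (\<gamma> s) (\<gamma> t) \<le> dist (\<eta> s) (\<eta> t)"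
  shows "ennreal k * curve_length \<gamma> I \<le> curve_length \<eta> I"
proof -
  have "(\<Sum>i<length ts - 1. ennreal k * ennreal (dist (\<gamma> (ts ! i)) (\<gamma> (ts ! Suc i))))
    \<le> (\<Sum>i<length ts - 1. ennreal (dist (\<eta> (ts ! i)) (\<eta> (ts ! Suc i))))" if "set ts \<subseteq> I" for ts
  proof (rule sum_mono)
    fix i assume "i \<in> {..<length ts - 1}"
    hence "ts ! i \<in> I" "ts ! Suc i \<in> I" using that by (auto simp: subset_iff)
    thus "ennreal k * ennreal (dist (\<gamma> (ts ! i)) (\<gamma> (ts ! Suc i))) \<le> ennreal (dist (\<eta> (ts ! i)) (\<eta> (ts ! Suc i)))"
      using le k by (simp add: ennreal_mult[symmetric] ennreal_leI)
  qed
  thus ?thesis unfolding curve_length_def SUP_mult_left_ennreal sum_distrib_left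
    by (intro SUP_mono) (auto simp del: sum_ennreal)
qed

section \<open>The measure generated by arc length\<close>

lemma sets_arc_length_measure:
  "sets (arc_length_measure \<gamma> A) = sigma_sets A ((\<lambda>(a, b). {a..b}) ` {(a, b). a \<in> A \<and> b \<in> A \<and> a \<le> b})"
  if "is_interval A"
  unfolding arc_length_measure_def
  by (rule sets_extend_measure) (use interval_subset_is_interval[OF that] in auto)

lemma space_arc_length_measure: "space (arc_length_measure \<gamma> A) = A" if "is_interval A"
  unfolding arc_length_measure_def
  by (rule space_extend_measure) (use interval_subset_is_interval[OF that] in auto)

text \<open>The first case is the null measure that \<open>extend_measure\<close> returns when no
  extension exists.\<close>
lemma arc_length_measure_cases:
  assumes A: "is_interval A"
  obtains "\<And>X. emeasure (arc_length_measure \<gamma> A) X = 0"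
  | "\<And>a b. a \<in> A \<Longrightarrow> b \<in> A \<Longrightarrow> a \<le> b \<Longrightarrow> emeasure (arc_length_measure \<gamma> A) {a..b} = curve_length \<gamma> {a..b}"
proof -
  let ?I = "{(a, b). a \<in> A \<and> b \<in> A \<and> a \<le> b}" let ?G = "\<lambda>(a, b). {a..b::real}"
  let ?m = "\<lambda>(a, b). curve_length \<gamma> {a..b}"
  have sub: "?G ` ?I \<subseteq> Pow A" using interval_subset_is_interval[OF A] by auto
  show thesis
  proof (cases "(\<exists>\<mu>'. (\<forall>i\<in>?I. \<mu>' (?G i) = ?m i) \<and> measure_space A (sigma_sets A (?G`?I)) \<mu>') \<and> \<not> (\<forall>i\<in>?I. ?m i = 0)")
    case True
    then obtain \<mu>' where mu: "\<And>i. i \<in> ?I \<Longrightarrow> \<mu>' (?G i) = ?m i" "measure_space A (sigma_sets A (?G`?I)) \<mu>'" by blast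
    show thesis
    proof (rule that(2))
      fix a b assume ab: "a \<in> A" "b \<in> A" "a \<le> b"
      have "emeasure (arc_length_measure \<gamma> A) (?G (a, b)) = ?m (a, b)"
      proof (rule emeasure_extend_measure[OF arc_length_measure_def[of \<gamma> A], of \<mu>'])
        show "positive (sets (arc_length_measure \<gamma> A)) \<mu>'" "countably_additive (sets (arc_length_measure \<gamma> A)) \<mu>'"
          using mu(2) by (simp_all add: measure_space_def sets_arc_length_measure[OF A])
      qed (use mu ab sub in auto)
      thus "emeasure (arc_length_measure \<gamma> A) {a..b} = curve_length \<gamma> {a..b}" by simp
    qed
  next
    case False
    hence e: "arc_length_measure \<gamma> A = measure_of A (?G`?I) (\<lambda>_. 0)"
      unfolding arc_length_measure_def extend_measure_def by (rule if_not_P)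
    show thesis
    proof (rule that(1))
      fix X
      show "emeasure (arc_length_measure \<gamma> A) X = 0"
      proof (cases "X \<in> sets (arc_length_measure \<gamma> A)")
        case True
        have "emeasure (measure_of A (?G`?I) (\<lambda>_. 0)) X = 0"
          by (rule emeasure_measure_of[OF refl sub])
             (use True in \<open>auto simp: e positive_def countably_additive_def\<close>)
        thus ?thesis by (simp add: e)
      qed (simp add: emeasure_notin_sets)
    qed
  qed
qed

text \<open>The generators of the arc length measure are compact intervals with end points in
  \<open>A\<close>, whereas \<open>A\<close> may be open, half-open or unbounded. The exhausting
  intervals are spanned by growing finite parts of a countable subset of \<open>A\<close>.\<close>

lemma interval_countable_exhaustion:
  fixes A :: "real set"
  assumes "is_interval A" "A \<noteq> {}"
  obtains a b :: "nat \<Rightarrow> real" where "\<And>n. a n \<in> A" "\<And>n. b n \<in> A" "\<And>n. a n \<le> b n"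
    "incseq (\<lambda>n. {a n..b n})" "(\<Union>n. {a n..b n}) = A"
proof -
  \<comment> \<open>The last two sets contain at most the least and the greatest point of
    \<open>A\<close>. Rationals alone would never reach an irrational end point.\<close>
  define D where "D = (\<rat> \<inter> A) \<union> {t\<in>A. \<forall>s\<in>A. t \<le> s} \<union> {t\<in>A. \<forall>s\<in>A. s \<le> t}"
  have sub1: "finite S" if "\<And>x y. x \<in> S \<Longrightarrow> y \<in> S \<Longrightarrow> x = y" for S :: "real set"
    by (metis that finite.simps is_singletonI' is_singleton_def)
  have "countable D" unfolding D_def
    by (intro countable_Un countable_Int1 countable_rat countable_finite sub1) (auto intro: antisym)
  have DA: "D \<subseteq> A" by (auto simp: D_def)
  have lo: "\<exists>c\<in>D. c \<le> t" if t: "t \<in> A" for t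
  proof (cases "\<forall>s\<in>A. t \<le> s")
    case False
    then obtain s where s: "s \<in> A" "s < t" by auto
    obtain q where q: "q \<in> \<rat>" "s < q" "q < t" using Rats_dense_in_real[OF s(2)] by blast
    have "q \<in> A" using mem_is_interval_1_I[OF assms(1) s(1) t] q by simp
    thus ?thesis using q by (auto simp: D_def intro!: bexI[of _ q])
  qed (use t in \<open>auto simp: D_def\<close>)
  have hi: "\<exists>c\<in>D. t \<le> c" if t: "t \<in> A" for t
  proof (cases "\<forall>s\<in>A. s \<le> t")
    case False
    then obtain s where s: "s \<in> A" "t < s" by auto
    obtain q where q: "q \<in> \<rat>" "t < q" "q < s" using Rats_dense_in_real[OF s(2)] by blast
    have "q \<in> A" using mem_is_interval_1_I[OF assms(1) t s(1)] q by simp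
    thus ?thesis using q by (auto simp: D_def intro!: bexI[of _ q])
  qed (use t in \<open>auto simp: D_def\<close>)
  have "D \<noteq> {}" using lo assms(2) by blast
  define e where "e = from_nat_into D"
  have e: "range e = D" using \<open>countable D\<close> \<open>D \<noteq> {}\<close> by (simp add: e_def range_from_nat_into)
  define a b where "a n = Min (e ` {..n})" and "b n = Max (e ` {..n})" for n
  have in_D: "a n \<in> D" "b n \<in> D" for n
  proof -
    have "a n \<in> e ` {..n}" "b n \<in> e ` {..n}" unfolding a_def b_def by (rule Min_in Max_in; simp)+
    thus "a n \<in> D" "b n \<in> D" using e by auto
  qed
  show thesis
  proof
    show "a n \<in> A" "b n \<in> A" for n using in_D DA by auto
    show "a n \<le> b n" for n unfolding a_def b_def by (rule order_trans[of _ "e n"]) auto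
    have "a n \<le> a m" "b m \<le> b n" if "m \<le> n" for m n
      unfolding a_def b_def using that by (intro Min_antimono Max_mono image_mono; auto)+
    thus "incseq (\<lambda>n. {a n..b n})" by (intro monoI) (meson atLeastatMost_subset_iff)
    show "(\<Union>n. {a n..b n}) = A"
    proof
      show "(\<Union>n. {a n..b n}) \<subseteq> A"
      proof (rule UN_least)
        fix n
        have "a n \<in> A" "b n \<in> A" using in_D[of n] DA by (blast, blast)
        thus "{a n..b n} \<subseteq> A" using interval_subset_is_interval[OF assms(1), of "a n" "b n"] by simp
      qed
      show "A \<subseteq> (\<Union>n. {a n..b n})"
      proof
        fix t assume t: "t \<in> A"
        obtain i where i: "e i \<le> t" using lo[OF t] e by blast
        obtain j where j: "t \<le> e j" using hi[OF t] e by blast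
        have "a (max i j) \<le> e i" "e j \<le> b (max i j)" by (auto simp: a_def b_def)
        thus "t \<in> (\<Union>n. {a n..b n})" using i j by (intro UN_I[of "max i j"]) auto
      qed
    qed
  qed
qed

text \<open>The sigma-algebra is given only by its generators. The part of \<open>A\<close> below a
  level is a countable union of compact intervals with end points in \<open>A\<close>, so the
  inclusion of \<open>A\<close> into the reals is Borel measurable, and \<open>h\<close> is composed
  with it.\<close>

lemma borel_measurable_arc_length_measure:
  fixes h :: "real \<Rightarrow> 'b::topological_space"
  assumes A: "is_interval A" and h: "continuous_on A h"
  shows "h \<in> borel_measurable (arc_length_measure \<gamma> A)"
proof (cases "A = {}")
  case False
  let ?M = "arc_length_measure \<gamma> A"
  obtain a b where ab: "\<And>n. a n \<in> A" "\<And>n. b n \<in> A" "\<And>n. a n \<le> b n"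
    "incseq (\<lambda>n. {a n..b n})" "(\<Union>n. {a n..b n}) = A"
    by (rule interval_countable_exhaustion[OF A False]) (rule that)
  have "(\<lambda>t. t) \<in> borel_measurable ?M"
    unfolding borel_measurable_iff_le
  proof
    fix x
    have "{w \<in> space ?M. w \<le> x} = (\<Union>n. if a n \<le> x then {a n..min (b n) x} else {})"
      (is "?L = ?R")
    proof
      show "?L \<subseteq> ?R"
      proof
        fix w assume "w \<in> ?L"
        hence "w \<in> (\<Union>n. {a n..b n})" "w \<le> x" using space_arc_length_measure[OF A, of \<gamma>] ab(5) by auto
        then obtain n where "a n \<le> w" "w \<le> b n" "w \<le> x"
          by auto
        thus "w \<in> ?R" by (intro UN_I[of n]) auto
      qed
      show "?R \<subseteq> ?L"
      proof
        fix w assume "w \<in> ?R"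
        then obtain n where n: "w \<in> {a n..b n}" "w \<le> x" by (auto split: if_splits)
        hence "w \<in> A" using ab(5) by blast
        thus "w \<in> ?L" using n(2) by (simp add: space_arc_length_measure[OF A])
      qed
    qed
    moreover have "{a n..min (b n) x} \<in> sets ?M" if "a n \<le> x" for n
    proof -
      have "min (b n) x \<in> A" using mem_is_interval_1_I[OF A ab(1)[of n] ab(2)[of n], of "min (b n) x"] that ab(3) by simp
      thus ?thesis unfolding sets_arc_length_measure[OF A]
        using that ab by (intro sigma_sets.Basic image_eqI[of _ _ "(a n, min (b n) x)"]) auto
    qed
    ultimately show "{w \<in> space ?M. w \<le> x} \<in> sets ?M" by (auto intro!: sets.countable_UN)
  qed
  hence "(\<lambda>t. t) \<in> measurable ?M (restrict_space borel A)"
    by (intro measurable_restrict_space2) (auto simp: space_arc_length_measure[OF A])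
  from measurable_comp[OF this borel_measurable_continuous_on_restrict[OF h]]
  show ?thesis by (simp add: comp_def)
next
  case True
  hence "space (arc_length_measure \<gamma> A) = {}" using space_arc_length_measure[OF A] by simp
  thus ?thesis by (auto simp: measurable_def)
qed

section \<open>Gabriel's theorem for analytic functions\<close>

lemma has_contour_integral_unit_circle_iff:
  "(f has_contour_integral I) (circlepath 0 1) \<longleftrightarrow>
   ((\<lambda>t. f (cis t) * (\<i> * cis t)) has_integral I) {0..2*pi}"
  unfolding circlepath_def
  by (subst has_contour_integral_part_circlepath_iff) (auto simp: mult.assoc)

text \<open>The zero \<open>1 / cnj z\<close> of \<open>1 - \<zeta> * cnj z\<close> lies outside the
  closed disc, so kernels built from this expression are analytic slightly beyond the unit circle.
  The radius \<open>2 / (1 + norm z)\<close> lies between 1 and \<open>1 / norm z\<close>.\<close>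

lemma obtain_radius_conj:
  fixes z :: complex
  assumes R: "R > 1" and z: "norm z < 1"
  obtains e where "1 < e" "e \<le> R" "\<And>\<zeta>. norm \<zeta> < e \<Longrightarrow> norm (\<zeta> * cnj z) < 1"
proof
  show "1 < min R (2 / (1 + norm z))" "min R (2 / (1 + norm z)) \<le> R"
    using R z by (auto simp: add_pos_nonneg)
  fix \<zeta> :: complex assume "norm \<zeta> < min R (2 / (1 + norm z))"
  hence "norm \<zeta> * (1 + norm z) < 2" using norm_ge_zero[of z] by (simp add: field_simps)
  moreover have "norm \<zeta> * norm z * 2 \<le> norm \<zeta> * (1 + norm z)"
    using mult_left_mono[of "norm z * 2" "1 + norm z" "norm \<zeta>"] z by (simp add: algebra_simps)
  ultimately show "norm (\<zeta> * cnj z) < 1" by (simp add: norm_mult)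
qed

text \<open>Integrate by parts against \<open>Ln (1 - z/\<zeta>)\<close>; its conjugate on the circle is analytic in \<open>\<zeta>\<close>
  on the disc and contributes nothing, so only the imaginary part is left.\<close>
lemma contour_integral_visual_angle:
  assumes R: "R > 1" and W: "\<And>z. norm z < R \<Longrightarrow> (W has_field_derivative G z) (at z)"
    and z: "norm z < 1"
  shows "((\<lambda>\<zeta>. G \<zeta> * of_real (visual_angle \<zeta> z)) has_contour_integral - of_real pi * (W z - W 0)) (circlepath 0 1)"
proof -
  have holW: "W holomorphic_on ball 0 R"
    unfolding holomorphic_on_def field_differentiable_def
    using W has_field_derivative_at_within by (metis mem_ball_0)
  have "(deriv W) holomorphic_on ball 0 R" using holW by (intro holomorphic_deriv) auto
  hence holG: "G holomorphic_on ball 0 R"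
    by (rule holomorphic_transform) (use W in \<open>auto intro: DERIV_imp_deriv\<close>)
  \<comment> \<open>On this annulus \<open>z / \<zeta>\<close> has modulus below 1 and
    \<open>Ln (1 - z / \<zeta>)\<close> is single-valued, so the derivative of
    \<open>W \<zeta> * Ln (1 - z / \<zeta>)\<close> integrates to zero around the unit circle. The
    two Cauchy quotients in that derivative yield \<open>W z - W 0\<close>.\<close>
  define S where "S = {\<zeta>::complex. norm z < norm \<zeta> \<and> norm \<zeta> < R}"
  have d: "((\<lambda>\<zeta>. W \<zeta> * Ln (1 - z / \<zeta>)) has_field_derivative
       G \<zeta> * Ln (1 - z / \<zeta>) + W \<zeta> / (\<zeta> - z) - W \<zeta> / (\<zeta> - 0)) (at \<zeta> within S)" if "\<zeta> \<in> S" for \<zeta>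
  proof -
    have n: "norm z < norm \<zeta>" "norm \<zeta> < R" "\<zeta> \<noteq> 0" "\<zeta> \<noteq> z" using that by (auto simp: S_def)
    have "norm (z / \<zeta>) < 1" using n norm_ge_zero[of z] by (simp add: norm_divide del: norm_ge_zero)
    hence "Re (1 - z / \<zeta>) > 0" using abs_Re_le_cmod[of "z / \<zeta>"] by simp
    hence nn: "1 - z / \<zeta> \<notin> \<real>\<^sub>\<le>\<^sub>0" by (auto simp: complex_nonpos_Reals_iff)
    have "((\<lambda>\<zeta>. Ln (1 - z / \<zeta>)) has_field_derivative (z / \<zeta>^2) / (1 - z / \<zeta>)) (at \<zeta> within S)"
      using nn n by (auto intro!: derivative_eq_intros simp: power2_eq_square) (simp add: divide_inverse mult_ac)
    moreover have "(z / \<zeta>^2) / (1 - z / \<zeta>) = 1 / (\<zeta> - z) - 1 / \<zeta>"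
      using n by (simp add: field_simps power2_eq_square)
    ultimately have "((\<lambda>\<zeta>. W \<zeta> * Ln (1 - z / \<zeta>)) has_field_derivative
       W \<zeta> * (1 / (\<zeta> - z) - 1 / \<zeta>) + G \<zeta> * Ln (1 - z / \<zeta>)) (at \<zeta> within S)"
      using W[OF n(2)] by (intro DERIV_mult') (auto intro: has_field_derivative_at_within)
    thus ?thesis by (simp add: algebra_simps)
  qed
  have i0: "((\<lambda>\<zeta>. G \<zeta> * Ln (1 - z / \<zeta>) + W \<zeta> / (\<zeta> - z) - W \<zeta> / (\<zeta> - 0)) has_contour_integral 0) (circlepath 0 1)"
  proof -
    have "path_image (circlepath 0 1) \<subseteq> S" using R z by (auto simp: S_def)
    from contour_integral_primitive[OF d valid_path_circlepath this] show ?thesis by simp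
  qed
  have hol1: "W holomorphic_on ball 0 1" "continuous_on (cball 0 1) W"
    using R by (auto intro!: holomorphic_on_subset[OF holW] holomorphic_on_imp_continuous_on[OF holomorphic_on_subset[OF holW]])
  have iz: "((\<lambda>\<zeta>. W \<zeta> / (\<zeta> - z)) has_contour_integral (2 * of_real pi * \<i> * W z)) (circlepath 0 1)"
    using Cauchy_integral_circlepath[OF hol1(2,1), of z] z by simp
  have i00: "((\<lambda>\<zeta>. W \<zeta> / (\<zeta> - 0)) has_contour_integral (2 * of_real pi * \<i> * W 0)) (circlepath 0 1)"
    using Cauchy_integral_circlepath[OF hol1(2,1), of 0] by simp
  have 1: "((\<lambda>\<zeta>. G \<zeta> * Ln (1 - z / \<zeta>)) has_contour_integral (- 2 * of_real pi * \<i> * (W z - W 0))) (circlepath 0 1)"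
    using has_contour_integral_add[OF has_contour_integral_diff[OF i0 iz] i00] by (simp add: algebra_simps)
  obtain e where e: "1 < e" "e \<le> R" "\<And>\<zeta>. norm \<zeta> < e \<Longrightarrow> norm (\<zeta> * cnj z) < 1"
    using obtain_radius_conj[OF R z] by blast
  have holL: "(\<lambda>\<zeta>. G \<zeta> * Ln (1 - \<zeta> * cnj z)) holomorphic_on ball 0 e"
  proof (intro holomorphic_intros holomorphic_on_subset[OF holG])
    show "ball 0 e \<subseteq> ball 0 R" using e by auto
    fix \<zeta> :: complex assume "\<zeta> \<in> ball 0 e"
    hence "norm (\<zeta> * cnj z) < 1" by (intro e(3)) simp
    hence "Re (1 - \<zeta> * cnj z) > 0" using abs_Re_le_cmod[of "\<zeta> * cnj z"] by (simp del: times_complex.sel)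
    thus "1 - \<zeta> * cnj z \<notin> \<real>\<^sub>\<le>\<^sub>0" by (auto simp: complex_nonpos_Reals_iff)
  qed
  have 2: "((\<lambda>\<zeta>. G \<zeta> * Ln (1 - \<zeta> * cnj z)) has_contour_integral 0) (circlepath 0 1)"
    by (rule Cauchy_theorem_disc_simple[OF holL]) (use e in auto)
  have 3: "((\<lambda>\<zeta>. (G \<zeta> * Ln (1 - z / \<zeta>) - G \<zeta> * Ln (1 - \<zeta> * cnj z)) / (2 * \<i>)) has_contour_integral
      (- 2 * of_real pi * \<i> * (W z - W 0) - 0) / (2 * \<i>)) (circlepath 0 1)"
    by (intro has_contour_integral_div has_contour_integral_diff 1 2)
  show ?thesis
  proof (rule has_contour_integral_eq)
    show "((\<lambda>\<zeta>. (G \<zeta> * Ln (1 - z / \<zeta>) - G \<zeta> * Ln (1 - \<zeta> * cnj z)) / (2 * \<i>)) has_contour_integral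
      - of_real pi * (W z - W 0)) (circlepath 0 1)"
      using 3 by (rule back_subst[where P = "\<lambda>I. (_ has_contour_integral I) _"]) (simp add: field_simps)
    fix \<zeta> :: complex assume "\<zeta> \<in> path_image (circlepath 0 1)"
    hence \<zeta>: "norm \<zeta> = 1" by simp
    have "\<zeta> * cnj \<zeta> = 1" using \<zeta> complex_norm_square[of \<zeta>] by simp
    hence q: "z / \<zeta> = z * cnj \<zeta>" using \<zeta> by (simp add: divide_eq_eq) (metis mult.commute mult.left_commute mult_1)
    have nn: "1 - z * cnj \<zeta> \<notin> \<real>\<^sub>\<le>\<^sub>0" using Re_one_minus_pos[OF z, of \<zeta>] \<zeta> by (auto simp: complex_nonpos_Reals_iff)
    \<comment> \<open>On the circle \<open>z / \<zeta> = z * cnj \<zeta>\<close>, so the two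
      logarithms are conjugate and their difference is \<open>2 * \<i>\<close> times the viewing
      angle.\<close>
    have "Ln (1 - \<zeta> * cnj z) = cnj (Ln (1 - z * cnj \<zeta>))"
      using cnj_Ln[OF nn] by (simp add: mult.commute)
    hence "(Ln (1 - z / \<zeta>) - Ln (1 - \<zeta> * cnj z)) / (2 * \<i>) = of_real (visual_angle \<zeta> z)"
      by (simp add: q visual_angle_def complex_diff_cnj) (simp add: complex_eq_iff)
    thus "(G \<zeta> * Ln (1 - z / \<zeta>) - G \<zeta> * Ln (1 - \<zeta> * cnj z)) / (2 * \<i>) = G \<zeta> * of_real (visual_angle \<zeta> z)"
      by (metis right_diff_distrib times_divide_eq_right)
  qed
qed

lemma continuous_visual_angle:
  assumes "norm z < 1" shows "continuous_on S (\<lambda>t. visual_angle (cis t) z)"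
  unfolding visual_angle_def
proof (intro continuous_intros)
  show "1 - z * cnj (cis t) \<notin> \<real>\<^sub>\<le>\<^sub>0" for t
    using Re_one_minus_pos[OF assms, of "cis t"] by (auto simp: complex_nonpos_Reals_iff)
qed

text \<open>Subtracting the formulas for \<open>b\<close> and \<open>a\<close> cancels
  \<open>W 0\<close>. What remains bounds one edge of a polygon inscribed in the image under
  \<open>W\<close> by changes of the viewing angle, integrated with weight
  \<open>|G|\<close>.\<close>

lemma norm_primitive_diff_le:
  assumes R: "R > 1" and W: "\<And>z. norm z < R \<Longrightarrow> (W has_field_derivative G z) (at z)"
    and G: "continuous_on (cball 0 1) G"
    and a: "norm a < 1" and b: "norm b < 1"
  shows "pi * norm (W b - W a) \<le>
    integral {0..2*pi} (\<lambda>t. norm (G (cis t)) * \<bar>visual_angle (cis t) b - visual_angle (cis t) a\<bar>)"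
proof -
  have "((\<lambda>\<zeta>. G \<zeta> * of_real (visual_angle \<zeta> b) - G \<zeta> * of_real (visual_angle \<zeta> a)) has_contour_integral
     (- of_real pi * (W b - W 0) - (- of_real pi * (W a - W 0)))) (circlepath 0 1)"
    by (intro has_contour_integral_diff contour_integral_visual_angle[OF R W] a b)
  hence hi: "((\<lambda>t. (G (cis t) * of_real (visual_angle (cis t) b) - G (cis t) * of_real (visual_angle (cis t) a)) * (\<i> * cis t))
     has_integral (- of_real pi * (W b - W 0) - (- of_real pi * (W a - W 0)))) {0..2*pi}"
    (is "(?f has_integral ?I) _")
    by (simp add: has_contour_integral_unit_circle_iff)
  have "norm ?I \<le> integral {0..2*pi} (\<lambda>t. norm (G (cis t)) * \<bar>visual_angle (cis t) b - visual_angle (cis t) a\<bar>)"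
    unfolding integral_unique[OF hi, symmetric]
  proof (rule integral_norm_bound_integral)
    show "?f integrable_on {0..2*pi}" using hi by (rule has_integral_integrable)
    have "continuous_on {0..2*pi} (\<lambda>t. G (cis t))"
      by (rule continuous_on_compose2[OF G]) (auto intro!: continuous_intros)
    thus "(\<lambda>t. norm (G (cis t)) * \<bar>visual_angle (cis t) b - visual_angle (cis t) a\<bar>) integrable_on {0..2*pi}"
      by (intro integrable_continuous_interval continuous_intros continuous_visual_angle a b)
    show "norm (?f t) \<le> norm (G (cis t)) * \<bar>visual_angle (cis t) b - visual_angle (cis t) a\<bar>" for t
      by (simp add: norm_mult right_diff_distrib[symmetric] of_real_diff[symmetric] del: of_real_diff)
  qed
  moreover have "?I = - of_real pi * (W b - W a)" by (simp add: algebra_simps)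
  ultimately show ?thesis by (simp add: norm_mult)
qed

text \<open>The edges of an inscribed polygon are summed under the integral. For each boundary point
  the changes of the viewing angle add up to at most \<open>2 * pi\<close>, and dividing by the
  \<open>pi\<close> in the edge estimate leaves the constant 2.\<close>

lemma curve_length_primitive_le:
  assumes R: "R > 1" and W: "\<And>z. norm z < R \<Longrightarrow> (W has_field_derivative G z) (at z)"
    and G: "continuous_on (cball 0 1) G"
    and C: "convex_curve \<gamma> A" "\<gamma> ` A \<subseteq> ball 0 1"
  shows "curve_length (W \<circ> \<gamma>) A \<le> ennreal (2 * integral {0..2*pi} (\<lambda>t. norm (G (cis t))))"
  unfolding curve_length_def
proof (rule SUP_least, clarify)
  fix ts :: "real list" assume ts: "sorted ts" "set ts \<subseteq> A"
  define n where "n = length ts - 1"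
  define v where "v i t = visual_angle (cis t) (\<gamma> (ts ! i))" for i t
  have n1: "norm (\<gamma> (ts ! i)) < 1" if "i < length ts" for i using C(2) ts that by (auto simp: subset_iff)
  have contG: "continuous_on {0..2*pi} (\<lambda>t. norm (G (cis t)))"
    by (intro continuous_intros continuous_on_compose2[OF G]) auto
  have int: "(\<lambda>t. norm (G (cis t)) * \<bar>v (Suc i) t - v i t\<bar>) integrable_on {0..2*pi}" if "i < n" for i
    unfolding v_def using that n1
    by (intro integrable_continuous_interval continuous_intros contG continuous_visual_angle) (auto simp: n_def)
  have "pi * (\<Sum>i<n. dist (W (\<gamma> (ts ! i))) (W (\<gamma> (ts ! Suc i)))) \<le>
     (\<Sum>i<n. integral {0..2*pi} (\<lambda>t. norm (G (cis t)) * \<bar>v (Suc i) t - v i t\<bar>))"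
    unfolding sum_distrib_left v_def
    by (intro sum_mono, subst dist_commute, unfold dist_norm)
       (auto simp: n_def intro!: norm_primitive_diff_le[OF R W G] n1)
  also have "\<dots> = integral {0..2*pi} (\<lambda>t. \<Sum>i<n. norm (G (cis t)) * \<bar>v (Suc i) t - v i t\<bar>)"
    using int by (intro integral_sum[symmetric]) auto
  also have "\<dots> \<le> integral {0..2*pi} (\<lambda>t. 2 * pi * norm (G (cis t)))"
  proof (rule integral_le)
    show "(\<lambda>t. \<Sum>i<n. norm (G (cis t)) * \<bar>v (Suc i) t - v i t\<bar>) integrable_on {0..2*pi}"
      using int by (intro integrable_sum) auto
    show "(\<lambda>t. 2 * pi * norm (G (cis t))) integrable_on {0..2*pi}"
      by (intro integrable_continuous_interval continuous_intros contG)
    fix t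
    have "(\<Sum>i<n. \<bar>v (Suc i) t - v i t\<bar>) \<le> 2 * pi"
      unfolding v_def n_def by (rule visual_angle_variation[OF C _ ts]) auto
    thus "(\<Sum>i<n. norm (G (cis t)) * \<bar>v (Suc i) t - v i t\<bar>) \<le> 2 * pi * norm (G (cis t))"
      unfolding sum_distrib_left[symmetric] by (subst mult.commute) (intro mult_right_mono, auto)
  qed
  also have "\<dots> = pi * (2 * integral {0..2*pi} (\<lambda>t. norm (G (cis t))))" by simp
  finally have "(\<Sum>i<n. dist (W (\<gamma> (ts ! i))) (W (\<gamma> (ts ! Suc i)))) \<le> 2 * integral {0..2*pi} (\<lambda>t. norm (G (cis t)))"
    by simp
  thus "(\<Sum>i<length ts - 1. ennreal (dist ((W \<circ> \<gamma>) (ts ! i)) ((W \<circ> \<gamma>) (ts ! Suc i)))) \<le> ennreal (2 * integral {0..2*pi} (\<lambda>t. norm (G (cis t))))"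
    by (simp add: sum_ennreal n_def ennreal_leI)
qed

text \<open>Up to a small error the integral of \<open>|G|\<close> is at most the length of the
  image under \<open>W\<close>, since on a short piece \<open>W\<close> is nearly multiplication by
  one value of \<open>G\<close>. The measure \<open>M\<close> enters only through the lengths it
  gives to compact intervals.\<close>

lemma nn_integral_convex_arc_le:
  assumes R: "R > 1" and W: "\<And>z. norm z < R \<Longrightarrow> (W has_field_derivative G z) (at z)"
    and G: "continuous_on (cball 0 1) G"
    and C: "convex_curve \<gamma> A" "\<gamma> ` A \<subseteq> ball 0 1"
    and ab: "a \<in> A" "b \<in> A" "a \<le> b"
    and M: "\<And>s t. s \<in> A \<Longrightarrow> t \<in> A \<Longrightarrow> s \<le> t \<Longrightarrow> {s..t} \<in> sets M"
      "\<And>s t. s \<in> A \<Longrightarrow> t \<in> A \<Longrightarrow> s \<le> t \<Longrightarrow> emeasure M {s..t} = curve_length \<gamma> {s..t}"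
  shows "(\<integral>\<^sup>+t. ennreal (norm (G (\<gamma> t))) * indicator {a..b} t \<partial>M) \<le> ennreal (2 * integral {0..2*pi} (\<lambda>t. norm (G (cis t))))"
    (is "?I \<le> ennreal ?B")
proof (rule ennreal_le_epsilon)
  fix e :: real assume e: "e > 0"
  \<comment> \<open>The case \<open>G = 1\<close> with \<open>W\<close> the identity: a convex curve
    in the disc has length at most \<open>4 * pi\<close>. This finite bound controls the error
    term.\<close>
  have "curve_length ((\<lambda>z. z) \<circ> \<gamma>) A \<le> ennreal (2 * integral {0..2*pi} (\<lambda>t. norm ((\<lambda>_. 1::complex) (cis t))))"
    by (rule curve_length_primitive_le[OF R _ _ C]) auto
  hence lenA: "curve_length \<gamma> A \<le> ennreal (4 * pi)" by (simp add: comp_def)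
  define \<epsilon> where "\<epsilon> = e / (8 * pi)"
  have \<epsilon>: "\<epsilon> > 0" using e by (simp add: \<epsilon>_def)
  have "uniformly_continuous_on (cball 0 1) G" using G by (rule compact_uniformly_continuous) simp
  then obtain \<delta> where \<delta>: "\<delta> > 0" "\<And>x y. x \<in> cball 0 1 \<Longrightarrow> y \<in> cball 0 1 \<Longrightarrow> dist y x < \<delta> \<Longrightarrow> dist (G y) (G x) < \<epsilon>"
    using \<epsilon> unfolding uniformly_continuous_on_def by metis
  have sub: "{a..b} \<subseteq> A" using C(1) ab interval_subset_is_interval[of A a b] by (simp add: convex_curve_def)
  have "continuous_on {a..b} \<gamma>" using C(1) sub continuous_on_subset unfolding convex_curve_def by blast
  hence "uniformly_continuous_on {a..b} \<gamma>" by (rule compact_uniformly_continuous) simp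
  then obtain \<eta> where \<eta>: "\<eta> > 0" "\<And>x y. x \<in> {a..b} \<Longrightarrow> y \<in> {a..b} \<Longrightarrow> dist y x < \<eta> \<Longrightarrow> dist (\<gamma> y) (\<gamma> x) < \<delta>"
    using \<delta>(1) unfolding uniformly_continuous_on_def by metis
  obtain n :: nat where n: "n > 0" "(b - a) / n < \<eta>"
  proof -
    obtain n :: nat where "(b - a) / \<eta> < n" using reals_Archimedean2 by blast
    hence "(b - a) / real (Suc n) < \<eta>" using \<eta>(1) ab(3) by (simp add: field_simps)
    thus thesis using that[of "Suc n"] by simp
  qed
  define s where "s j = a + real j * ((b - a) / n)" for j
  define h where "h = (b - a) / n"
  have h: "h \<ge> 0" using ab n by (simp add: h_def)
  have s0: "s 0 = a" "s n = b" using n by (auto simp: s_def)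
  have sS: "s (Suc j) = s j + h" for j unfolding s_def h_def by (simp add: distrib_right add_divide_distrib)
  have smono: "s i \<le> s j" if "i \<le> j" for i j
    using that h by (auto simp: s_def h_def[symmetric] intro!: mult_right_mono)
  have sab: "s j \<in> {a..b}" if "j \<le> n" for j using smono[of 0 j] smono[of j n] that s0 by auto
  have sA: "s j \<in> A" if "j \<le> n" for j using sab[OF that] sub by blast
  define I where "I j = {s j..s (Suc j)}" for j
  have Iab: "I j \<subseteq> {a..b}" if "j < n" for j using sab[of j] sab[of "Suc j"] that by (auto simp: I_def)
  \<comment> \<open>The factor by which \<open>W\<close> is guaranteed to stretch the piece
    \<open>I j\<close>, cut off at 0 because \<open>curve_length_scale_le\<close> takes nonnegative
    factors.\<close>
  define k where "k j = max 0 (norm (G (\<gamma> (s j))) - \<epsilon>)" for j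
  have near: "\<gamma> t \<in> cball 0 1 \<inter> ball (\<gamma> (s j)) \<delta>" if "j < n" "t \<in> I j" for j t
  proof -
    have "t \<in> {a..b}" using that Iab by blast
    moreover have "dist (s j) t < \<eta>" using that n(2) by (auto simp: I_def sS h_def dist_real_def)
    ultimately show ?thesis using \<eta>(2)[of t "s j"] sab[of j] that C(2) sub by (force simp: subset_iff)
  qed
  have gk: "norm (G (\<gamma> t)) \<le> k j + 2 * \<epsilon>" if "j < n" "t \<in> I j" for j t
  proof -
    have "dist (G (\<gamma> t)) (G (\<gamma> (s j))) < \<epsilon>"
      using near[OF that] near[OF that(1), of "s j"] h by (intro \<delta>(2)) (auto simp: dist_commute I_def sS)
    thus ?thesis using norm_triangle_ineq2[of "G (\<gamma> t)" "G (\<gamma> (s j))"] by (auto simp: k_def dist_norm max_def)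
  qed
  have Wk: "k j * dist (\<gamma> t) (\<gamma> u) \<le> dist ((W \<circ> \<gamma>) t) ((W \<circ> \<gamma>) u)" if "j < n" "t \<in> I j" "u \<in> I j" for j t u
  proof -
    define z0 where "z0 = \<gamma> (s j)"
    \<comment> \<open>Mean value inequality for \<open>W z - G z0 * z\<close>, whose derivative is
      at most \<open>\<epsilon>\<close> in modulus on the convex lens around
      \<open>z0\<close>.\<close>
    have "norm ((W (\<gamma> t) - G z0 * \<gamma> t) - (W (\<gamma> u) - G z0 * \<gamma> u)) \<le> \<epsilon> * norm (\<gamma> t - \<gamma> u)"
    proof (rule field_differentiable_bound[of "cball 0 1 \<inter> ball z0 \<delta>"])
      show "convex (cball 0 1 \<inter> ball z0 \<delta>)" by (intro convex_Int) auto
      show "((\<lambda>z. W z - G z0 * z) has_field_derivative G z - G z0) (at z within cball 0 1 \<inter> ball z0 \<delta>)"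
        if "z \<in> cball 0 1 \<inter> ball z0 \<delta>" for z
        using that R by (auto intro!: derivative_eq_intros has_field_derivative_at_within[OF W])
      have z0: "z0 \<in> cball 0 1" using near[OF \<open>j < n\<close>, of "s j"] h by (auto simp: z0_def I_def sS)
      show "norm (G z - G z0) \<le> \<epsilon>" if "z \<in> cball 0 1 \<inter> ball z0 \<delta>" for z
        using \<delta>(2)[OF z0, of z] that by (simp add: dist_norm norm_minus_commute)
    qed (use near[OF that(1,2)] near[OF that(1,3)] in \<open>auto simp: z0_def\<close>)
    hence "norm ((W (\<gamma> t) - W (\<gamma> u)) - G z0 * (\<gamma> t - \<gamma> u)) \<le> \<epsilon> * norm (\<gamma> t - \<gamma> u)"
      by (simp add: algebra_simps)
    hence "norm (G z0 * (\<gamma> t - \<gamma> u)) - \<epsilon> * norm (\<gamma> t - \<gamma> u) \<le> norm (W (\<gamma> t) - W (\<gamma> u))"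
      using norm_triangle_ineq2[of "G z0 * (\<gamma> t - \<gamma> u)" "W (\<gamma> t) - W (\<gamma> u)"] by (simp add: norm_minus_commute)
    hence "(norm (G z0) - \<epsilon>) * norm (\<gamma> t - \<gamma> u) \<le> norm (W (\<gamma> t) - W (\<gamma> u))"
      unfolding norm_mult by (simp add: algebra_simps)
    thus ?thesis by (simp add: k_def z0_def dist_norm max_def)
  qed
  have IM: "I j \<in> sets M" "emeasure M (I j) = curve_length \<gamma> (I j)" if "j < n" for j
    unfolding I_def using that sA[of j] sA[of "Suc j"] smono[of j "Suc j"] by (auto intro!: M)
  have k0: "k j \<ge> 0" for j by (simp add: k_def)
  \<comment> \<open>Neighbouring pieces share an end point, which is counted twice; this is harmless
    in an upper bound.\<close>
  have "?I \<le> (\<integral>\<^sup>+t. (\<Sum>j<n. ennreal (k j + 2 * \<epsilon>) * indicator (I j) t) \<partial>M)"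
  proof (rule nn_integral_mono)
    fix t
    show "ennreal (norm (G (\<gamma> t))) * indicator {a..b} t \<le> (\<Sum>j<n. ennreal (k j + 2 * \<epsilon>) * indicator (I j) t)"
    proof (cases "t \<in> {a..b}")
      case True
      have "\<exists>j<m. t \<in> I j" if "0 < m" "t \<le> s m" for m
        using that
      proof (induction m)
        case (Suc m)
        show ?case
        proof (cases "m > 0 \<and> t \<le> s m")
          case False
          hence "t \<in> I m" using Suc.prems True s0(1) by (auto simp: I_def)
          thus ?thesis by blast
        qed (use Suc in \<open>auto intro: less_SucI\<close>)
      qed simp
      from this[of n] obtain j where j: "j < n" "t \<in> I j" using True n s0 by auto
      have "ennreal (norm (G (\<gamma> t))) * indicator {a..b} t \<le> ennreal (k j + 2 * \<epsilon>) * indicator (I j) t"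
        using gk[OF j] j True by (simp add: ennreal_leI)
      also have "\<dots> \<le> (\<Sum>j<n. ennreal (k j + 2 * \<epsilon>) * indicator (I j) t)"
        by (rule member_le_sum) (use j in auto)
      finally show ?thesis .
    qed simp
  qed
  also have "\<dots> = (\<Sum>j<n. ennreal (k j + 2 * \<epsilon>) * curve_length \<gamma> (I j))"
    using IM by (subst nn_integral_sum) (auto simp: nn_integral_cmult)
  also have "\<dots> = (\<Sum>j<n. ennreal (k j) * curve_length \<gamma> (I j)) + ennreal (2 * \<epsilon>) * (\<Sum>j<n. curve_length \<gamma> (I j))"
    using k0 \<epsilon> by (simp add: ennreal_plus distrib_right sum.distrib sum_distrib_left)
  also have "\<dots> \<le> (\<Sum>j<n. curve_length (W \<circ> \<gamma>) (I j)) + ennreal (2 * \<epsilon>) * (\<Sum>j<n. curve_length \<gamma> (I j))"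
    by (intro add_right_mono sum_mono curve_length_scale_le k0 Wk) auto
  also have "\<dots> \<le> curve_length (W \<circ> \<gamma>) A + ennreal (2 * \<epsilon>) * curve_length \<gamma> A"
  proof -
    have "(\<Sum>j<n. curve_length \<eta> (I j)) \<le> curve_length \<eta> A" for \<eta>
      using sum_curve_length_le[of n s \<eta>] smono curve_length_mono[OF sub, of \<eta>] s0 unfolding I_def
      by (metis le_SucI order_refl order_trans)
    thus ?thesis by (intro add_mono mult_left_mono) auto
  qed
  also have "\<dots> \<le> ennreal ?B + ennreal (2 * \<epsilon>) * ennreal (4 * pi)"
    by (intro add_mono mult_left_mono curve_length_primitive_le[OF R W G C] lenA) auto
  also have "ennreal (2 * \<epsilon>) * ennreal (4 * pi) = ennreal e"
    using \<epsilon> by (simp add: ennreal_mult[symmetric] \<epsilon>_def)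
  finally show "?I \<le> ennreal ?B + ennreal e" .
qed

text \<open>The bound for compact arcs does not depend on the arc, so monotone convergence along an
  exhaustion extends it to curves without end points.\<close>

theorem Gabriel_convex_curve:
  assumes R: "R > 1" and hol: "G holomorphic_on ball 0 R"
    and C: "convex_curve \<gamma> A" "\<gamma> ` A \<subseteq> ball 0 1"
  shows "(\<integral>\<^sup>+t. ennreal (norm (G (\<gamma> t))) \<partial>arc_length_measure \<gamma> A) \<le> ennreal (2 * integral {0..2*pi} (\<lambda>t. norm (G (cis t))))"
    (is "nn_integral ?M _ \<le> ?B")
proof (cases "A = {}")
  case True
  have "space ?M = {}" using space_arc_length_measure[of A] C True by (simp add: convex_curve_def)
  thus ?thesis by (simp add: nn_integral_empty)
next
  case False
  have A: "is_interval A" "continuous_on A \<gamma>" using C by (auto simp: convex_curve_def)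
  obtain W where W: "\<And>z. norm z < R \<Longrightarrow> (W has_field_derivative G z) (at z)"
    using holomorphic_convex_primitive'[OF convex_ball open_ball hol]
    by (metis at_within_open mem_ball_0 open_ball)
  have cG: "continuous_on (cball 0 1) G"
    by (rule continuous_on_subset[OF holomorphic_on_imp_continuous_on[OF hol]]) (use R in auto)
  show ?thesis
  proof (rule arc_length_measure_cases[OF A(1), of \<gamma>])
    assume z: "\<And>X. emeasure ?M X = 0"
    have "AE t in ?M. False"
      by (rule AE_I[of _ _ "space ?M"]) (auto simp: z)
    hence "nn_integral ?M (\<lambda>t. ennreal (norm (G (\<gamma> t)))) = (\<integral>\<^sup>+t. 0 \<partial>?M)"
      by (intro nn_integral_cong_AE) (auto elim: eventually_mono)
    thus ?thesis by simp
  next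
    assume M: "\<And>a b. a \<in> A \<Longrightarrow> b \<in> A \<Longrightarrow> a \<le> b \<Longrightarrow> emeasure ?M {a..b} = curve_length \<gamma> {a..b}"
    have M': "{a..b} \<in> sets ?M" if "a \<in> A" "b \<in> A" "a \<le> b" for a b
      unfolding sets_arc_length_measure[OF A(1)] using that by (intro sigma_sets.Basic image_eqI[of _ _ "(a, b)"]) auto
    obtain a b where ab: "\<And>n. a n \<in> A" "\<And>n. b n \<in> A" "\<And>n. a n \<le> b n"
      "incseq (\<lambda>n. {a n..b n})" "(\<Union>n. {a n..b n}) = A"
      by (rule interval_countable_exhaustion[OF A(1) False]) (rule that)
    have meas: "(\<lambda>t. ennreal (norm (G (\<gamma> t)))) \<in> borel_measurable ?M"
    proof -
      have "continuous_on A (\<lambda>t. norm (G (\<gamma> t)))"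
        using C(2) by (intro continuous_intros continuous_on_compose2[OF cG A(2)]) auto
      from borel_measurable_arc_length_measure[OF A(1) this] show ?thesis by measurable
    qed
    have "(\<integral>\<^sup>+t. ennreal (norm (G (\<gamma> t))) \<partial>?M) = (\<integral>\<^sup>+t. (SUP n. ennreal (norm (G (\<gamma> t))) * indicator {a n..b n} t) \<partial>?M)"
    proof (rule nn_integral_cong)
      fix t assume "t \<in> space ?M"
      hence "t \<in> A" using space_arc_length_measure[OF A(1)] by simp
      then obtain n where n: "t \<in> {a n..b n}" using ab(5) by blast
      show "ennreal (norm (G (\<gamma> t))) = (SUP n. ennreal (norm (G (\<gamma> t))) * indicator {a n..b n} t)"
      proof (rule antisym)
        show "ennreal (norm (G (\<gamma> t))) \<le> (SUP n. ennreal (norm (G (\<gamma> t))) * indicator {a n..b n} t)"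
          by (rule SUP_upper2[of n]) (use n in auto)
      qed (auto intro!: SUP_least simp: indicator_def)
    qed
    also have "\<dots> = (SUP n. \<integral>\<^sup>+t. ennreal (norm (G (\<gamma> t))) * indicator {a n..b n} t \<partial>?M)"
    proof (rule nn_integral_monotone_convergence_SUP)
      show "incseq (\<lambda>n t. ennreal (norm (G (\<gamma> t))) * indicator {a n..b n} t)"
      proof (intro monoI le_funI mult_left_mono)
        fix m n :: nat and t assume "m \<le> n"
        hence "{a m..b m} \<subseteq> {a n..b n}" using ab(4) by (rule monoD[rotated])
        thus "indicator {a m..b m} t \<le> (indicator {a n..b n} t :: ennreal)" by (rule indicator_leI[OF subsetD])
      qed simp
      show "(\<lambda>t. ennreal (norm (G (\<gamma> t))) * indicator {a n..b n} t) \<in> borel_measurable ?M" for n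
        using meas M'[OF ab(1,2,3)] by (intro borel_measurable_times_ennreal borel_measurable_indicator)
    qed
    also have "\<dots> \<le> ?B"
      by (intro SUP_least nn_integral_convex_arc_le[OF R W cG C] ab M M') auto
    finally show ?thesis .
  qed
qed

section \<open>A trigonometric inequality\<close>

text \<open>The second derivative of \<open>- x cot x\<close> is
  \<open>2 (sin x - x cos x) / sin x ^ 3\<close>, and \<open>sin x - x cos x\<close> increases from
  0 because its derivative is \<open>x sin x\<close>.\<close>

lemma x_cot_concave:
  fixes a b :: real assumes "0 < a" "a < pi" "0 < b" "b < pi" "0 \<le> l" "l \<le> 1"
  shows "l * (a * cot a) + (1 - l) * (b * cot b) \<le> (l * a + (1 - l) * b) * cot (l * a + (1 - l) * b)"
proof -
  have "convex_on {0<..<pi} (\<lambda>x. - (x * cot x))"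
  proof (rule f''_ge0_imp_convex)
    fix x :: real assume "x \<in> {0<..<pi}"
    hence x: "0 < x" "x < pi" by auto
    have s: "sin x > 0" using x by (rule sin_gt_zero)
    show "((\<lambda>x. - (x * cot x)) has_real_derivative (x / (sin x)^2 - cot x)) (at x)"
      using s by (auto intro!: derivative_eq_intros DERIV_cot simp: field_simps)
    show "((\<lambda>x. x / (sin x)^2 - cot x) has_real_derivative (2 * (sin x - x * cos x) / (sin x)^3)) (at x)"
      using s by (auto intro!: derivative_eq_intros DERIV_cot simp: field_simps power2_eq_square power3_eq_cube)
    have "0 - 0 * cos 0 \<le> sin x - x * cos x"
    proof -
      have "sin 0 - 0 * cos 0 \<le> sin x - x * cos x"
      proof (rule DERIV_nonneg_imp_nondecreasing[of 0 x "\<lambda>x. sin x - x * cos x"])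
        show "\<exists>y. DERIV (\<lambda>x. sin x - x * cos x) u :> y \<and> 0 \<le> y" if "0 \<le> u" "u \<le> x" for u
          using that x by (intro exI[of _ "u * sin u"] conjI)
             (auto intro!: derivative_eq_intros mult_nonneg_nonneg sin_ge_zero)
      qed (use x in auto)
      thus ?thesis by simp
    qed
    thus "0 \<le> 2 * (sin x - x * cos x) / (sin x)^3" using s by auto
  qed auto
  from convex_onD[OF this, of "1-l" a b] assms show ?thesis by (simp add: algebra_simps)
qed

lemma cot_double:
  fixes x :: real assumes "cos x \<noteq> 0" "sin x \<noteq> 0"
  shows "2 * cot (2 * x) = cot x - tan x"
  using assms unfolding cot_def tan_def sin_double cos_double
  by (simp add: field_simps power2_eq_square)

text \<open>Multiplied by \<open>x\<close>, this is the concavity of \<open>y cot y\<close> at the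
  point \<open>t x = (2 - t) x + (t - 1) (2 x)\<close>, with \<open>2 * cot (2 * x)\<close> replaced
  by \<open>cot x - tan x\<close>. It is the monotonicity of \<open>q\<close> in the next
  proof.\<close>

lemma t_cot_ge:
  fixes t x :: real assumes t: "1 < t" "t \<le> 2" and x: "0 < x" "x < pi/2"
  shows "cot x - (t - 1) * tan x \<le> t * cot (t * x)"
proof (cases "t = 2")
  case True
  have c: "cos x > 0" using x by (intro cos_gt_zero) auto
  have s: "sin x > 0" using x by (intro sin_gt_zero) auto
  show ?thesis using cot_double[of x] c s unfolding True by simp
next
  case False
  have c: "cos x > 0" using x by (intro cos_gt_zero) auto
  have s: "sin x > 0" using x by (intro sin_gt_zero) auto
  have "(2 - t) * (x * cot x) + (1 - (2 - t)) * ((2 * x) * cot (2 * x)) \<le> ((2 - t) * x + (1 - (2 - t)) * (2 * x)) * cot ((2 - t) * x + (1 - (2 - t)) * (2 * x))"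
    by (rule x_cot_concave) (use assms in auto)
  also have "(2 - t) * x + (1 - (2 - t)) * (2 * x) = t * x" by (simp add: algebra_simps)
  also have "2 * x * cot (2 * x) = x * (cot x - tan x)"
    using cot_double[of x] c s by simp
  finally have "x * (cot x - (t - 1) * tan x) \<le> x * (t * cot (t * x))"
    by (simp add: algebra_simps)
  thus ?thesis using x by simp
qed

text \<open>The function \<open>h\<close> is smallest at \<open>\<alpha>\<close>. Its derivative is
  a difference of two products, positive for positive arguments; taking logarithms reduces its sign
  to the comparison of \<open>q y\<close> with \<open>q \<alpha>\<close>, and \<open>q\<close> is
  increasing.\<close>

lemma essen_real_inequality:
  fixes t x \<alpha> :: real
  assumes t: "1 < t" "t \<le> 2" and x: "0 \<le> x" "x < pi/2" and \<alpha>: "\<alpha> = pi / (2 * t)"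
  shows "cos \<alpha> powr t + cos \<alpha> powr (t - 1) * sin \<alpha> * cos (t * x) \<le> cos x powr t"
proof -
  have \<alpha>b: "0 < \<alpha>" "\<alpha> < pi/2" using t pi_gt_zero unfolding \<alpha> by (auto simp: field_simps)
  \<comment> \<open>Chosen so that the derivative of \<open>h\<close> vanishes at
    \<open>\<alpha>\<close>, where \<open>t * \<alpha> = pi / 2\<close> and so
    \<open>sin (t * \<alpha>) = 1\<close>.\<close>
  define C where "C = cos \<alpha> powr (t - 1) * sin \<alpha>"
  define h where "h y = cos y powr t - C * cos (t * y)" for y
  define q where "q y = ln (sin (t * y)) - (t - 1) * ln (cos y) - ln (sin y)" for y
  have pos: "cos y > 0" "sin y > 0" "sin (t * y) > 0" if "0 < y" "y < pi/2" for y
  proof -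
    show "cos y > 0" "sin y > 0" using that by (auto intro: cos_gt_zero sin_gt_zero)
    have "t * y \<le> 2 * y" using that t by (intro mult_right_mono) auto
    hence "t * y < pi" using that by linarith
    thus "sin (t * y) > 0" using that t by (intro sin_gt_zero) auto
  qed
  have qd: "(q has_real_derivative (t * cot (t * y) + (t - 1) * tan y - cot y)) (at y)"
    if "0 < y" "y < pi/2" for y
    unfolding q_def using pos[OF that]
    by (auto intro!: derivative_eq_intros simp: cot_def tan_def field_simps)
  have qmono: "q y \<le> q z" if "0 < y" "y \<le> z" "z < pi/2" for y z
  proof (rule DERIV_nonneg_imp_nondecreasing[OF that(2)])
    show "\<exists>d. DERIV q u :> d \<and> 0 \<le> d" if "y \<le> u" "u \<le> z" for u
      using that \<open>0 < y\<close> \<open>z < pi/2\<close> qd[of u] t_cot_ge[OF t, of u]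
      by (intro exI[of _ "t * cot (t * u) + (t - 1) * tan u - cot u"]) auto
  qed
  have Cpos: "C > 0" using pos[OF \<alpha>b] by (simp add: C_def)
  have q\<alpha>: "q \<alpha> = - ln C"
    using pos[OF \<alpha>b] t by (simp add: q_def C_def ln_mult ln_powr) (simp add: \<alpha>)
  have hd: "(h has_real_derivative (t * (C * sin (t * y) - cos y powr (t - 1) * sin y))) (at y)"
    if "0 \<le> y" "y < pi/2" for y
  proof -
    have "cos y > 0" using that by (intro cos_gt_zero_pi) auto
    thus ?thesis unfolding h_def
      by (auto intro!: derivative_eq_intros simp: algebra_simps)
  qed
  have sgn: "C * sin (t * y) \<le> cos y powr (t - 1) * sin y \<longleftrightarrow> q y \<le> q \<alpha>" if "0 < y" "y < pi/2" for y
  proof -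
    have p: "C * sin (t * y) > 0" "cos y powr (t - 1) * sin y > 0" using pos[OF that] Cpos by auto
    have "C * sin (t * y) \<le> cos y powr (t - 1) * sin y \<longleftrightarrow>
       ln (C * sin (t * y)) \<le> ln (cos y powr (t - 1) * sin y)" using p by simp
    also have "\<dots> \<longleftrightarrow> q y \<le> q \<alpha>"
      using pos[OF that] Cpos unfolding q\<alpha> by (auto simp: q_def ln_mult ln_powr)
    finally show ?thesis .
  qed
  have "h \<alpha> \<le> h x"
  proof (cases "x \<le> \<alpha>")
    case True
    show ?thesis
    proof (rule DERIV_nonpos_imp_nonincreasing[OF True])
      fix y assume y: "x \<le> y" "y \<le> \<alpha>"
      have "C * sin (t * y) \<le> cos y powr (t - 1) * sin y"
      proof (cases "y = 0")
        case False
        thus ?thesis using y x \<alpha>b qmono[of y \<alpha>] by (subst sgn) auto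
      qed simp
      thus "\<exists>d. DERIV h y :> d \<and> d \<le> 0" using hd[of y] y x \<alpha>b t
        by (intro exI[of _ "t * (C * sin (t * y) - cos y powr (t - 1) * sin y)"]) (auto intro!: mult_nonneg_nonpos)
    qed
  next
    case False
    hence le: "\<alpha> \<le> x" by simp
    show ?thesis
    proof (rule DERIV_nonneg_imp_nondecreasing[OF le])
      fix y assume y: "\<alpha> \<le> y" "y \<le> x"
      have "C * sin (t * y) \<ge> cos y powr (t - 1) * sin y"
      proof (cases "q y \<le> q \<alpha>")
        case True
        hence "q y = q \<alpha>" using y x \<alpha>b qmono[of \<alpha> y] by auto
        hence "ln (C * sin (t * y)) = ln (cos y powr (t - 1) * sin y)"
          using pos[of y] Cpos y x \<alpha>b unfolding q\<alpha> by (auto simp: q_def ln_mult ln_powr)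
        thus ?thesis using pos[of y] Cpos y x \<alpha>b by (subst (asm) ln_inj_iff) auto
      next
        case False thus ?thesis using sgn[of y] y x \<alpha>b by auto
      qed
      thus "\<exists>d. DERIV h y :> d \<and> d \<ge> 0" using hd[of y] y x \<alpha>b t
        by (intro exI[of _ "t * (C * sin (t * y) - cos y powr (t - 1) * sin y)"]) auto
    qed
  qed
  moreover have t\<alpha>: "t * \<alpha> = pi / 2" using t by (simp add: \<alpha>)
  have "h \<alpha> = cos \<alpha> powr t" unfolding h_def t\<alpha> by simp
  ultimately have "cos \<alpha> powr t \<le> cos x powr t - C * cos (t * x)" by (simp only: h_def)
  thus ?thesis unfolding C_def by linarith
qed

text \<open>Equality holds at argument pi/(2t); the coefficient of the last term makes the two sides
  tangent there.\<close>
lemma norm_powr_le_Re_powr: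
  fixes w :: complex and t :: real
  assumes t: "1 < t" "t \<le> 2" and w: "Re w > 0"
  defines "\<alpha> \<equiv> pi / (2 * t)"
  shows "norm w powr t \<le> (1 / cos \<alpha>) powr t * Re w powr t - tan \<alpha> * Re (w powr of_real t)"
proof -
  \<comment> \<open>Both sides are even in the argument of \<open>w\<close>, so its absolute value
    suffices.\<close>
  define x where "x = \<bar>Im (Ln w)\<bar>"
  have w0: "w \<noteq> 0" using w by auto
  have x: "0 \<le> x" "x < pi/2" using Re_Ln_pos_lt[OF w0] w by (auto simp: x_def)
  have \<alpha>b: "0 < \<alpha>" "\<alpha> < pi/2" using t pi_gt_zero unfolding \<alpha>_def by (auto simp: field_simps)
  have c: "cos \<alpha> > 0" using \<alpha>b by (intro cos_gt_zero) auto
  have cx: "cos x \<ge> 0" using x by (intro cos_ge_zero) auto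
  have e: "w = of_real (norm w) * cis (Im (Ln w))"
    using w0 by (metis Arg_eq_Im_Ln Arg_eq cis_conv_exp)
  have R: "Re w = norm w * cos x"
    by (subst e) (simp add: x_def)
  have P: "Re (w powr of_real t) = norm w powr t * cos (t * x)"
    using w0 by (simp add: powr_def Re_exp x_def abs_if)
  have "cos \<alpha> powr t + cos \<alpha> powr (t - 1) * sin \<alpha> * cos (t * x) \<le> cos x powr t"
    using essen_real_inequality[OF t x] by (simp add: \<alpha>_def)
  hence "(cos \<alpha> powr t + cos \<alpha> powr (t - 1) * sin \<alpha> * cos (t * x)) * (norm w powr t / cos \<alpha> powr t)
     \<le> cos x powr t * (norm w powr t / cos \<alpha> powr t)"
    by (intro mult_right_mono) auto
  also have "cos \<alpha> powr (t - 1) = cos \<alpha> powr t / cos \<alpha>" using c by (simp add: powr_diff)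
  also have "(cos \<alpha> powr t + cos \<alpha> powr t / cos \<alpha> * sin \<alpha> * cos (t * x)) * (norm w powr t / cos \<alpha> powr t)
    = norm w powr t + tan \<alpha> * (norm w powr t * cos (t * x))"
    using c by (simp add: tan_def field_simps)
  also have "cos x powr t * (norm w powr t / cos \<alpha> powr t) = (1 / cos \<alpha>) powr t * Re w powr t"
    using c cx unfolding R by (simp add: powr_divide powr_mult)
  finally show ?thesis by (simp add: P)
qed

section \<open>Poisson integrals\<close>

abbreviation polar :: "real \<Rightarrow> real \<Rightarrow> complex" where
  "polar r \<theta> \<equiv> of_real r * cis \<theta>"

abbreviation circle_powr :: "real \<Rightarrow> real \<Rightarrow> (complex \<Rightarrow> complex) \<Rightarrow> real" where
  "circle_powr p r f \<equiv> integral {0..2*pi} (\<lambda>\<theta>. norm (f (polar r \<theta>)) powr p)"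

text \<open>The Poisson kernel without the factor \<open>1 / (2 * pi)\<close>, written as the real
  part of the Herglotz kernel so that an analytic completion of Poisson integrals can be read
  off.\<close>

definition poisson :: "complex \<Rightarrow> real \<Rightarrow> real" where
  "poisson z \<theta> = Re ((cis \<theta> + z) / (cis \<theta> - z))"

lemma cis_neq_if_norm_less: "norm z < 1 \<Longrightarrow> cis \<theta> \<noteq> z"
  by auto

lemma poisson_eq: "norm z < 1 \<Longrightarrow> poisson z \<theta> = (1 - (norm z)\<^sup>2) / (norm (cis \<theta> - z))\<^sup>2"
proof -
  assume z: "norm z < 1"
  have "(cis \<theta> + z) / (cis \<theta> - z) = (cis \<theta> + z) * cnj (cis \<theta> - z) / of_real ((norm (cis \<theta> - z))\<^sup>2)"
    by (rule complex_div_cnj[of "cis \<theta> + z" "cis \<theta> - z", unfolded of_real_power[symmetric]])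
  hence "poisson z \<theta> = Re ((cis \<theta> + z) * cnj (cis \<theta> - z)) / (norm (cis \<theta> - z))\<^sup>2"
    unfolding poisson_def by (simp only: Re_divide_of_real)
  also have "Re ((cis \<theta> + z) * cnj (cis \<theta> - z)) = (norm (cis \<theta>))\<^sup>2 - (norm z)\<^sup>2"
    unfolding cmod_power2 by (simp add: algebra_simps power2_eq_square)
  finally show ?thesis by simp
qed

lemma poisson_pos: "norm z < 1 \<Longrightarrow> poisson z \<theta> > 0"
  unfolding poisson_eq using cis_neq_if_norm_less[of z \<theta>]
  by (intro divide_pos_pos) (auto simp: power_less_one_iff)

lemma continuous_poisson:
  "norm z < 1 \<Longrightarrow> continuous_on S (poisson z)"
  unfolding poisson_def using cis_neq_if_norm_less by (intro continuous_intros) auto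

lemma continuous_poisson_pair:
  assumes "continuous_on S g" "continuous_on S h" "\<And>x. x \<in> S \<Longrightarrow> norm (g x) < 1"
  shows "continuous_on S (\<lambda>x. poisson (g x) (h x))"
  unfolding poisson_def using assms cis_neq_if_norm_less
  by (intro continuous_intros assms(1,2)) (metis eq_iff_diff_eq_0)

lemma poisson_polar:
  assumes "0 \<le> \<rho>" "\<rho> < 1"
  shows "poisson (polar \<rho> \<eta>) \<theta> = (1 - \<rho>\<^sup>2) / (1 - 2 * \<rho> * cos (\<theta> - \<eta>) + \<rho>\<^sup>2)"
proof -
  have "(norm (cis \<theta> - polar \<rho> \<eta>))\<^sup>2
     = (cos \<theta> * cos \<theta> + sin \<theta> * sin \<theta>) - 2 * \<rho> * cos (\<theta> - \<eta>) + \<rho>\<^sup>2 * (cos \<eta> * cos \<eta> + sin \<eta> * sin \<eta>)"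
    unfolding cmod_power2
    by (simp add: cos_diff algebra_simps power2_eq_square del: sin_cos_squared_add sin_cos_squared_add2 sin_cos_squared_add3)
  also have "\<dots> = 1 - 2 * \<rho> * cos (\<theta> - \<eta>) + \<rho>\<^sup>2" by simp
  finally have "(norm (cis \<theta> - polar \<rho> \<eta>))\<^sup>2 = 1 - 2 * \<rho> * cos (\<theta> - \<eta>) + \<rho>\<^sup>2" .
  thus ?thesis using assms by (subst poisson_eq) (auto simp: norm_mult)
qed

text \<open>The kernel is even in the angle difference. After an exchange of integrals this turns
  the inner one into the total mass of the kernel.\<close>

lemma poisson_commute:
  assumes "0 \<le> \<rho>" "\<rho> < 1"
  shows "poisson (polar \<rho> \<eta>) \<theta> = poisson (polar \<rho> \<theta>) \<eta>"
  unfolding poisson_polar[OF assms] using cos_minus[of "\<theta> - \<eta>"] by simp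

text \<open>On the circle the kernel is the sum of \<open>\<zeta> / (\<zeta> - z)\<close> and
  \<open>cnj z * \<zeta> / (1 - \<zeta> * cnj z)\<close>. With
  \<open>d\<zeta> = \<i> \<zeta> d\<theta>\<close> the first part is Cauchy's kernel; the second
  becomes analytic beyond the closed disc and contributes zero.\<close>

lemma poisson_reproduces_holomorphic:
  assumes R: "R > 1" and F: "F holomorphic_on ball 0 R" and z: "norm z < 1"
  shows "((\<lambda>\<theta>. of_real (poisson z \<theta>) * F (cis \<theta>)) has_integral 2 * of_real pi * F z) {0..2*pi}"
proof -
  have hol1: "F holomorphic_on ball 0 1" "continuous_on (cball 0 1) F"
    using R by (auto intro!: holomorphic_on_subset[OF F] holomorphic_on_imp_continuous_on[OF holomorphic_on_subset[OF F]])
  have "((\<lambda>u. F u / (u - z)) has_contour_integral (2 * of_real pi * \<i> * F z)) (circlepath 0 1)"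
    using Cauchy_integral_circlepath[OF hol1(2,1), of z] z by simp
  hence 1: "((\<lambda>\<theta>. F (cis \<theta>) / (cis \<theta> - z) * (\<i> * cis \<theta>)) has_integral (2 * of_real pi * \<i> * F z)) {0..2*pi}"
    by (simp add: has_contour_integral_unit_circle_iff)
  obtain e where e: "1 < e" "e \<le> R" "\<And>\<zeta>. norm \<zeta> < e \<Longrightarrow> norm (\<zeta> * cnj z) < 1"
    using obtain_radius_conj[OF R z] by blast
  have hol: "(\<lambda>\<zeta>. F \<zeta> * (cnj z / (1 - \<zeta> * cnj z))) holomorphic_on ball 0 e"
  proof (intro holomorphic_intros holomorphic_on_subset[OF F])
    show "ball 0 e \<subseteq> ball 0 R" using e by auto
    fix \<zeta> :: complex assume "\<zeta> \<in> ball 0 e"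
    hence "norm (\<zeta> * cnj z) < 1" by (intro e(3)) simp
    thus "1 - \<zeta> * cnj z \<noteq> 0" by auto
  qed
  have "((\<lambda>\<zeta>. F \<zeta> * (cnj z / (1 - \<zeta> * cnj z))) has_contour_integral 0) (circlepath 0 1)"
    by (rule Cauchy_theorem_disc_simple[OF hol]) (use e in auto)
  hence 2: "((\<lambda>\<theta>. F (cis \<theta>) * (cnj z / (1 - cis \<theta> * cnj z)) * (\<i> * cis \<theta>)) has_integral 0) {0..2*pi}"
    by (simp add: has_contour_integral_unit_circle_iff)
  have 3: "((\<lambda>\<theta>. (F (cis \<theta>) / (cis \<theta> - z) * (\<i> * cis \<theta>) + F (cis \<theta>) * (cnj z / (1 - cis \<theta> * cnj z)) * (\<i> * cis \<theta>)) * (1 / \<i>))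
     has_integral (2 * of_real pi * \<i> * F z + 0) * (1 / \<i>)) {0..2*pi}"
    by (intro has_integral_mult_left has_integral_add 1 2)
  have "(F (cis \<theta>) / (cis \<theta> - z) * (\<i> * cis \<theta>) + F (cis \<theta>) * (cnj z / (1 - cis \<theta> * cnj z)) * (\<i> * cis \<theta>)) * (1 / \<i>)
     = of_real (poisson z \<theta>) * F (cis \<theta>)" for \<theta>
  proof -
    \<comment> \<open>In terms of \<open>w\<close> the Herglotz kernel is \<open>1 + 2 * w\<close>,
      the Cauchy part \<open>1 + w\<close> and the conjugate part \<open>cnj w\<close>.\<close>
    define w where "w = z / (cis \<theta> - z)"
    have d: "cis \<theta> - z \<noteq> 0" using cis_neq_if_norm_less[OF z, of \<theta>] by simp
    have cc: "cis \<theta> * cnj (cis \<theta>) = 1" using complex_norm_square[of "cis \<theta>"] by simp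
    have "(cis \<theta> + z) / (cis \<theta> - z) = 1 + 2 * w" using d by (simp add: w_def field_simps)
    hence p: "of_real (poisson z \<theta>) = 1 + w + cnj w"
      by (simp add: poisson_def complex_eq_iff)
    have a: "cis \<theta> / (cis \<theta> - z) = 1 + w" using d by (simp add: w_def field_simps)
    have "1 - cis \<theta> * cnj z = cis \<theta> * cnj (cis \<theta> - z)" using cc by (simp add: algebra_simps)
    hence b: "cnj z / (1 - cis \<theta> * cnj z) * cis \<theta> = cnj w"
      by (simp add: w_def)
    have "(F (cis \<theta>) / (cis \<theta> - z) * (\<i> * cis \<theta>) + F (cis \<theta>) * (cnj z / (1 - cis \<theta> * cnj z)) * (\<i> * cis \<theta>)) * (1 / \<i>)
       = F (cis \<theta>) * (cis \<theta> / (cis \<theta> - z) + cnj z / (1 - cis \<theta> * cnj z) * cis \<theta>) * (\<i> * (1 / \<i>))"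
      by (simp only: distrib_left distrib_right times_divide_eq_left times_divide_eq_right mult.commute mult.left_commute mult.assoc)
    thus ?thesis unfolding a b p by (simp add: mult.commute)
  qed
  moreover have "(2 * of_real pi * \<i> * F z + 0) * (1 / \<i>) = 2 * of_real pi * F z" by (simp add: field_simps)
  ultimately show ?thesis using 3 by (simp only:)
qed

lemma integral_poisson:
  assumes "norm z < 1" shows "(poisson z has_integral 2 * pi) {0..2*pi}"
proof -
  have "((\<lambda>\<theta>. of_real (poisson z \<theta>) * 1 :: complex) has_integral 2 * of_real pi * 1) {0..2*pi}"
    using poisson_reproduces_holomorphic[of 2 "\<lambda>_. 1" z] assms by simp
  from has_integral_linear[OF this bounded_linear_Re] show ?thesis by (simp add: o_def)
qed

text \<open>The density is a function of the angle with values in a Euclidean space, so one operator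
  serves complex boundary values and real densities such as powers of their norm.\<close>

definition poisson_integral :: "(real \<Rightarrow> 'a::euclidean_space) \<Rightarrow> complex \<Rightarrow> 'a" where
  "poisson_integral \<phi> z = (1 / (2 * pi)) *\<^sub>R integral {0..2*pi} (\<lambda>\<theta>. poisson z \<theta> *\<^sub>R \<phi> \<theta>)"

lemma integrable_poisson:
  fixes \<phi> :: "real \<Rightarrow> 'a::euclidean_space"
  assumes "norm z < 1" "continuous_on {0..2*pi} \<phi>"
  shows "(\<lambda>\<theta>. poisson z \<theta> *\<^sub>R \<phi> \<theta>) integrable_on {0..2*pi}"
  by (intro integrable_continuous_interval continuous_intros continuous_poisson assms)

lemma poisson_integral_mono:
  fixes \<phi> \<psi> :: "real \<Rightarrow> real"
  assumes "norm z < 1" "continuous_on {0..2*pi} \<phi>" "continuous_on {0..2*pi} \<psi>"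
    "\<And>\<theta>. \<theta> \<in> {0..2*pi} \<Longrightarrow> \<phi> \<theta> \<le> \<psi> \<theta>"
  shows "poisson_integral \<phi> z \<le> poisson_integral \<psi> z"
  unfolding poisson_integral_def real_scaleR_def
  using integrable_poisson[OF assms(1,2)] integrable_poisson[OF assms(1,3)] poisson_pos[OF assms(1)] assms(4)
  by (intro mult_left_mono integral_le) (auto intro!: less_imp_le)

lemma poisson_integral_const: "norm z < 1 \<Longrightarrow> poisson_integral (\<lambda>_. c) z = (c::real)"
  unfolding poisson_integral_def using integral_unique[OF integral_poisson[of z]] by simp

lemma norm_poisson_integral_le:
  fixes \<phi> :: "real \<Rightarrow> 'a::euclidean_space"
  assumes z: "norm z < 1" and \<phi>: "continuous_on {0..2*pi} \<phi>"
  shows "norm (poisson_integral \<phi> z) \<le> poisson_integral (\<lambda>\<theta>. norm (\<phi> \<theta>)) z"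
proof -
  have "norm (integral {0..2*pi} (\<lambda>\<theta>. poisson z \<theta> *\<^sub>R \<phi> \<theta>)) \<le> integral {0..2*pi} (\<lambda>\<theta>. poisson z \<theta> *\<^sub>R norm (\<phi> \<theta>))"
    using poisson_pos[OF z] \<phi>
    by (intro integral_norm_bound_integral integrable_poisson z continuous_intros) (auto simp: less_imp_le)
  thus ?thesis unfolding poisson_integral_def by (simp add: divide_right_mono)
qed

section \<open>Jensen's inequality and Fubini for Poisson integrals\<close>

lemma powr_tangent_le:
  fixes x m t :: real assumes "t \<ge> 1" "x \<ge> 0" "m > 0"
  shows "m powr t + t * m powr (t - 1) * (x - m) \<le> x powr t"
proof (cases "x = 0")
  \<comment> \<open>The power is differentiated only on the open half line, so the end point is
    computed directly.\<close>
  case True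
  have "m powr (t - 1) * m = m powr t" using assms by (simp add: powr_diff)
  hence "m powr t + t * m powr (t - 1) * (x - m) = (1 - t) * m powr t" using True by (simp add: algebra_simps)
  also have "\<dots> \<le> 0" using assms by (intro mult_nonpos_nonneg) auto
  finally show ?thesis using True by simp
next
  case False
  have "convex_on {0<..} (\<lambda>x::real. x powr t)"
  proof (rule f''_ge0_imp_convex)
    show "((\<lambda>x. x powr t) has_real_derivative t * x powr (t - 1)) (at x)" if "x \<in> {0<..}" for x
      using that by (auto intro!: derivative_eq_intros)
    show "((\<lambda>x. t * x powr (t - 1)) has_real_derivative t * ((t - 1) * x powr (t - 1 - 1))) (at x)" if "x \<in> {0<..}" for x
      using that by (auto intro!: derivative_eq_intros)
  qed (use assms in auto)
  hence "t * m powr (t - 1) * (x - m) \<le> x powr t - m powr t"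
    by (rule convex_on_imp_above_tangent) (use assms False in \<open>auto intro!: derivative_eq_intros simp: interior_open\<close>)
  thus ?thesis by simp
qed

text \<open>Jensen's inequality: up to the factor \<open>1 / (2 * pi)\<close> the kernel is a
  probability density, against which the tangent of the power at the mean \<open>m\<close> is
  integrated. For \<open>m = 0\<close> the left side is zero.\<close>

lemma poisson_integral_powr_le:
  fixes \<phi> :: "real \<Rightarrow> real"
  assumes z: "norm z < 1" and t: "t \<ge> 1" and c: "continuous_on {0..2*pi} \<phi>" and nn: "\<And>\<theta>. \<phi> \<theta> \<ge> 0"
  shows "poisson_integral \<phi> z powr t \<le> poisson_integral (\<lambda>\<theta>. \<phi> \<theta> powr t) z"
proof -
  define m where "m = poisson_integral \<phi> z"
  have cp: "continuous_on {0..2*pi} (\<lambda>\<theta>. \<phi> \<theta> powr t)"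
    using t nn by (intro continuous_on_powr' c continuous_intros) auto
  have "0 \<le> poisson_integral \<phi> z"
    using poisson_integral_mono[OF z _ c, of "\<lambda>_. 0"] nn by (simp add: poisson_integral_const[OF z])
  hence m0: "m \<ge> 0" by (simp add: m_def)
  show ?thesis
  proof (cases "m = 0")
    case True
    have "0 \<le> poisson_integral (\<lambda>\<theta>. \<phi> \<theta> powr t) z"
      using poisson_integral_mono[OF z _ cp, of "\<lambda>_. 0"] by (simp add: poisson_integral_const[OF z])
    thus ?thesis using True by (simp add: m_def)
  next
    case False
    hence m: "m > 0" using m0 by simp
    define k where "k = t * m powr (t - 1)"
    have "poisson_integral (\<lambda>\<theta>. m powr t + k * (\<phi> \<theta> - m)) z \<le> poisson_integral (\<lambda>\<theta>. \<phi> \<theta> powr t) z"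
      using powr_tangent_le[OF t nn m] by (intro poisson_integral_mono z cp continuous_intros c) (auto simp: k_def)
    also have "poisson_integral (\<lambda>\<theta>. m powr t + k * (\<phi> \<theta> - m)) z = m powr t"
    proof -
      have i: "((\<lambda>\<theta>. poisson z \<theta> *\<^sub>R \<phi> \<theta>) has_integral 2 * pi * m) {0..2*pi}"
        using integrable_integral[OF integrable_poisson[OF z c]] by (simp add: m_def poisson_integral_def)
      have "((\<lambda>\<theta>. (m powr t - k * m) * poisson z \<theta> + k * (poisson z \<theta> *\<^sub>R \<phi> \<theta>)) has_integral
        (m powr t - k * m) * (2 * pi) + k * (2 * pi * m)) {0..2*pi}"
        by (intro has_integral_add has_integral_mult_right integral_poisson z i)
      hence "((\<lambda>\<theta>. poisson z \<theta> *\<^sub>R (m powr t + k * (\<phi> \<theta> - m))) has_integral 2 * pi * m powr t) {0..2*pi}"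
        by (simp add: algebra_simps)
      thus ?thesis unfolding poisson_integral_def by (simp add: integral_unique)
    qed
    finally show ?thesis by (simp add: m_def)
  qed
qed

lemma integral_poisson_integral:
  fixes \<phi> :: "real \<Rightarrow> real"
  assumes \<rho>: "0 \<le> \<rho>" "\<rho> < 1" and c: "continuous_on {0..2*pi} \<phi>"
  shows "integral {0..2*pi} (\<lambda>\<eta>. poisson_integral \<phi> (polar \<rho> \<eta>)) = integral {0..2*pi} \<phi>"
proof -
  have n: "norm (polar \<rho> \<eta>) < 1" for \<eta> using \<rho> by (simp add: norm_mult)
  have c2: "continuous_on (cbox (0, 0) (2*pi, 2*pi)) (\<lambda>(\<eta>, \<theta>). poisson (polar \<rho> \<eta>) \<theta> * \<phi> \<theta>)"
    unfolding case_prod_beta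
    by (intro continuous_intros continuous_poisson_pair n continuous_on_compose2[OF c]) (auto simp: cbox_Pair_eq)
  have "integral {0..2*pi} (\<lambda>\<eta>. integral {0..2*pi} (\<lambda>\<theta>. poisson (polar \<rho> \<eta>) \<theta> * \<phi> \<theta>))
     = integral {0..2*pi} (\<lambda>\<theta>. integral {0..2*pi} (\<lambda>\<eta>. poisson (polar \<rho> \<eta>) \<theta> * \<phi> \<theta>))"
    using integral_swap_continuous[OF c2] by simp
  also have "\<dots> = integral {0..2*pi} (\<lambda>\<theta>. 2 * pi * \<phi> \<theta>)"
  proof (rule integral_cong)
    fix \<theta>
    have "integral {0..2*pi} (\<lambda>\<eta>. poisson (polar \<rho> \<theta>) \<eta> * \<phi> \<theta>) = 2 * pi * \<phi> \<theta>"
      using integral_poisson[OF n, of \<theta>] by (simp add: integral_unique)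
    thus "integral {0..2*pi} (\<lambda>\<eta>. poisson (polar \<rho> \<eta>) \<theta> * \<phi> \<theta>) = 2 * pi * \<phi> \<theta>"
      by (subst poisson_commute[OF \<rho>])
  qed
  finally show ?thesis unfolding poisson_integral_def by simp
qed

lemma Re_times_of_real: "Re (w * of_real x) = Re w * x"
  by simp

text \<open>The Herglotz integral of \<open>\<phi>\<close>. It is real at 0, so that for positive
  \<open>\<phi>\<close> the value of \<open>S powr t\<close> at 0, its mean over circles about 0, is
  positive.\<close>

lemma Schwarz_integral:
  fixes \<phi> :: "real \<Rightarrow> real"
  assumes c: "continuous_on {0..2*pi} \<phi>"
  obtains S where "S holomorphic_on ball 0 1" "\<And>z. norm z < 1 \<Longrightarrow> Re (S z) = poisson_integral \<phi> z" "Im (S 0) = 0"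
proof
  define S where "S z = (1 / (2 * of_real pi)) * integral {0..2*pi} (\<lambda>\<theta>. (cis \<theta> + z) / (cis \<theta> - z) * of_real (\<phi> \<theta>))" for z
  have cz: "continuous_on {0..2*pi} (\<lambda>\<theta>. (cis \<theta> + z) / (cis \<theta> - z) * of_real (\<phi> \<theta>))" if "norm z < 1" for z
    using cis_neq_if_norm_less[OF that] by (intro continuous_intros c) auto
  have "(\<lambda>z. integral (cbox 0 (2*pi)) (\<lambda>\<theta>. (cis \<theta> + z) / (cis \<theta> - z) * of_real (\<phi> \<theta>))) holomorphic_on ball 0 1"
  proof (rule leibniz_rule_holomorphic[where fx = "\<lambda>z \<theta>. 2 * cis \<theta> / (cis \<theta> - z)^2 * of_real (\<phi> \<theta>)"])
    show "((\<lambda>z. (cis \<theta> + z) / (cis \<theta> - z) * of_real (\<phi> \<theta>)) has_field_derivative 2 * cis \<theta> / (cis \<theta> - z)^2 * of_real (\<phi> \<theta>)) (at z within ball 0 1)"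
      if "z \<in> ball 0 1" for z \<theta>
      using cis_neq_if_norm_less[of z \<theta>] that
      by (auto intro!: derivative_eq_intros simp: field_simps power2_eq_square)
    show "(\<lambda>\<theta>. (cis \<theta> + z) / (cis \<theta> - z) * of_real (\<phi> \<theta>)) integrable_on cbox 0 (2*pi)" if "z \<in> ball 0 1" for z
      using cz[of z] that by (auto intro: integrable_continuous_interval)
    show "continuous_on (ball 0 1 \<times> cbox 0 (2*pi)) (\<lambda>(z, \<theta>). 2 * cis \<theta> / (cis \<theta> - z)^2 * of_real (\<phi> \<theta>))"
      unfolding case_prod_beta using cis_neq_if_norm_less
      by (intro continuous_intros continuous_on_compose2[OF c]) auto
  qed auto
  thus "S holomorphic_on ball 0 1" unfolding S_def by (intro holomorphic_intros) simp
  have i: "((\<lambda>\<theta>. (cis \<theta> + z) / (cis \<theta> - z) * of_real (\<phi> \<theta>)) has_integral 2 * of_real pi * S z) {0..2*pi}" if "norm z < 1" for z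
    using integrable_integral[OF integrable_continuous_interval[OF cz[OF that]]] by (simp add: S_def)
  show "Re (S z) = poisson_integral \<phi> z" if "norm z < 1" for z
  proof -
    have "((\<lambda>\<theta>. poisson z \<theta> * \<phi> \<theta>) has_integral 2 * pi * Re (S z)) {0..2*pi}"
      using has_integral_linear[OF i[OF that] bounded_linear_Re]
      unfolding o_def Re_times_of_real by (simp add: poisson_def del: times_divide_eq_left times_divide_eq_right)
    thus ?thesis unfolding poisson_integral_def by (simp add: integral_unique)
  qed
  have "((\<lambda>\<theta>. 0) has_integral 2 * pi * Im (S 0)) {0..2*pi}"
    using has_integral_linear[OF i[of 0] bounded_linear_Im] by (simp add: o_def)
  thus "Im (S 0) = 0" using has_integral_unique[OF _ has_integral_0] by fastforce
qed

section \<open>Harmonic functions on the disc\<close>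

lemma has_real_derivative_along_line:
  fixes u :: "complex \<Rightarrow> real"
  assumes "(u has_derivative (\<lambda>h. a * Re h + b * Im h)) (at (p + of_real x * d))"
  shows "((\<lambda>x. u (p + of_real x * d)) has_real_derivative (a * Re d + b * Im d)) (at x within S)"
proof -
  have "((\<lambda>x. p + of_real x * d) has_derivative (\<lambda>h. of_real h * d)) (at x within S)"
    by (auto intro!: derivative_eq_intros)
  from has_derivative_compose[OF this assms]
  have "((\<lambda>x. u (p + of_real x * d)) has_derivative (\<lambda>h. a * Re (of_real h * d) + b * Im (of_real h * d))) (at x within S)" .
  moreover have "(\<lambda>h. a * Re (of_real h * d) + b * Im (of_real h * d)) = (*) (a * Re d + b * Im d)"
    by (auto simp: fun_eq_iff algebra_simps)
  ultimately show ?thesis by (simp add: has_field_derivative_def)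
qed

text \<open>The mean value theorem, once in each direction, turns a second difference into a mixed
  derivative at an intermediate point. The difference is symmetric in \<open>d\<close> and
  \<open>e\<close>, which permits comparing the two orders of differentiation.\<close>

lemma second_difference_mixed:
  fixes u v w :: "complex \<Rightarrow> real"
  assumes d1: "\<And>p x. p + of_real x * d \<in> S \<Longrightarrow> ((\<lambda>x. u (p + of_real x * d)) has_real_derivative v (p + of_real x * d)) (at x)"
    and d2: "\<And>p x. p + of_real x * e \<in> S \<Longrightarrow> ((\<lambda>x. v (p + of_real x * e)) has_real_derivative w (p + of_real x * e)) (at x)"
    and sub: "\<And>x y. 0 \<le> x \<Longrightarrow> x \<le> h \<Longrightarrow> 0 \<le> y \<Longrightarrow> y \<le> h \<Longrightarrow> z + of_real x * d + of_real y * e \<in> S"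
    and h: "h > 0"
  obtains x y where "0 < x" "x < h" "0 < y" "y < h"
    "u (z + of_real h * d + of_real h * e) - u (z + of_real h * d) - u (z + of_real h * e) + u z
      = h\<^sup>2 * w (z + of_real x * d + of_real y * e)"
proof -
  define \<phi> where "\<phi> x = u (z + of_real h * e + of_real x * d) - u (z + of_real x * d)" for x
  have "\<exists>x. 0 < x \<and> x < h \<and> \<phi> h - \<phi> 0 = (h - 0) * (v (z + of_real h * e + of_real x * d) - v (z + of_real x * d))"
  proof (rule MVT2[OF h])
    fix x assume x: "0 \<le> x" "x \<le> h"
    show "(\<phi> has_real_derivative v (z + of_real h * e + of_real x * d) - v (z + of_real x * d)) (at x)"
      unfolding \<phi>_def using sub[OF x, of h] sub[OF x, of 0] h
      by (intro DERIV_diff d1) (auto simp: algebra_simps)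
  qed
  then obtain x where x: "0 < x" "x < h" "\<phi> h - \<phi> 0 = h * (v (z + of_real h * e + of_real x * d) - v (z + of_real x * d))" by auto
  have "\<exists>y. 0 < y \<and> y < h \<and> v (z + of_real x * d + of_real h * e) - v (z + of_real x * d + of_real 0 * e) = (h - 0) * w (z + of_real x * d + of_real y * e)"
    by (rule MVT2[OF h]) (use sub[of x] x in \<open>auto intro!: d2\<close>)
  then obtain y where y: "0 < y" "y < h" "v (z + of_real x * d + of_real h * e) - v (z + of_real x * d) = h * w (z + of_real x * d + of_real y * e)" by auto
  show thesis
  proof (rule that[OF x(1,2) y(1,2)])
    have "u (z + of_real h * d + of_real h * e) - u (z + of_real h * d) - u (z + of_real h * e) + u z = \<phi> h - \<phi> 0"
      by (simp add: \<phi>_def algebra_simps)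
    also have "\<dots> = h * (h * w (z + of_real x * d + of_real y * e))"
      unfolding x(3) y(3)[symmetric] by (simp add: add_ac)
    finally show "u (z + of_real h * d + of_real h * e) - u (z + of_real h * d) - u (z + of_real h * e) + u z
      = h\<^sup>2 * w (z + of_real x * d + of_real y * e)" by (simp add: power2_eq_square)
  qed
qed

text \<open>\<open>real_harmonic_on\<close> supplies the two mixed partials separately. Both
  represent the same second difference at points arbitrarily near \<open>z\<close>, so continuity
  identifies them. This is one of the Cauchy-Riemann equations for \<open>ux - \<i> * uy\<close>;
  Laplace's equation is the other.\<close>

lemma mixed_partials_eq:
  fixes u ux uy uxx uxy uyx uyy :: "complex \<Rightarrow> real"
  assumes S: "open S" "z \<in> S"
    and u: "\<And>z. z \<in> S \<Longrightarrow> (u has_derivative (\<lambda>h. ux z * Re h + uy z * Im h)) (at z)"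
    and ux: "\<And>z. z \<in> S \<Longrightarrow> (ux has_derivative (\<lambda>h. uxx z * Re h + uxy z * Im h)) (at z)"
    and uy: "\<And>z. z \<in> S \<Longrightarrow> (uy has_derivative (\<lambda>h. uyx z * Re h + uyy z * Im h)) (at z)"
    and c: "continuous_on S uxy" "continuous_on S uyx"
  shows "uxy z = uyx z"
proof (rule ccontr)
  assume ne: "uxy z \<noteq> uyx z"
  define \<epsilon> where "\<epsilon> = \<bar>uxy z - uyx z\<bar> / 2"
  have \<epsilon>: "\<epsilon> > 0" using ne by (simp add: \<epsilon>_def)
  obtain r where r: "r > 0" "ball z r \<subseteq> S" using S by (meson openE)
  have "isCont uxy z" "isCont uyx z" using c S by (auto simp: continuous_on_eq_continuous_at)
  then obtain d1 d2 where d: "d1 > 0" "\<And>q. dist q z < d1 \<Longrightarrow> \<bar>uxy q - uxy z\<bar> < \<epsilon>"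
    "d2 > 0" "\<And>q. dist q z < d2 \<Longrightarrow> \<bar>uyx q - uyx z\<bar> < \<epsilon>"
    unfolding continuous_at_eps_delta dist_real_def using \<epsilon> by metis
  define h where "h = min r (min d1 d2) / 3"
  have h: "h > 0" "2 * h < r" "2 * h < d1" "2 * h < d2" using r d by (auto simp: h_def)
  have near: "dist (z + of_real x * a + of_real y * b) z \<le> 2 * h"
    if "0 \<le> x" "x \<le> h" "0 \<le> y" "y \<le> h" "norm a = 1" "norm b = 1" for x y and a b :: complex
    using norm_triangle_ineq[of "of_real x * a" "of_real y * b"] that
    by (simp add: dist_norm norm_mult)
  have mem: "z + of_real x * a + of_real y * b \<in> S"
    if "0 \<le> x" "x \<le> h" "0 \<le> y" "y \<le> h" "norm a = 1" "norm b = 1" for x y and a b :: complex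
    using near[OF that] h r by (auto simp: dist_commute subset_iff)
  obtain x y where xy: "0 < x" "x < h" "0 < y" "y < h"
    "u (z + of_real h * 1 + of_real h * \<i>) - u (z + of_real h * 1) - u (z + of_real h * \<i>) + u z = h\<^sup>2 * uxy (z + of_real x * 1 + of_real y * \<i>)"
  proof (rule second_difference_mixed[where S = S and u = u and d = 1 and v = ux and e = "\<i>" and w = uxy and h = h and z = z])
    show "((\<lambda>x. u (p + of_real x * 1)) has_real_derivative ux (p + of_real x * 1)) (at x)" if "p + of_real x * 1 \<in> S" for p x
      using has_real_derivative_along_line[OF u[OF that]] by simp
    show "((\<lambda>x. ux (p + of_real x * \<i>)) has_real_derivative uxy (p + of_real x * \<i>)) (at x)" if "p + of_real x * \<i> \<in> S" for p x
      using has_real_derivative_along_line[OF ux[OF that]] by simp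
    show "z + of_real x * 1 + of_real y * \<i> \<in> S" if "0 \<le> x" "x \<le> h" "0 \<le> y" "y \<le> h" for x y
      using mem[OF that, of 1 \<i>] by simp
  qed (use h in auto)
  obtain x' y' where xy': "0 < x'" "x' < h" "0 < y'" "y' < h"
    "u (z + of_real h * \<i> + of_real h * 1) - u (z + of_real h * \<i>) - u (z + of_real h * 1) + u z = h\<^sup>2 * uyx (z + of_real x' * \<i> + of_real y' * 1)"
  proof (rule second_difference_mixed[where S = S and u = u and d = "\<i>" and v = uy and e = 1 and w = uyx and h = h and z = z])
    show "((\<lambda>x. u (p + of_real x * \<i>)) has_real_derivative uy (p + of_real x * \<i>)) (at x)" if "p + of_real x * \<i> \<in> S" for p x
      using has_real_derivative_along_line[OF u[OF that]] by simp
    show "((\<lambda>x. uy (p + of_real x * 1)) has_real_derivative uyx (p + of_real x * 1)) (at x)" if "p + of_real x * 1 \<in> S" for p x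
      using has_real_derivative_along_line[OF uy[OF that]] by simp
    show "z + of_real x * \<i> + of_real y * 1 \<in> S" if "0 \<le> x" "x \<le> h" "0 \<le> y" "y \<le> h" for x y
      using mem[OF that, of \<i> 1] by simp
  qed (use h in auto)
  have "h\<^sup>2 * uxy (z + of_real x * 1 + of_real y * \<i>) = h\<^sup>2 * uyx (z + of_real x' * \<i> + of_real y' * 1)"
    unfolding xy(5)[symmetric] xy'(5)[symmetric] by (simp add: add_ac)
  hence "uxy (z + of_real x * 1 + of_real y * \<i>) = uyx (z + of_real x' * \<i> + of_real y' * 1)" using h by simp
  moreover have "\<bar>uxy (z + of_real x * 1 + of_real y * \<i>) - uxy z\<bar> < \<epsilon>"
    using near[of x y 1 \<i>] xy h by (intro d) simp
  moreover have "\<bar>uyx (z + of_real x' * \<i> + of_real y' * 1) - uyx z\<bar> < \<epsilon>"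
    using near[of x' y' \<i> 1] xy' h by (intro d) simp
  ultimately show False by (simp add: \<epsilon>_def) (smt (verit) field_sum_of_halves)
qed

text \<open>The function \<open>g = ux - \<i> * uy\<close> is holomorphic and has a primitive on the
  convex set. The real part of that primitive has the same gradient as \<open>u\<close>, so the two
  differ by a constant.\<close>

lemma real_harmonic_imp_Re_holomorphic:
  assumes "real_harmonic_on u S" "open S" "convex S"
  obtains H where "H holomorphic_on S" "\<And>z. z \<in> S \<Longrightarrow> u z = Re (H z)"
proof (cases "S = {}")
  case True thus ?thesis using that[of "\<lambda>_. 0"] by simp
next
  case False
  then obtain z0 where z0: "z0 \<in> S" by blast
  obtain ux uy uxx uxy uyx uyy where d:
    "\<And>z. z \<in> S \<Longrightarrow> (u has_derivative (\<lambda>h. ux z * Re h + uy z * Im h)) (at z)"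
    "\<And>z. z \<in> S \<Longrightarrow> (ux has_derivative (\<lambda>h. uxx z * Re h + uxy z * Im h)) (at z)"
    "\<And>z. z \<in> S \<Longrightarrow> (uy has_derivative (\<lambda>h. uyx z * Re h + uyy z * Im h)) (at z)"
    "continuous_on S uxy" "continuous_on S uyx" "\<And>z. z \<in> S \<Longrightarrow> uxx z + uyy z = 0"
    using assms(1) unfolding real_harmonic_on_def by blast
  define g where "g z = of_real (ux z) - \<i> * of_real (uy z)" for z
  have "(g has_field_derivative (of_real (uxx z) - \<i> * of_real (uyx z))) (at z)" if z: "z \<in> S" for z
  proof -
    have "(g has_derivative (\<lambda>h. of_real (uxx z * Re h + uxy z * Im h) - \<i> * of_real (uyx z * Re h + uyy z * Im h))) (at z)"
      unfolding g_def by (intro has_derivative_diff has_derivative_mult_right has_derivative_of_real d z)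
    moreover have "of_real (uxx z * Re h + uxy z * Im h) - \<i> * of_real (uyx z * Re h + uyy z * Im h)
        = (of_real (uxx z) - \<i> * of_real (uyx z)) * h" for h
      using mixed_partials_eq[OF assms(2) z d(1,2,3,4,5)] d(6)[OF z]
      by (simp add: complex_eq_iff eq_neg_iff_add_eq_0[symmetric] algebra_simps)
    ultimately show ?thesis by (simp add: has_field_derivative_def)
  qed
  hence "g holomorphic_on S"
    unfolding holomorphic_on_def field_differentiable_def by (blast intro: has_field_derivative_at_within)
  then obtain H where H: "\<And>z. z \<in> S \<Longrightarrow> (H has_field_derivative g z) (at z within S)"
    using holomorphic_convex_primitive'[OF assms(3,2)] by metis
  have "((\<lambda>z. u z - Re (H z)) has_derivative (\<lambda>h. 0)) (at z within S)" if z: "z \<in> S" for z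
  proof -
    have "((\<lambda>z. u z - Re (H z)) has_derivative (\<lambda>h. (ux z * Re h + uy z * Im h) - Re (g z * h))) (at z within S)"
      using H[OF z] has_derivative_at_withinI[OF d(1)[OF z]]
      by (intro has_derivative_diff has_derivative_Re) (auto simp: has_field_derivative_def)
    thus ?thesis by (simp add: g_def)
  qed
  hence "\<exists>c. \<forall>z\<in>S. u z - Re (H z) = c"
    by (intro has_derivative_zero_constant assms(3)) auto
  then obtain c where c: "\<And>z. z \<in> S \<Longrightarrow> u z - Re (H z) = c" by blast
  have "H holomorphic_on S" unfolding holomorphic_on_def field_differentiable_def using H by blast
  thus ?thesis
    by (intro that[of "\<lambda>z. H z + of_real c"]) (auto intro!: holomorphic_intros simp: c[symmetric])
qed

text \<open>Real and imaginary part of \<open>f\<close> are real parts of holomorphic functions, and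
  dilation by \<open>r\<close> makes these holomorphic on the disc of radius
  \<open>1 / r > 1\<close>, where the reproducing formula applies. For \<open>r = 0\<close> the
  dilation is constant.\<close>

lemma harmonic_poisson:
  assumes f: "harmonic_on f (ball 0 1)" and r: "0 \<le> r" "r < 1" and z: "norm z < 1"
  shows "poisson_integral (\<lambda>\<theta>. f (polar r \<theta>)) z = f (of_real r * z)"
proof (cases "r = 0")
  case True
  have "integral {0..2*pi} (\<lambda>\<theta>. poisson z \<theta> *\<^sub>R f 0) = (2 * pi) *\<^sub>R f 0"
    by (rule integral_unique[OF has_integral_scaleR_left[OF integral_poisson[OF z]]])
  thus ?thesis by (simp add: poisson_integral_def True)
next
  case False
  obtain H1 where H1: "H1 holomorphic_on ball 0 1" "\<And>z. norm z < 1 \<Longrightarrow> Re (f z) = Re (H1 z)"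
    using f real_harmonic_imp_Re_holomorphic[of _ "ball 0 1"] unfolding harmonic_on_def by (metis convex_ball mem_ball_0 open_ball)
  obtain H2 where H2: "H2 holomorphic_on ball 0 1" "\<And>z. norm z < 1 \<Longrightarrow> Im (f z) = Re (H2 z)"
    using f real_harmonic_imp_Re_holomorphic[of _ "ball 0 1"] unfolding harmonic_on_def by (metis convex_ball mem_ball_0 open_ball)
  have n: "norm (of_real r * w) < 1" if "norm w \<le> 1" for w :: complex
    using r that mult_left_mono[of "norm w" 1 r] by (simp add: norm_mult)
  have I: "((\<lambda>\<theta>. poisson z \<theta> * Re (H (polar r \<theta>))) has_integral 2 * pi * Re (H (of_real r * z))) {0..2*pi}"
    if "H holomorphic_on ball 0 1" for H
  proof -
    have "(\<lambda>w. H (of_real r * w)) holomorphic_on ball 0 (1 / r)"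
    proof (rule holomorphic_on_compose_gen[unfolded o_def, of _ _ H "ball 0 1"])
      show "(\<lambda>w::complex. of_real r * w) ` ball 0 (1 / r) \<subseteq> ball 0 1"
        using r False by (auto simp: dist_norm norm_mult field_simps)
    qed (auto intro!: holomorphic_intros that)
    from poisson_reproduces_holomorphic[OF _ this z] r False
    have "((\<lambda>\<theta>. of_real (poisson z \<theta>) * H (polar r \<theta>)) has_integral 2 * of_real pi * H (of_real r * z)) {0..2*pi}"
      by (simp add: field_simps)
    from has_integral_linear[OF this bounded_linear_Re] show ?thesis by (simp add: o_def)
  qed
  have "((\<lambda>\<theta>. of_real (poisson z \<theta> * Re (H1 (polar r \<theta>))) + \<i> * of_real (poisson z \<theta> * Re (H2 (polar r \<theta>))))
     has_integral (of_real (2 * pi * Re (H1 (of_real r * z))) + \<i> * of_real (2 * pi * Re (H2 (of_real r * z))))) {0..2*pi}"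
    by (intro has_integral_add has_integral_mult_right has_integral_of_real I H1(1) H2(1))
  moreover have "of_real (poisson z \<theta> * Re (H1 (polar r \<theta>))) + \<i> * of_real (poisson z \<theta> * Re (H2 (polar r \<theta>)))
    = poisson z \<theta> *\<^sub>R f (polar r \<theta>)" for \<theta>
    using H1(2) H2(2) n[of "cis \<theta>"] by (simp add: complex_eq_iff)
  moreover have "of_real (2 * pi * Re (H1 (of_real r * z))) + \<i> * of_real (2 * pi * Re (H2 (of_real r * z))) = (2 * pi) *\<^sub>R f (of_real r * z)"
    using H1(2) H2(2) n[of z] z by (simp add: complex_eq_iff)
  ultimately have "((\<lambda>\<theta>. poisson z \<theta> *\<^sub>R f (polar r \<theta>)) has_integral (2 * pi) *\<^sub>R f (of_real r * z)) {0..2*pi}"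
    by (simp only:)
  thus ?thesis unfolding poisson_integral_def by (simp add: integral_unique)
qed

lemma harmonic_imp_continuous:
  assumes "harmonic_on f S" shows "continuous_on S f"
proof -
  have "continuous_on S u" if "real_harmonic_on u S" for u
    using that unfolding real_harmonic_on_def
    by (metis continuous_at_imp_continuous_on has_derivative_continuous)
  hence "continuous_on S (\<lambda>z. Complex (Re (f z)) (Im (f z)))"
    using assms unfolding harmonic_on_def by (intro continuous_on_Complex) auto
  thus ?thesis by simp
qed

section \<open>Curve integrals of dilated harmonic functions\<close>

lemma holomorphic_on_dilation:
  assumes "S holomorphic_on ball 0 1" "0 < \<rho>"
  shows "(\<lambda>z. S (of_real \<rho> * z)) holomorphic_on ball 0 (1 / \<rho>)"
proof (rule holomorphic_on_compose_gen[unfolded o_def, of _ _ S "ball 0 1"])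
  show "(\<lambda>w::complex. of_real \<rho> * w) ` ball 0 (1 / \<rho>) \<subseteq> ball 0 1"
    using assms by (auto simp: dist_norm norm_mult field_simps)
qed (auto intro!: holomorphic_intros assms)

lemma integral_norm_powr_le_Re_powr:
  assumes S: "S holomorphic_on ball 0 1" and pos: "\<And>z. norm z < 1 \<Longrightarrow> Re (S z) > 0" and S0: "Im (S 0) = 0"
    and t: "1 < t" "t \<le> 2" and \<rho>: "0 < \<rho>" "\<rho> < 1"
  shows "integral {0..2*pi} (\<lambda>\<theta>. norm (S (polar \<rho> \<theta>)) powr t)
    \<le> (1 / cos (pi / (2 * t))) powr t * integral {0..2*pi} (\<lambda>\<theta>. Re (S (polar \<rho> \<theta>)) powr t)"
proof -
  have n: "norm (polar \<rho> \<theta>) < 1" for \<theta> using \<rho> by (simp add: norm_mult)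
  define T where "T \<theta> = S (polar \<rho> \<theta>)" for \<theta>
  have T: "Re (T \<theta>) > 0" for \<theta> using pos[OF n] by (simp add: T_def)
  have nr: "S z \<notin> \<real>\<^sub>\<le>\<^sub>0" if "norm z < 1" for z using pos[OF that] by (auto simp: complex_nonpos_Reals_iff)
  have cT: "continuous_on A T" for A unfolding T_def
    by (rule continuous_on_compose2[OF holomorphic_on_imp_continuous_on[OF S]]) (use n in \<open>auto intro!: continuous_intros\<close>)
  have c1: "continuous_on A (\<lambda>\<theta>. norm (T \<theta>) powr t)" for A
    using t by (intro continuous_on_powr' continuous_intros cT) auto
  have c2: "continuous_on A (\<lambda>\<theta>. Re (T \<theta>) powr t)" for A
    using t T by (intro continuous_on_powr' continuous_intros cT) (auto intro: less_imp_le)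
  have c3: "continuous_on A (\<lambda>\<theta>. T \<theta> powr of_real t)" for A
    using T t by (intro continuous_on_powr_complex continuous_intros cT) (auto intro: less_imp_le)
  have "(\<lambda>z. S (of_real \<rho> * z) powr of_real t) holomorphic_on ball 0 (1 / \<rho>)"
  proof (intro holomorphic_intros holomorphic_on_dilation[OF S \<rho>(1)])
    fix z :: complex assume "z \<in> ball 0 (1 / \<rho>)"
    hence "norm (of_real \<rho> * z) < 1" using \<rho> by (simp add: norm_mult field_simps)
    thus "S (of_real \<rho> * z) \<notin> \<real>\<^sub>\<le>\<^sub>0" by (rule nr)
  qed
  from poisson_reproduces_holomorphic[OF _ this, of 0] \<rho>
  have "((\<lambda>\<theta>. T \<theta> powr of_real t) has_integral 2 * of_real pi * (S 0 powr of_real t)) {0..2*pi}"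
    by (simp add: poisson_def T_def)
  from has_integral_linear[OF this bounded_linear_Re]
  have "integral {0..2*pi} (\<lambda>\<theta>. Re (T \<theta> powr of_real t)) = 2 * pi * Re (S 0 powr of_real t)"
    by (simp add: o_def integral_unique)
  also have "S 0 = of_real (Re (S 0))" using S0 by (simp add: complex_eq_iff)
  hence "Re (S 0 powr of_real t) = Re (S 0) powr t"
    using pos[of 0] by (metis powr_of_real Re_complex_of_real less_imp_le norm_zero zero_less_one)
  finally have mean: "integral {0..2*pi} (\<lambda>\<theta>. Re (T \<theta> powr of_real t)) \<ge> 0" by simp
  define \<alpha> where "\<alpha> = pi / (2 * t)"
  have \<alpha>b: "0 < \<alpha>" "\<alpha> < pi/2" using t pi_gt_zero unfolding \<alpha>_def by (auto simp: field_simps)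
  have "integral {0..2*pi} (\<lambda>\<theta>. norm (T \<theta>) powr t) \<le>
    integral {0..2*pi} (\<lambda>\<theta>. (1 / cos \<alpha>) powr t * Re (T \<theta>) powr t - tan \<alpha> * Re (T \<theta> powr of_real t))"
    using norm_powr_le_Re_powr[OF t T] unfolding \<alpha>_def
    by (intro integral_le integrable_continuous_interval continuous_intros c1 c2 c3)
  also have "\<dots> = (1 / cos \<alpha>) powr t * integral {0..2*pi} (\<lambda>\<theta>. Re (T \<theta>) powr t) - tan \<alpha> * integral {0..2*pi} (\<lambda>\<theta>. Re (T \<theta> powr of_real t))"
    by (subst integral_diff) (auto intro!: integrable_continuous_interval continuous_intros c2 c3)
  also have "\<dots> \<le> (1 / cos \<alpha>) powr t * integral {0..2*pi} (\<lambda>\<theta>. Re (T \<theta>) powr t)"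
    using mean tan_gt_zero[OF \<alpha>b] by simp
  finally show ?thesis by (simp add: T_def \<alpha>_def)
qed

text \<open>Strict positivity keeps the Herglotz integral in the open right half plane, where its
  powers are analytic.\<close>

lemma poisson_integral_pos:
  fixes \<phi> :: "real \<Rightarrow> real"
  assumes z: "norm z < 1" and c: "continuous_on {0..2*pi} \<phi>" and nn: "\<And>\<theta>. \<phi> \<theta> \<ge> 0"
    and \<theta>: "\<theta> \<in> {0..2*pi}" "\<phi> \<theta> > 0"
  shows "poisson_integral \<phi> z > 0"
proof -
  have c': "continuous_on {0..2*pi} (\<lambda>\<theta>. poisson z \<theta> *\<^sub>R \<phi> \<theta>)"
    by (intro continuous_intros continuous_poisson z c)
  have "integral {0..2*pi} (\<lambda>\<theta>. poisson z \<theta> *\<^sub>R \<phi> \<theta>) \<noteq> 0"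
  proof
    assume "integral {0..2*pi} (\<lambda>\<theta>. poisson z \<theta> *\<^sub>R \<phi> \<theta>) = 0"
    hence "poisson z \<theta> *\<^sub>R \<phi> \<theta> = 0"
      using integral_eq_0_iff[OF c'] \<theta>(1) nn poisson_pos[OF z] by (simp add: less_imp_le)
    thus False using \<theta>(2) poisson_pos[OF z, of \<theta>] by simp
  qed
  moreover have "integral {0..2*pi} (\<lambda>\<theta>. poisson z \<theta> *\<^sub>R \<phi> \<theta>) \<ge> 0"
    using nn poisson_pos[OF z] by (intro integral_nonneg integrable_poisson z c) (auto simp: less_imp_le)
  ultimately show ?thesis by (simp add: poisson_integral_def)
qed

text \<open>The radius \<open>r\<close> is used twice: the values of \<open>f\<close> on the circle
  of radius \<open>r\<close> are continuous Poisson data, and \<open>S\<close> is dilated by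
  \<open>r\<close> again to make \<open>G\<close> holomorphic on the disc of radius
  \<open>1 / r\<close>. Hence \<open>f\<close> is evaluated at \<open>r\<^sup>2\<close> times the
  curve.\<close>

lemma harmonic_curve_integral_le:
  assumes f: "harmonic_on f (ball 0 1)" and r: "0 < r" "r < 1"
    and s: "s \<ge> 1" and t: "1 < t" "t \<le> 2"
    and C: "convex_curve \<gamma> A" "\<gamma> ` A \<subseteq> ball 0 1"
  shows "(\<integral>\<^sup>+u. ennreal (norm (f (of_real (r\<^sup>2) * \<gamma> u)) powr (s * t)) \<partial>arc_length_measure \<gamma> A)
     \<le> ennreal (2 * (1 / cos (pi / (2 * t))) powr t * circle_powr (s * t) r f)"
    (is "?L \<le> _")
proof -
  have A: "is_interval A" using C by (simp add: convex_curve_def)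
  have sp: "u \<in> A" if "u \<in> space (arc_length_measure \<gamma> A)" for u
    using that space_arc_length_measure[OF A] by simp
  have n1: "norm (\<gamma> u) < 1" if "u \<in> A" for u using that C(2) by auto
  define g where "g \<theta> = f (polar r \<theta>)" for \<theta>
  define \<phi> where "\<phi> \<theta> = norm (g \<theta>) powr s" for \<theta>
  have cg: "continuous_on {0..2*pi} g" unfolding g_def
    by (rule continuous_on_compose2[OF harmonic_imp_continuous[OF f]])
       (use r in \<open>auto intro!: continuous_intros simp: norm_mult\<close>)
  have c\<phi>: "continuous_on {0..2*pi} \<phi>" unfolding \<phi>_def
    using s by (intro continuous_on_powr' continuous_intros cg) auto
  have nn: "\<phi> \<theta> \<ge> 0" for \<theta> by (simp add: \<phi>_def)
  have le: "norm (f (of_real r * z)) powr s \<le> poisson_integral \<phi> z" if z: "norm z < 1" for z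
  proof -
    have "norm (f (of_real r * z)) = norm (poisson_integral g z)"
      unfolding g_def using harmonic_poisson[OF f _ r(2) z] r by simp
    also have "\<dots> \<le> poisson_integral (\<lambda>\<theta>. norm (g \<theta>)) z" by (rule norm_poisson_integral_le[OF z cg])
    finally have "norm (f (of_real r * z)) powr s \<le> poisson_integral (\<lambda>\<theta>. norm (g \<theta>)) z powr s"
      using s by (intro powr_mono2) auto
    also have "\<dots> \<le> poisson_integral \<phi> z"
      unfolding \<phi>_def using s by (intro poisson_integral_powr_le z continuous_intros cg) auto
    finally show ?thesis .
  qed
  have pst: "x powr (s * t) = (x powr s) powr t" for x :: real by (simp add: powr_powr)
  show ?thesis
  proof (cases "\<forall>\<theta>\<in>{0..2*pi}. \<phi> \<theta> = 0")
    \<comment> \<open>Vanishing data would put \<open>S\<close> at the branch point of the power.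
      Here the majorant shows that \<open>f\<close> is zero along the dilated curve.\<close>
    case True
    have z0: "f (of_real (r\<^sup>2) * \<gamma> u) = 0" if "u \<in> A" for u
    proof -
      have n: "norm (of_real r * \<gamma> u) < 1" using r n1[OF that] mult_strict_mono[of r 1 "norm (\<gamma> u)" 1] by (simp add: norm_mult)
      have "poisson_integral \<phi> (of_real r * \<gamma> u) \<le> poisson_integral (\<lambda>_. 0) (of_real r * \<gamma> u)"
        by (rule poisson_integral_mono[OF n c\<phi>]) (use True in auto)
      hence "norm (f (of_real r * (of_real r * \<gamma> u))) powr s \<le> 0"
        using le[OF n] poisson_integral_const[OF n, of 0] by linarith
      hence "norm (f (of_real r * (of_real r * \<gamma> u))) powr s = 0"
        using powr_ge_zero[of "norm (f (of_real r * (of_real r * \<gamma> u)))" s] by linarith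
      thus ?thesis by (simp add: power2_eq_square mult.assoc)
    qed
    have "?L = (\<integral>\<^sup>+u. 0 \<partial>arc_length_measure \<gamma> A)"
    proof (rule nn_integral_cong)
      fix u assume "u \<in> space (arc_length_measure \<gamma> A)"
      from z0[OF sp[OF this]]
      show "ennreal (norm (f (of_real (r\<^sup>2) * \<gamma> u)) powr (s * t)) = 0" by simp
    qed
    thus ?thesis by simp
  next
    case False
    then obtain \<theta>0 where \<theta>0: "\<theta>0 \<in> {0..2*pi}" "\<phi> \<theta>0 > 0" using nn by (metis less_eq_real_def)
    obtain S where S: "S holomorphic_on ball 0 1" "\<And>z. norm z < 1 \<Longrightarrow> Re (S z) = poisson_integral \<phi> z" "Im (S 0) = 0"
      using Schwarz_integral[OF c\<phi>] by metis
    have pos: "Re (S z) > 0" if "norm z < 1" for z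
      using poisson_integral_pos[OF that c\<phi> nn \<theta>0] S(2)[OF that] by simp
    define G where "G z = S (of_real r * z) powr of_real t" for z
    have nG: "norm (G z) = norm (S (of_real r * z)) powr t" for z
      by (simp add: G_def norm_powr_real_powr')
    have holG: "G holomorphic_on ball 0 (1 / r)" unfolding G_def
    proof (intro holomorphic_intros holomorphic_on_dilation[OF S(1) r(1)])
      fix z :: complex assume "z \<in> ball 0 (1 / r)"
      hence "norm (of_real r * z) < 1" using r by (simp add: norm_mult field_simps)
      thus "S (of_real r * z) \<notin> \<real>\<^sub>\<le>\<^sub>0" using pos by (force simp: complex_nonpos_Reals_iff)
    qed
    have nr: "norm (polar r \<theta>) < 1" for \<theta> using r by (simp add: norm_mult)
    have "?L \<le> (\<integral>\<^sup>+u. ennreal (norm (G (\<gamma> u))) \<partial>arc_length_measure \<gamma> A)"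
    proof (rule nn_integral_mono, rule ennreal_leI)
      fix u assume "u \<in> space (arc_length_measure \<gamma> A)"
      hence u: "norm (\<gamma> u) < 1" using sp n1 by blast
      have n: "norm (of_real r * \<gamma> u) < 1" using r u mult_strict_mono[of r 1 "norm (\<gamma> u)" 1] by (simp add: norm_mult)
      have "norm (f (of_real (r\<^sup>2) * \<gamma> u)) powr s \<le> Re (S (of_real r * \<gamma> u))"
        using le[OF n] S(2)[OF n] by (simp add: power2_eq_square mult.assoc)
      also have "\<dots> \<le> norm (S (of_real r * \<gamma> u))" by (rule complex_Re_le_cmod)
      finally show "norm (f (of_real (r\<^sup>2) * \<gamma> u)) powr (s * t) \<le> norm (G (\<gamma> u))"
        unfolding nG pst using t by (intro powr_mono2) auto
    qed
    also have "\<dots> \<le> ennreal (2 * integral {0..2*pi} (\<lambda>\<theta>. norm (G (cis \<theta>))))"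
      by (rule Gabriel_convex_curve[OF _ holG C]) (use r in simp)
    also have "\<dots> \<le> ennreal (2 * (1 / cos (pi / (2 * t))) powr t * integral {0..2*pi} (\<lambda>\<theta>. norm (g \<theta>) powr (s * t)))"
    proof (rule ennreal_leI)
      have cP: "continuous_on {0..2*pi} (\<lambda>\<theta>. Re (S (polar r \<theta>)))"
        by (intro continuous_intros continuous_on_compose2[OF holomorphic_on_imp_continuous_on[OF S(1)]])
           (use nr in auto)
      have c\<phi>t: "continuous_on {0..2*pi} (\<lambda>\<theta>. \<phi> \<theta> powr t)"
        using t nn by (intro continuous_on_powr' continuous_intros c\<phi>) auto
      have "integral {0..2*pi} (\<lambda>\<theta>. norm (G (cis \<theta>))) \<le> (1 / cos (pi / (2 * t))) powr t * integral {0..2*pi} (\<lambda>\<theta>. Re (S (polar r \<theta>)) powr t)"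
        unfolding nG by (rule integral_norm_powr_le_Re_powr[OF S(1) pos S(3) t r])
      \<comment> \<open>Jensen again, now with exponent \<open>t\<close>. Integration over the
        circle then removes the Poisson operator and returns the data at radius
        \<open>r\<close>.\<close>
      also have "integral {0..2*pi} (\<lambda>\<theta>. Re (S (polar r \<theta>)) powr t)
          \<le> integral {0..2*pi} (\<lambda>\<theta>. poisson_integral (\<lambda>\<theta>. \<phi> \<theta> powr t) (polar r \<theta>))"
      proof (rule integral_le)
        show "(\<lambda>\<theta>. Re (S (polar r \<theta>)) powr t) integrable_on {0..2*pi}"
          using t pos[OF nr] by (intro integrable_continuous_interval continuous_on_powr' cP continuous_intros) (auto intro: less_imp_le)
        obtain S' where S': "S' holomorphic_on ball 0 1" "\<And>z. norm z < 1 \<Longrightarrow> Re (S' z) = poisson_integral (\<lambda>\<theta>. \<phi> \<theta> powr t) z"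
          using Schwarz_integral[OF c\<phi>t] by metis
        have "continuous_on {0..2*pi} (\<lambda>\<theta>. Re (S' (polar r \<theta>)))"
          by (intro continuous_intros continuous_on_compose2[OF holomorphic_on_imp_continuous_on[OF S'(1)]])
             (use nr in auto)
        thus "(\<lambda>\<theta>. poisson_integral (\<lambda>\<theta>. \<phi> \<theta> powr t) (polar r \<theta>)) integrable_on {0..2*pi}"
          using S'(2)[OF nr] by (intro integrable_continuous_interval) simp
        show "Re (S (polar r \<theta>)) powr t \<le> poisson_integral (\<lambda>\<theta>. \<phi> \<theta> powr t) (polar r \<theta>)" for \<theta>
          unfolding S(2)[OF nr] using t by (intro poisson_integral_powr_le nr c\<phi> nn) auto
      qed
      also have "\<dots> = integral {0..2*pi} (\<lambda>\<theta>. norm (g \<theta>) powr (s * t))"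
        using integral_poisson_integral[OF _ r(2) c\<phi>t] r by (simp add: \<phi>_def pst)
      finally show "2 * integral {0..2*pi} (\<lambda>\<theta>. norm (G (cis \<theta>))) \<le> 2 * (1 / cos (pi / (2 * t))) powr t * integral {0..2*pi} (\<lambda>\<theta>. norm (g \<theta>) powr (s * t))"
        by (simp add: mult_left_mono mult.assoc)
    qed
    finally show ?thesis by (simp add: g_def)
  qed
qed

section \<open>Convergence of dilations in the mean\<close>

lemma continuous_poisson_integral_circle:
  fixes \<phi> :: "real \<Rightarrow> real"
  assumes c: "continuous_on {0..2*pi} \<phi>" and \<rho>: "0 \<le> \<rho>" "\<rho> < 1"
  shows "continuous_on X (\<lambda>\<theta>. poisson_integral \<phi> (polar \<rho> \<theta>))"
proof -
  have n: "norm (polar \<rho> \<theta>) < 1" for \<theta> using \<rho> by (simp add: norm_mult)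
  obtain S where S: "S holomorphic_on ball 0 1" "\<And>z. norm z < 1 \<Longrightarrow> Re (S z) = poisson_integral \<phi> z"
    using Schwarz_integral[OF c] by metis
  have "continuous_on X (\<lambda>\<theta>. Re (S (polar \<rho> \<theta>)))"
    by (intro continuous_intros continuous_on_compose2[OF holomorphic_on_imp_continuous_on[OF S(1)]]) (use n in auto)
  thus ?thesis by (simp add: S(2)[OF n])
qed

text \<open>A class that contains the dilations of \<open>f\<close> and is closed under sums and
  differences by linearity of the integral, so these combinations need no return to second
  derivatives.\<close>

definition poisson_repr :: "(complex \<Rightarrow> complex) \<Rightarrow> bool" where
  "poisson_repr h \<longleftrightarrow> continuous_on (cball 0 1) h \<and>
     (\<forall>z. norm z < 1 \<longrightarrow> poisson_integral (\<lambda>\<theta>. h (cis \<theta>)) z = h z)"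

lemma poisson_repr_dilation:
  assumes "harmonic_on f (ball 0 1)" "0 \<le> r" "r < 1"
  shows "poisson_repr (\<lambda>z. f (of_real r * z))"
proof -
  have "norm (of_real r * z) < 1" if "norm z \<le> 1" for z :: complex
    using assms that mult_left_mono[of "norm z" 1 r] by (simp add: norm_mult)
  hence "continuous_on (cball 0 1) (\<lambda>z. f (of_real r * z))"
    by (intro continuous_on_compose2[OF harmonic_imp_continuous[OF assms(1)]] continuous_intros) auto
  thus ?thesis using harmonic_poisson[OF assms] by (simp add: poisson_repr_def)
qed

lemma poisson_repr_continuous:
  "poisson_repr h \<Longrightarrow> continuous_on X (\<lambda>\<theta>. h (cis \<theta>))"
  unfolding poisson_repr_def by (auto intro!: continuous_on_compose2[of "cball 0 1" h] continuous_intros)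

lemma poisson_repr_add:
  assumes "poisson_repr g" "poisson_repr h" shows "poisson_repr (\<lambda>z. g z + h z)"
  using assms unfolding poisson_repr_def poisson_integral_def scaleR_add_right
  by (auto intro!: continuous_intros simp: integral_add integrable_poisson poisson_repr_continuous[OF assms(1)]
      poisson_repr_continuous[OF assms(2)] scaleR_add_right)

lemma poisson_repr_diff:
  assumes "poisson_repr g" "poisson_repr h" shows "poisson_repr (\<lambda>z. g z - h z)"
  using assms unfolding poisson_repr_def poisson_integral_def scaleR_diff_right
  by (auto intro!: continuous_intros simp: integral_diff integrable_poisson poisson_repr_continuous[OF assms(1)]
      poisson_repr_continuous[OF assms(2)] scaleR_diff_right)

lemma continuous_norm_powr:
  fixes g :: "real \<Rightarrow> complex"
  assumes "continuous_on X g" "p > 0"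
  shows "continuous_on X (\<lambda>\<theta>. norm (g \<theta>) powr p)"
  using assms by (intro continuous_on_powr' continuous_intros) auto

lemma poisson_repr_norm_powr_le:
  assumes h: "poisson_repr h" and p: "p \<ge> 1" and z: "norm z < 1"
  shows "norm (h z) powr p \<le> poisson_integral (\<lambda>\<theta>. norm (h (cis \<theta>)) powr p) z"
proof -
  have c: "continuous_on {0..2*pi} (\<lambda>\<theta>. h (cis \<theta>))" by (rule poisson_repr_continuous[OF h])
  have "norm (h z) \<le> poisson_integral (\<lambda>\<theta>. norm (h (cis \<theta>))) z"
    using norm_poisson_integral_le[OF z c] h z by (simp add: poisson_repr_def)
  hence "norm (h z) powr p \<le> poisson_integral (\<lambda>\<theta>. norm (h (cis \<theta>))) z powr p"
    using p by (intro powr_mono2) auto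
  also have "\<dots> \<le> poisson_integral (\<lambda>\<theta>. norm (h (cis \<theta>)) powr p) z"
    by (intro poisson_integral_powr_le z p continuous_intros c) auto
  finally show ?thesis .
qed

text \<open>The Poisson integral of the boundary values of \<open>norm h powr p\<close> majorises
  this function and has the same integral over each smaller circle as its data have over the
  boundary.\<close>

lemma poisson_repr_contraction:
  assumes h: "poisson_repr h" and p: "p \<ge> 1" and s: "0 \<le> s" "s < 1"
  shows "integral {0..2*pi} (\<lambda>\<theta>. norm (h (polar s \<theta>)) powr p) \<le> integral {0..2*pi} (\<lambda>\<theta>. norm (h (cis \<theta>)) powr p)"
proof -
  have n: "norm (polar s \<theta>) < 1" for \<theta> using s by (simp add: norm_mult)
  have c: "continuous_on {0..2*pi} (\<lambda>\<theta>. norm (h (cis \<theta>)) powr p)"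
    using p by (intro continuous_norm_powr poisson_repr_continuous[OF h]) auto
  have ch: "continuous_on {0..2*pi} (\<lambda>\<theta>. h (polar s \<theta>))"
  proof -
    have "continuous_on (cball 0 1) h" using h by (simp add: poisson_repr_def)
    moreover have "continuous_on {0..2*pi} (\<lambda>\<theta>. polar s \<theta>)" by (intro continuous_intros)
    moreover have "(\<lambda>\<theta>. polar s \<theta>) ` {0..2*pi} \<subseteq> cball 0 1" using s by (auto simp: norm_mult)
    ultimately show ?thesis by (rule continuous_on_compose2)
  qed
  have "integral {0..2*pi} (\<lambda>\<theta>. norm (h (polar s \<theta>)) powr p) \<le>
    integral {0..2*pi} (\<lambda>\<theta>. poisson_integral (\<lambda>\<theta>. norm (h (cis \<theta>)) powr p) (polar s \<theta>))"
  proof (rule integral_le)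
    show "(\<lambda>\<theta>. norm (h (polar s \<theta>)) powr p) integrable_on {0..2*pi}"
      using p by (intro integrable_continuous_interval continuous_norm_powr ch) auto
    show "(\<lambda>\<theta>. poisson_integral (\<lambda>\<theta>. norm (h (cis \<theta>)) powr p) (polar s \<theta>)) integrable_on {0..2*pi}"
      by (intro integrable_continuous_interval continuous_poisson_integral_circle c s)
    show "norm (h (polar s \<theta>)) powr p \<le> poisson_integral (\<lambda>\<theta>. norm (h (cis \<theta>)) powr p) (polar s \<theta>)" for \<theta>
      by (rule poisson_repr_norm_powr_le[OF h p n])
  qed
  thus ?thesis by (simp add: integral_poisson_integral[OF s c])
qed

section \<open>Strict and uniform convexity of p-th powers\<close>

lemma powr_midpoint_less:
  fixes x y p :: real assumes "p > 1" "0 \<le> x" "x < y"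
  shows "(x + y) powr p < 2 powr (p - 1) * (x powr p + y powr p)"
proof -
  \<comment> \<open>The increments of the power over the two halves of the interval are compared by
    the mean value theorem; its derivative is strictly larger on the right half.\<close>
  define m where "m = (x + y) / 2"
  have m: "x < m" "m < y" using assms by (auto simp: m_def)
  have pw: "\<exists>\<xi>. a < \<xi> \<and> \<xi> < b \<and> b powr p - a powr p = (b - a) * (p * \<xi> powr (p - 1))" if ab: "0 \<le> a" "a < b" for a b
  proof -
    have "continuous_on {a..b} (\<lambda>x. x powr p)" using ab assms by (intro continuous_on_powr' continuous_intros) auto
    moreover have "((\<lambda>x. x powr p) has_derivative (*) (p * \<xi> powr (p - 1))) (at \<xi>)" if "a < \<xi>" "\<xi> < b" for \<xi>
    proof -
      have "((\<lambda>x. x powr p) has_real_derivative p * \<xi> powr (p - 1)) (at \<xi>)"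
        using that \<open>0 \<le> a\<close> by (auto intro!: derivative_eq_intros)
      thus ?thesis by (simp add: has_field_derivative_def)
    qed
    ultimately obtain \<xi> where "\<xi> \<in> {a<..<b}" "b powr p - a powr p = p * \<xi> powr (p - 1) * (b - a)"
      using mvt[OF ab(2), of "\<lambda>x. x powr p" "\<lambda>\<xi>. (*) (p * \<xi> powr (p - 1))"] by auto
    thus ?thesis by (intro exI[of _ \<xi>]) (simp add: mult.commute)
  qed
  obtain \<xi>1 where 1: "x < \<xi>1" "\<xi>1 < m" "m powr p - x powr p = (m - x) * (p * \<xi>1 powr (p - 1))" using pw[of x m] m assms by auto
  obtain \<xi>2 where 2: "m < \<xi>2" "\<xi>2 < y" "y powr p - m powr p = (y - m) * (p * \<xi>2 powr (p - 1))" using pw[of m y] m assms by auto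
  have "\<xi>1 powr (p - 1) < \<xi>2 powr (p - 1)" using 1 2 assms by (intro powr_less_mono2) auto
  hence "(m - x) * (p * \<xi>1 powr (p - 1)) < (m - x) * (p * \<xi>2 powr (p - 1))" using m assms by simp
  also have "m - x = y - m" by (simp add: m_def field_simps)
  finally have "m powr p - x powr p < y powr p - m powr p" using 1 2 by (simp add: \<open>m - x = y - m\<close>)
  hence "2 powr (p - 1) * (2 * m powr p) < 2 powr (p - 1) * (x powr p + y powr p)" by simp
  moreover have "2 powr (p - 1) * (2 * m powr p) = (2 * m) powr p"
    using m assms by (simp add: powr_mult powr_diff)
  ultimately have "(2 * m) powr p < 2 powr (p - 1) * (x powr p + y powr p)" by simp
  moreover have "2 * m = x + y" by (simp add: m_def)
  ultimately show ?thesis by (simp only:)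
qed

text \<open>Strictness has two sources: strict convexity of the power if the norms differ, and the
  strict triangle inequality if the norms agree but the points do not.\<close>

lemma norm_powr_midpoint_less:
  fixes a b :: complex assumes p: "p > 1" and "a \<noteq> b"
  shows "norm (a + b) powr p < 2 powr (p - 1) * (norm a powr p + norm b powr p)"
proof (cases "norm a = norm b")
  case False
  have "norm (a + b) powr p \<le> (norm a + norm b) powr p"
    using p by (intro powr_mono2 norm_triangle_ineq) auto
  also have "\<dots> < 2 powr (p - 1) * (norm a powr p + norm b powr p)"
    using powr_midpoint_less[OF p, of "norm a" "norm b"] powr_midpoint_less[OF p, of "norm b" "norm a"] False
    by (cases "norm a < norm b") (auto simp: add.commute)
  finally show ?thesis .
next
  case True
  have "norm (a + b) \<noteq> norm a + norm b"
    using True assms(2) norm_triangle_eq[of a b] by (cases "norm b = 0") auto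
  hence "norm (a + b) < norm a + norm b" using norm_triangle_ineq[of a b] by simp
  hence "norm (a + b) powr p < (2 * norm b) powr p" using p True by (intro powr_less_mono2) auto
  also have "\<dots> = 2 powr (p - 1) * (norm a powr p + norm b powr p)"
    using True p by (simp add: powr_mult powr_diff)
  finally show ?thesis .
qed

text \<open>Compactness and homogeneity make strict convexity uniform.\<close>
lemma norm_powr_uniformly_convex:
  fixes p \<epsilon> :: real assumes p: "p > 1" and \<epsilon>: "\<epsilon> > 0"
  obtains C where "C \<ge> 0" "\<And>a b :: complex. norm (a - b) powr p \<le>
     \<epsilon> * (norm a powr p + norm b powr p) + C * (2 powr (p - 1) * (norm a powr p + norm b powr p) - norm (a + b) powr p)"
proof -
  define \<Phi> where "\<Phi> x = 2 powr (p - 1) * (norm (fst x) powr p + norm (snd x) powr p) - norm (fst x + snd x) powr p" for x :: "complex \<times> complex"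
  have \<Phi>nn: "\<Phi> x \<ge> 0" for x
  proof (cases "fst x = snd x")
    case False thus ?thesis using norm_powr_midpoint_less[OF p False] by (simp add: \<Phi>_def)
  next
    case True
    have "norm (snd x + snd x) = 2 * norm (snd x)" by (simp add: mult_2[symmetric] norm_mult)
    thus ?thesis using True by (simp add: \<Phi>_def powr_mult powr_diff)
  qed
  \<comment> \<open>Normalised pairs for which the term with \<open>\<epsilon>\<close> alone may be
    too small. There \<open>a \<noteq> b\<close>, so by compactness \<open>\<Phi>\<close> has a
    positive lower bound \<open>\<delta>\<close>, and \<open>1 / \<delta>\<close> serves as
    \<open>C\<close> because \<open>norm (a - b) \<le> 1\<close>.\<close>
  define K where "K = {x :: complex \<times> complex. norm (fst x) + norm (snd x) = 1 \<and>
     \<epsilon> * (norm (fst x) powr p + norm (snd x) powr p) \<le> norm (fst x - snd x) powr p}"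
  have cp: "continuous_on UNIV (\<lambda>x. norm (g x) powr p)" if "continuous_on UNIV g" for g :: "complex \<times> complex \<Rightarrow> complex"
    using that p by (intro continuous_on_powr' continuous_intros) auto
  have c\<Phi>: "continuous_on UNIV \<Phi>" unfolding \<Phi>_def by (intro continuous_intros cp)
  have "closed K" unfolding K_def
    by (intro closed_Collect_conj closed_Collect_eq closed_Collect_le continuous_intros cp)
  moreover have "K \<subseteq> cball 0 1 \<times> cball 0 1"
    unfolding K_def by auto (smt (verit) norm_ge_zero)+
  hence "bounded K" using bounded_Times[OF bounded_cball bounded_cball] bounded_subset by blast
  ultimately have "compact K" by (simp add: compact_eq_bounded_closed)
  have "\<exists>\<delta>>0. \<forall>x\<in>K. \<delta> \<le> \<Phi> x"
  proof (cases "K = {}")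
    case True thus ?thesis by (auto intro: exI[of _ 1])
  next
    case False
    obtain x0 where x0: "x0 \<in> K" "\<And>x. x \<in> K \<Longrightarrow> \<Phi> x0 \<le> \<Phi> x"
      using continuous_attains_inf[OF \<open>compact K\<close> False continuous_on_subset[OF c\<Phi>]] by auto
    have "fst x0 \<noteq> snd x0"
    proof
      assume e: "fst x0 = snd x0"
      hence "norm (snd x0) > 0" using x0(1) by (auto simp: K_def)
      hence "\<epsilon> * (norm (fst x0) powr p + norm (snd x0) powr p) > 0" using \<epsilon> by (intro mult_pos_pos add_nonneg_pos) auto
      thus False using x0(1) e p by (simp add: K_def)
    qed
    hence "\<Phi> x0 > 0" using norm_powr_midpoint_less[OF p] by (simp add: \<Phi>_def)
    thus ?thesis using x0 by blast
  qed
  then obtain \<delta> where \<delta>: "\<delta> > 0" "\<And>x. x \<in> K \<Longrightarrow> \<delta> \<le> \<Phi> x" by blast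
  have main: "norm (a - b) powr p \<le> \<epsilon> * (norm a powr p + norm b powr p) + 1 / \<delta> * \<Phi> (a, b)" if ab: "norm a + norm b = 1" for a b
  proof (cases "(a, b) \<in> K")
    case True
    have "norm (a - b) \<le> 1" using norm_triangle_ineq4[of a b] ab by simp
    hence "norm (a - b) powr p \<le> 1 powr p" using p by (intro powr_mono2) auto
    also have "1 powr p \<le> 1 / \<delta> * \<Phi> (a, b)" using \<delta>(1) \<delta>(2)[OF True] by simp
    finally show ?thesis using \<epsilon> by (simp add: add_increasing)
  next
    case False
    hence "norm (a - b) powr p < \<epsilon> * (norm a powr p + norm b powr p)" using ab by (auto simp: K_def)
    thus ?thesis using \<Phi>nn[of "(a, b)"] \<delta>(1) by (simp add: add_increasing2 less_imp_le)
  qed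
  show thesis
  proof (rule that[of "1 / \<delta>"])
    fix a b :: complex
    define s where "s = norm a + norm b"
    show "norm (a - b) powr p \<le>
     \<epsilon> * (norm a powr p + norm b powr p) + 1 / \<delta> * (2 powr (p - 1) * (norm a powr p + norm b powr p) - norm (a + b) powr p)"
    proof (cases "s = 0")
      case True
      hence "a = 0 \<and> b = 0" unfolding s_def by (simp add: add_nonneg_eq_0_iff)
      thus ?thesis by simp
    next
      case False
      hence s: "s > 0" unfolding s_def by (smt (verit) norm_ge_zero)
      define a' b' where "a' = a / of_real s" and "b' = b / of_real s"
      have e: "a = of_real s * a'" "b = of_real s * b'" using s by (auto simp: a'_def b'_def)
      have sc: "norm (of_real s * w) powr p = s powr p * norm w powr p" for w :: complex
        using s by (simp add: norm_mult powr_mult)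
      have sum: "norm (of_real s * a' - of_real s * b') powr p = s powr p * norm (a' - b') powr p"
        "norm (of_real s * a' + of_real s * b') powr p = s powr p * norm (a' + b') powr p"
        by (simp_all only: sc distrib_left[symmetric] right_diff_distrib[symmetric])
      have "norm a' + norm b' = 1" using s by (simp add: a'_def b'_def norm_divide add_divide_distrib[symmetric] s_def[symmetric])
      from mult_left_mono[OF main[OF this], of "s powr p"] show ?thesis
        unfolding e sc sum by (simp add: \<Phi>_def algebra_simps)
    qed
  qed (use \<delta> in simp)
qed

text \<open>Choose \<open>s\<close> so that \<open>I s\<close> is close to the supremum
  \<open>L\<close>. For \<open>r\<close>, \<open>\<rho>\<close> near 1 continuity keeps
  \<open>J (s * r, s * \<rho>)\<close> close to \<open>J (s, s) = 2 powr p * I s\<close>, and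
  contraction carries this lower bound to \<open>J (r, \<rho>)\<close>. Thus the midpoint deficit in
  the uniform convexity inequality is small. No limit function is presupposed.\<close>

lemma harmonic_Lp_Cauchy:
  assumes f: "harmonic_on f (ball 0 1)" and p: "p > 1"
    and bd: "\<And>r. 0 < r \<Longrightarrow> r < 1 \<Longrightarrow> circle_powr p r f \<le> B"
    and \<eta>: "\<eta> > 0"
  obtains s0 where "0 < s0" "s0 < 1" "\<And>r \<rho>. s0 \<le> r \<Longrightarrow> r < 1 \<Longrightarrow> s0 \<le> \<rho> \<Longrightarrow> \<rho> < 1 \<Longrightarrow>
    integral {0..2*pi} (\<lambda>\<theta>. norm (f (polar r \<theta>) - f (polar \<rho> \<theta>)) powr p) \<le> \<eta>"
proof -
  define I where "I r = circle_powr p r f" for r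
  define J where "J x = integral {0..2*pi} (\<lambda>\<theta>. norm (f (polar (fst x) \<theta>) + f (polar (snd x) \<theta>)) powr p)" for x
  define L where "L = Sup (I ` {0<..<1})"
  have bdd: "bdd_above (I ` {0<..<1})" using bd by (intro bdd_aboveI[of _ B]) (auto simp: I_def)
  have IL: "I r \<le> L" if "0 < r" "r < 1" for r
    unfolding L_def using that by (intro cSup_upper bdd) auto
  have "I r \<ge> 0" for r unfolding I_def
    by (metis (no_types, lifting) integral_nonneg not_integrable_integral order_refl powr_ge_zero)
  hence L0: "L \<ge> 0" using IL[of "1/2"] order_trans[of 0 "I (1/2)" L] by simp
  \<comment> \<open>Both \<open>I r\<close> and \<open>I \<rho>\<close> are at most
    \<open>L\<close>, so this choice contributes at most \<open>\<eta> / 2\<close>;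
    \<open>L + 1\<close> avoids a zero denominator.\<close>
  obtain C where C: "C \<ge> 0" "\<And>a b :: complex. norm (a - b) powr p \<le>
     \<eta> / (4 * (L + 1)) * (norm a powr p + norm b powr p) + C * (2 powr (p - 1) * (norm a powr p + norm b powr p) - norm (a + b) powr p)"
    by (rule norm_powr_uniformly_convex[OF p, of "\<eta> / (4 * (L + 1))"]) (use \<eta> L0 that in auto)
  \<comment> \<open>The deficit will be at most \<open>(2 powr p + 1) * \<delta>\<close>, and
    \<open>C\<close> times this is at most \<open>\<eta> / 2\<close>.\<close>
  define \<delta> where "\<delta> = \<eta> / (2 * (C + 1) * (2 powr p + 1))"
  have \<delta>: "\<delta> > 0" using \<eta> C by (simp add: \<delta>_def add_nonneg_pos)
  have "\<exists>x\<in>I ` {0<..<1}. L - \<delta> < x" unfolding L_def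
    using \<delta> by (intro less_cSupD) auto
  then obtain s where s: "0 < s" "s < 1" "L - \<delta> < I s" by auto
  have "continuous_on ({0..<1} \<times> {0..<1}) (\<lambda>x. integral (cbox 0 (2*pi)) (\<lambda>\<theta>. norm (f (polar (fst x) \<theta>) + f (polar (snd x) \<theta>)) powr p))"
  proof (rule integral_continuous_on_param)
    have cf: "continuous_on (({0..<1} \<times> {0..<1}) \<times> cbox 0 (2*pi)) (\<lambda>y. f (of_real (g y) * cis (snd y)))"
      if "continuous_on (({0..<1} \<times> {0..<1}) \<times> cbox 0 (2*pi)) g" "\<And>y. y \<in> ({0..<1} \<times> {0..<1}) \<times> cbox 0 (2*pi) \<Longrightarrow> 0 \<le> g y \<and> g y < 1"
      for g :: "(real \<times> real) \<times> real \<Rightarrow> real"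
      by (rule continuous_on_compose2[OF harmonic_imp_continuous[OF f]])
         (use that in \<open>auto intro!: continuous_intros simp: norm_mult\<close>)
    show "continuous_on (({0..<1} \<times> {0..<1}) \<times> cbox 0 (2*pi)) (\<lambda>(x, \<theta>). norm (f (polar (fst x) \<theta>) + f (polar (snd x) \<theta>)) powr p)"
      unfolding case_prod_beta using p
      by (intro continuous_on_powr' continuous_intros cf) auto
  qed
  hence cJ: "continuous_on ({0..<1} \<times> {0..<1}) J" by (simp add: J_def)
  have ss: "(s, s) \<in> {0..<1} \<times> {0..<1}" using s by simp
  obtain d where d: "d > 0" "\<And>x. x \<in> {0..<1} \<times> {0..<1} \<Longrightarrow> dist x (s, s) < d \<Longrightarrow> dist (J x) (J (s, s)) < \<delta>"
    using cJ ss \<delta> unfolding continuous_on_iff by metis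
  \<comment> \<open>A factor in \<open>[s0, 1)\<close> moves \<open>s\<close> by at most
    \<open>d / 3\<close> in each coordinate.\<close>
  define s0 where "s0 = max (1/2) (1 - d / 3)"
  have s0: "0 < s0" "s0 < 1" using d by (auto simp: s0_def)
  have Jss: "J (s, s) = 2 powr p * I s"
  proof -
    have "norm (w + w) powr p = 2 powr p * norm w powr p" for w :: complex
      by (simp add: mult_2[symmetric] norm_mult powr_mult)
    thus ?thesis by (simp add: J_def I_def)
  qed
  show thesis
  proof (rule that[OF s0])
    fix r \<rho> assume r: "s0 \<le> r" "r < 1" and \<rho>: "s0 \<le> \<rho>" "\<rho> < 1"
    have r0: "0 < r" "0 < \<rho>" using r \<rho> s0 by auto
    have hr: "poisson_repr (\<lambda>z. f (of_real r * z))" and h\<rho>: "poisson_repr (\<lambda>z. f (of_real \<rho> * z))"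
      using poisson_repr_dilation[OF f] r \<rho> r0 by auto
    have c: "continuous_on {0..2*pi} (\<lambda>\<theta>. f (polar r \<theta>))" "continuous_on {0..2*pi} (\<lambda>\<theta>. f (polar \<rho> \<theta>))"
      using poisson_repr_continuous[OF hr] poisson_repr_continuous[OF h\<rho>] by auto
    have "s * r \<in> {0..<1}" "s * \<rho> \<in> {0..<1}"
      using s r \<rho> r0 mult_strict_mono[of s 1 r 1] mult_strict_mono[of s 1 \<rho> 1] by auto
    moreover have "dist (s * r, s * \<rho>) (s, s) < d"
    proof -
      have "\<bar>s * x - s\<bar> \<le> d / 3" if "s0 \<le> x" "x < 1" for x
      proof -
        have "\<bar>s * x - s\<bar> = s * (1 - x)" using that s by (simp add: abs_if algebra_simps)
        also have "\<dots> \<le> 1 * (d / 3)" using that s d by (intro mult_mono) (auto simp: s0_def)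
        finally show ?thesis by simp
      qed
      hence "dist (s * r) s \<le> d / 3" "dist (s * \<rho>) s \<le> d / 3" using r \<rho> by (auto simp: dist_real_def)
      moreover have "dist (s * r, s * \<rho>) (s, s) \<le> dist (s * r) s + dist (s * \<rho>) s"
        by (simp add: dist_Pair_Pair sqrt_sum_squares_le_sum)
      ultimately show ?thesis using d(1) by simp
    qed
    ultimately have "dist (J (s * r, s * \<rho>)) (J (s, s)) < \<delta>" by (intro d) auto
    hence 1: "J (s * r, s * \<rho>) \<ge> 2 powr p * (L - \<delta>) - \<delta>"
    proof -
      have "2 powr p * (L - \<delta>) \<le> 2 powr p * I s" using s(3) by simp
      thus ?thesis using \<open>dist (J (s * r, s * \<rho>)) (J (s, s)) < \<delta>\<close> unfolding Jss dist_real_def by linarith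
    qed
    have "J (s * r, s * \<rho>) \<le> J (r, \<rho>)"
      using poisson_repr_contraction[OF poisson_repr_add[OF hr h\<rho>], of p s] p s
      by (simp add: J_def mult_ac)
    hence 2: "J (r, \<rho>) \<ge> 2 powr p * (L - \<delta>) - \<delta>" using 1 by simp
    have int: "(\<lambda>\<theta>. norm (f (polar r \<theta>)) powr p) integrable_on {0..2*pi}"
       "(\<lambda>\<theta>. norm (f (polar \<rho> \<theta>)) powr p) integrable_on {0..2*pi}"
       "(\<lambda>\<theta>. norm (f (polar r \<theta>) + f (polar \<rho> \<theta>)) powr p) integrable_on {0..2*pi}"
       "(\<lambda>\<theta>. norm (f (polar r \<theta>) - f (polar \<rho> \<theta>)) powr p) integrable_on {0..2*pi}"
      using p by (auto intro!: integrable_continuous_interval continuous_norm_powr continuous_intros c)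
    define k where "k = \<eta> / (4 * (L + 1)) + C * 2 powr (p - 1)"
    have "integral {0..2*pi} (\<lambda>\<theta>. norm (f (polar r \<theta>) - f (polar \<rho> \<theta>)) powr p)
      \<le> integral {0..2*pi} (\<lambda>\<theta>. k * norm (f (polar r \<theta>)) powr p + k * norm (f (polar \<rho> \<theta>)) powr p
           - C * norm (f (polar r \<theta>) + f (polar \<rho> \<theta>)) powr p)"
    proof (rule integral_le)
      show "norm (f (polar r \<theta>) - f (polar \<rho> \<theta>)) powr p \<le> k * norm (f (polar r \<theta>)) powr p + k * norm (f (polar \<rho> \<theta>)) powr p
           - C * norm (f (polar r \<theta>) + f (polar \<rho> \<theta>)) powr p" for \<theta>
        using C(2)[of "f (polar r \<theta>)" "f (polar \<rho> \<theta>)"] by (simp add: k_def algebra_simps)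
    qed (intro int integrable_add integrable_diff integrable_on_mult_right | simp)+
    also have "\<dots> = k * I r + k * I \<rho> - C * J (r, \<rho>)"
      unfolding I_def J_def fst_conv snd_conv using int
      by (subst integral_diff integral_add integral_mult_right; (intro integrable_add integrable_on_mult_right)?; simp)+
    also have "\<dots> \<le> k * L + k * L - C * (2 powr p * (L - \<delta>) - \<delta>)"
    proof -
      have "k \<ge> 0" using C(1) \<eta> L0 by (simp add: k_def)
      thus ?thesis using 2 C(1) IL r \<rho> r0 by (intro diff_mono add_mono mult_left_mono) auto
    qed
    also have "\<dots> = \<eta> * (L / (2 * (L + 1))) + C * ((2 powr p + 1) * \<delta>)"
    proof -
      have "2 * 2 powr (p - 1) = 2 powr p" by (simp add: powr_diff)
      hence "k * L + k * L = \<eta> / (4 * (L + 1)) * (2 * L) + C * (2 powr p * L)"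
        unfolding k_def by (simp add: algebra_simps)
      moreover have "\<eta> / (4 * (L + 1)) * (2 * L) = \<eta> * (L / (2 * (L + 1)))" using L0 by (simp add: field_simps)
      ultimately show ?thesis by (simp add: algebra_simps)
    qed
    also have "\<dots> \<le> \<eta> * (1 / 2) + \<eta> / 2"
    proof (rule add_mono)
      show "\<eta> * (L / (2 * (L + 1))) \<le> \<eta> * (1 / 2)" using \<eta> L0 by (intro mult_left_mono) (auto simp: field_simps)
      have "C * ((2 powr p + 1) * \<delta>) = (C / (C + 1)) * (\<eta> / 2)"
        using C(1) unfolding \<delta>_def by (simp add: field_simps add_nonneg_eq_0_iff)
      also have "\<dots> \<le> 1 * (\<eta> / 2)" using C(1) \<eta> by (intro mult_right_mono) auto
      finally show "C * ((2 powr p + 1) * \<delta>) \<le> \<eta> / 2" by simp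
    qed
    finally show "integral {0..2*pi} (\<lambda>\<theta>. norm (f (polar r \<theta>) - f (polar \<rho> \<theta>)) powr p) \<le> \<eta>" by simp
  qed
qed

section \<open>A weak type maximal inequality\<close>

lemma continuous_antiderivative:
  fixes g :: "real \<Rightarrow> real"
  assumes c: "continuous_on UNIV g"
  obtains Q where "\<And>x. (Q has_real_derivative g x) (at x)"
proof -
  \<comment> \<open>The signed integral from 0 to \<open>x\<close>: one of the two intervals is
    empty or a point. With a global \<open>Q\<close>, shifted and folded integrals become
    differences of its values.\<close>
  define Q where "Q x = integral {0..x} g - integral {x..0} g" for x
  have ci: "g integrable_on {a..b}" for a b
    by (intro integrable_continuous_interval continuous_on_subset[OF c]) auto
  have Q: "Q x = integral {-N..x} g - integral {-N..0} g" if "\<bar>x\<bar> \<le> N" for x N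
  proof (cases "x \<ge> 0")
    case True
    have "integral {-N..0} g + integral {0..x} g = integral {-N..x} g"
      using that True by (intro Henstock_Kurzweil_Integration.integral_combine ci) auto
    moreover have "integral {x..0} g = 0" using True by (cases "x = 0") auto
    ultimately show ?thesis by (simp add: Q_def)
  next
    case False
    have "integral {-N..x} g + integral {x..0} g = integral {-N..0} g"
      using that False by (intro Henstock_Kurzweil_Integration.integral_combine ci) auto
    moreover have "integral {0..x} g = 0" using False by simp
    ultimately show ?thesis by (simp add: Q_def)
  qed
  show thesis
  proof (rule that)
    fix x :: real
    define N where "N = \<bar>x\<bar> + 1"
    have x: "x \<in> {-N<..<N}" by (auto simp: N_def)
    have "((\<lambda>x. integral {-N..x} g) has_real_derivative g x) (at x within {-N..N})"
      by (rule integral_has_real_derivative) (use x c in \<open>auto intro: continuous_on_subset\<close>)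
    hence "((\<lambda>x. integral {-N..x} g) has_real_derivative g x) (at x within {-N<..<N})"
      by (rule has_field_derivative_subset) auto
    from DERIV_diff[OF this DERIV_const[of "integral {-N..0} g"], unfolded diff_0_right]
    have "((\<lambda>x. integral {-N..x} g - integral {-N..0} g) has_real_derivative g x) (at x within {-N<..<N})" .
    hence "((\<lambda>x. integral {-N..x} g - integral {-N..0} g) has_real_derivative g x) (at x)"
      by (simp only: at_within_open[OF x open_greaterThanLessThan])
    thus "(Q has_real_derivative g x) (at x)"
    proof (rule has_field_derivative_transform_within_open)
      show "open {-N<..<N}" "x \<in> {-N<..<N}" using x by auto
      show "integral {-N..y} g - integral {-N..0} g = Q y" if "y \<in> {-N<..<N}" for y
        using that by (intro Q[symmetric]) auto
    qed
  qed
qed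

lemma antiderivative_has_integral:
  fixes Q :: "real \<Rightarrow> real"
  assumes "\<And>x. (Q has_real_derivative g x) (at x)" "a \<le> b"
  shows "(g has_integral Q b - Q a) {a..b}"
  using assms by (intro fundamental_theorem_of_calculus)
    (auto simp: has_real_derivative_iff_has_vector_derivative[symmetric] intro: has_field_derivative_at_within)

lemma antiderivative_periodic:
  fixes Q :: "real \<Rightarrow> real"
  assumes Q: "\<And>x. (Q has_real_derivative g x) (at x)" and per: "\<And>x. g (x + 2 * pi) = g x"
  shows "Q (a + 2 * pi) - Q a = Q (2 * pi) - Q 0"
proof -
  have "((\<lambda>x. Q (x + 2 * pi) - Q x) has_real_derivative 0) (at x)" for x
  proof -
    have "((\<lambda>x. Q (x + 2 * pi)) has_real_derivative g x) (at x)"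
      using Q[of "x + 2 * pi"] unfolding DERIV_shift per by simp
    from DERIV_diff[OF this Q[of x]] show ?thesis by simp
  qed
  hence "\<forall>x. ((\<lambda>x. Q (x + 2 * pi) - Q x) has_real_derivative 0) (at x)" by blast
  from DERIV_isconst_all[OF this, of a 0] show ?thesis by simp
qed

text \<open>Brings the Poisson integral to the half period on which the kernel decreases with the
  distance from \<open>\<theta>\<close>.\<close>

lemma periodic_integral_fold:
  fixes g :: "real \<Rightarrow> real"
  assumes c: "continuous_on UNIV g" and per: "\<And>x. g (x + 2 * pi) = g x"
  shows "((\<lambda>x. g (\<theta> + x) + g (\<theta> - x)) has_integral integral {0..2*pi} g) {0..pi}"
proof -
  obtain Q where Q: "\<And>x. (Q has_real_derivative g x) (at x)" using continuous_antiderivative[OF c] by metis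
  have "((\<lambda>x. Q (\<theta> + x) - Q (\<theta> - x)) has_real_derivative g (\<theta> + x) + g (\<theta> - x)) (at x)" for x
    by (auto intro!: derivative_eq_intros DERIV_chain2[OF Q])
  from antiderivative_has_integral[OF this, of 0 pi]
  have "((\<lambda>x. g (\<theta> + x) + g (\<theta> - x)) has_integral Q (\<theta> + pi) - Q (\<theta> - pi)) {0..pi}" by simp
  also have "Q (\<theta> + pi) - Q (\<theta> - pi) = Q (2 * pi) - Q 0"
    using antiderivative_periodic[OF Q per, of "\<theta> - pi"] by (simp add: add.commute)
  also have "\<dots> = integral {0..2*pi} g"
    using antiderivative_has_integral[OF Q, of 0 "2*pi"] by (simp add: integral_unique)
  finally show ?thesis .
qed

text \<open>The radially decreasing kernel is a mixture of normalised indicators of symmetric intervals;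
  an integration by parts expresses this.\<close>
lemma poisson_integral_le_averages:
  fixes u :: "real \<Rightarrow> real"
  assumes c: "continuous_on UNIV u" and per: "\<And>x. u (x + 2 * pi) = u x"
    and r: "0 \<le> r" "r < 1"
    and avg: "\<And>\<delta>. 0 < \<delta> \<Longrightarrow> \<delta> \<le> pi \<Longrightarrow> integral {\<theta> - \<delta>..\<theta> + \<delta>} u \<le> 2 * \<delta> * m"
  shows "poisson_integral u (polar r \<theta>) \<le> m"
proof -
  define D where "D x = 1 - 2 * r * cos x + r\<^sup>2" for x
  define k where "k x = (1 - r\<^sup>2) / D x" for x
  have D: "D x > 0" for x
  proof -
    have "0 < (1 - r)\<^sup>2" using r by simp
    also have "\<dots> = 1 - 2 * r * 1 + r\<^sup>2" by (simp add: power2_eq_square algebra_simps)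
    also have "\<dots> \<le> D x" unfolding D_def using r by (intro add_right_mono diff_left_mono mult_left_mono) auto
    finally show ?thesis .
  qed
  have r2: "1 - r\<^sup>2 > 0" using r by (simp add: power_less_one_iff)
  have pk: "poisson (polar r \<theta>) \<eta> = k (\<eta> - \<theta>)" for \<eta>
    by (simp add: poisson_polar[OF r] k_def D_def)
  have kper: "k (x + 2 * pi) = k x" and keven: "k (- x) = k x" for x by (simp_all add: k_def D_def)
  have ck: "continuous_on X k" for X
    unfolding k_def D_def using D by (intro continuous_intros) (auto simp: D_def less_imp_neq[symmetric])
  have kd: "(k has_real_derivative - ((1 - r\<^sup>2) * (2 * r * sin x)) / (D x)\<^sup>2) (at x)" for x
    unfolding k_def D_def using D[of x]
    by (auto intro!: derivative_eq_intros simp: D_def power2_eq_square)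
  have fold: "((\<lambda>x. k x * (v (\<theta> + x) + v (\<theta> - x))) has_integral 2 * pi * poisson_integral v (polar r \<theta>)) {0..pi}"
    if "continuous_on UNIV v" "\<And>x. v (x + 2 * pi) = v x" for v :: "real \<Rightarrow> real"
  proof -
    have "continuous_on UNIV (\<lambda>\<eta>. k (\<eta> - \<theta>) * v \<eta>)"
      by (intro continuous_intros continuous_on_compose2[OF ck] that) auto
    moreover have "k (x + 2 * pi - \<theta>) * v (x + 2 * pi) = k (x - \<theta>) * v x" for x
      using kper[of "x - \<theta>"] that(2)[of x] by (simp add: algebra_simps)
    ultimately have "((\<lambda>x. k (\<theta> + x - \<theta>) * v (\<theta> + x) + k (\<theta> - x - \<theta>) * v (\<theta> - x)) has_integral integral {0..2*pi} (\<lambda>\<eta>. k (\<eta> - \<theta>) * v \<eta>)) {0..pi}"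
      by (rule periodic_integral_fold)
    thus ?thesis by (simp add: keven poisson_integral_def pk distrib_left)
  qed
  have n: "norm (polar r \<theta>) < 1" using r by (simp add: norm_mult)
  have fu: "((\<lambda>x. k x * (u (\<theta> + x) + u (\<theta> - x))) has_integral 2 * pi * poisson_integral u (polar r \<theta>)) {0..pi}"
    by (rule fold[OF c per])
  have fm: "((\<lambda>x. k x * (m + m)) has_integral 2 * pi * m) {0..pi}"
    using fold[of "\<lambda>_. m"] by (simp add: poisson_integral_const[OF n])
  obtain Q where Q: "\<And>x. (Q has_real_derivative u x) (at x)" using continuous_antiderivative[OF c] by metis
  \<comment> \<open>Kernel times the excess of \<open>2 * m * x\<close> over the integral of
    \<open>u\<close> on \<open>[\<theta> - x, \<theta> + x]\<close>. On \<open>[0, pi]\<close> the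
    excess is nonnegative by \<open>avg\<close> and the kernel decreases, so the term with
    \<open>k'\<close> has a fixed sign; \<open>\<Psi> 0 = 0\<close> and
    \<open>\<Psi> pi \<ge> 0\<close> finish the estimate.\<close>
  define \<Psi> where "\<Psi> x = k x * (2 * m * x - (Q (\<theta> + x) - Q (\<theta> - x)))" for x
  define k' where "k' x = - ((1 - r\<^sup>2) * (2 * r * sin x)) / (D x)\<^sup>2" for x
  have nn: "2 * m * x - (Q (\<theta> + x) - Q (\<theta> - x)) \<ge> 0" if "0 \<le> x" "x \<le> pi" for x
  proof (cases "x = 0")
    case False
    have "integral {\<theta> - x..\<theta> + x} u = Q (\<theta> + x) - Q (\<theta> - x)"
      using antiderivative_has_integral[OF Q, of "\<theta> - x" "\<theta> + x"] that by (simp add: integral_unique)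
    thus ?thesis using avg[of x] that False by (simp add: mult.commute mult.left_commute)
  qed simp
  have k0: "k x \<ge> 0" for x using r2 D[of x] by (simp add: k_def less_imp_le)
  have "((\<lambda>x. k' x * (2 * m * x - (Q (\<theta> + x) - Q (\<theta> - x))) + k x * (2 * m - (u (\<theta> + x) + u (\<theta> - x)))) has_integral \<Psi> pi - \<Psi> 0) {0..pi}"
  proof (rule fundamental_theorem_of_calculus)
    fix x
    have "(\<Psi> has_real_derivative k' x * (2 * m * x - (Q (\<theta> + x) - Q (\<theta> - x))) + k x * (2 * m - (u (\<theta> + x) + u (\<theta> - x)))) (at x)"
      unfolding \<Psi>_def by (auto intro!: derivative_eq_intros DERIV_chain2[OF Q] kd[folded k'_def] simp: algebra_simps)
    thus "(\<Psi> has_vector_derivative k' x * (2 * m * x - (Q (\<theta> + x) - Q (\<theta> - x))) + k x * (2 * m - (u (\<theta> + x) + u (\<theta> - x)))) (at x within {0..pi})"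
      by (simp add: has_real_derivative_iff_has_vector_derivative has_vector_derivative_at_within)
  qed simp
  moreover have "((\<lambda>x. k x * (m + m) - k x * (u (\<theta> + x) + u (\<theta> - x))) has_integral 2 * pi * m - 2 * pi * poisson_integral u (polar r \<theta>)) {0..pi}"
    by (intro has_integral_diff fm fu)
  ultimately have "\<Psi> pi - \<Psi> 0 \<le> 2 * pi * m - 2 * pi * poisson_integral u (polar r \<theta>)"
  proof (rule has_integral_le)
    fix x assume x: "x \<in> {0..pi}"
    have "k' x \<le> 0" unfolding k'_def using r2 r x D[of x]
      by (intro divide_nonpos_nonneg) (auto intro!: mult_nonneg_nonneg sin_ge_zero)
    hence "k' x * (2 * m * x - (Q (\<theta> + x) - Q (\<theta> - x))) \<le> 0" using nn[of x] x by (intro mult_nonpos_nonneg) auto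
    thus "k' x * (2 * m * x - (Q (\<theta> + x) - Q (\<theta> - x))) + k x * (2 * m - (u (\<theta> + x) + u (\<theta> - x))) \<le> k x * (m + m) - k x * (u (\<theta> + x) + u (\<theta> - x))"
      by (simp add: algebra_simps)
  qed
  moreover have "\<Psi> 0 = 0" by (simp add: \<Psi>_def)
  moreover have "\<Psi> pi \<ge> 0" unfolding \<Psi>_def using nn[of pi] k0 by (intro mult_nonneg_nonneg) auto
  ultimately have "2 * pi * poisson_integral u (polar r \<theta>) \<le> 2 * pi * m" by linarith
  thus ?thesis by simp
qed

text \<open>If a Poisson integral along the radius exceeds \<open>m\<close>, so does the average of
  \<open>u\<close> over some symmetric interval about \<open>\<theta>\<close>. Vitali's lemma
  selects disjoint intervals whose fivefold enlargements form \<open>V\<close>. In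
  \<open>10 / m\<close> the 5 is this enlargement and the 2 counts the periods in
  \<open>[-pi, 3 * pi]\<close>, which contains all selected intervals.\<close>

lemma poisson_maximal_weak_type:
  fixes u :: "real \<Rightarrow> real"
  assumes c: "continuous_on UNIV u" and per: "\<And>x. u (x + 2 * pi) = u x" and nn: "\<And>x. u x \<ge> 0" and m: "m > 0"
  obtains V where "V \<in> sets lborel" "{\<theta>\<in>{0..2*pi}. \<exists>r. 0 \<le> r \<and> r < 1 \<and> poisson_integral u (polar r \<theta>) > m} \<subseteq> V"
    "emeasure lborel V \<le> ennreal (10 / m * integral {0..2*pi} u)"
proof -
  define S where "S = {\<theta>\<in>{0..2*pi}. \<exists>r. 0 \<le> r \<and> r < 1 \<and> poisson_integral u (polar r \<theta>) > m}"
  obtain Q where Q: "\<And>x. (Q has_real_derivative u x) (at x)" using continuous_antiderivative[OF c] by metis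
  have intQ: "integral {a..b} u = Q b - Q a" if "a \<le> b" for a b
    using antiderivative_has_integral[OF Q that] by (simp add: integral_unique)
  have "\<exists>\<delta>. 0 < \<delta> \<and> \<delta> \<le> pi \<and> 2 * \<delta> * m < integral {\<theta> - \<delta>..\<theta> + \<delta>} u" if \<theta>: "\<theta> \<in> S" for \<theta>
  proof (rule ccontr)
    assume "\<not> ?thesis"
    hence a: "integral {\<theta> - \<delta>..\<theta> + \<delta>} u \<le> 2 * \<delta> * m" if "0 < \<delta>" "\<delta> \<le> pi" for \<delta> using that by (meson not_less)
    have "poisson_integral u (polar r \<theta>) \<le> m" if "0 \<le> r" "r < 1" for r
      by (rule poisson_integral_le_averages[OF c per that a])
    thus False using \<theta> by (auto simp: S_def not_less[symmetric])
  qed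
  then obtain \<delta> where \<delta>: "\<And>\<theta>. \<theta> \<in> S \<Longrightarrow> 0 < \<delta> \<theta> \<and> \<delta> \<theta> \<le> pi \<and> 2 * \<delta> \<theta> * m < integral {\<theta> - \<delta> \<theta>..\<theta> + \<delta> \<theta>} u"
    by metis
  have cov: "S \<subseteq> (\<Union>\<theta>\<in>S. cball \<theta> (\<delta> \<theta>))" using \<delta> by (force simp: less_imp_le)
  obtain C where C: "countable C" "C \<subseteq> S" "pairwise (\<lambda>i j. disjnt (cball i (\<delta> i)) (cball j (\<delta> j))) C"
    "S \<subseteq> (\<Union>i\<in>C. cball i (5 * \<delta> i))"
    by (rule Vitali_covering_lemma_cballs[OF cov, of pi]) (use \<delta> that in blast)+
  \<comment> \<open>Numbers the possibly finite family \<open>C\<close>. Indices outside the range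
    of \<open>e\<close> carry the empty set, so sums may run over all naturals.\<close>
  define e where "e = to_nat_on C"
  have inj: "inj_on e C" using C(1) unfolding e_def by (rule inj_on_to_nat_on)
  define X where "X t n = (\<Union>i\<in>{i\<in>C. e i = n}. cball i (t * \<delta> i))" for t n
  have Xs: "X t (e i) = cball i (t * \<delta> i)" if "i \<in> C" for t i
  proof -
    have "{j\<in>C. e j = e i} = {i}" using inj that by (auto simp: inj_on_def)
    thus ?thesis by (simp add: X_def)
  qed
  have X0: "X t n = {}" if "n \<notin> e ` C" for t n using that by (auto simp: X_def)
  have XU: "(\<Union>n. X t n) = (\<Union>i\<in>C. cball i (t * \<delta> i))" for t by (auto simp: X_def)
  have Xm: "X t n \<in> sets lborel" for t n
    by (cases "n \<in> e ` C") (auto simp: Xs X0)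
  define \<nu> where "\<nu> = density lborel (\<lambda>x. ennreal (u x))"
  have bu: "u \<in> borel_measurable borel" using c by (rule borel_measurable_continuous_onI)
  have \<nu>: "emeasure \<nu> {a..b} = ennreal (Q b - Q a)" if "a \<le> b" for a b
    unfolding \<nu>_def using bu
    by (subst emeasure_density) (auto intro!: nn_integral_FTC_Icc that Q nn)
  have disj: "disjoint_family (X 1)"
    unfolding disjoint_family_on_def
  proof (intro ballI impI)
    fix n n' :: nat assume ne: "n \<noteq> n'"
    show "X 1 n \<inter> X 1 n' = {}"
    proof (cases "n \<in> e ` C \<and> n' \<in> e ` C")
      case True
      then obtain i j where ij: "i \<in> C" "j \<in> C" "n = e i" "n' = e j" by blast
      hence "i \<noteq> j" using ne by blast
      hence "disjnt (cball i (\<delta> i)) (cball j (\<delta> j))" using C(3) ij by (auto simp: pairwise_def)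
      thus ?thesis using ij by (simp add: Xs disjnt_def)
    qed (auto simp: X0)
  qed
  have "emeasure lborel (\<Union>n. X 5 n) \<le> (\<Sum>n. emeasure lborel (X 5 n))"
    using Xm by (intro emeasure_subadditive_countably) auto
  also have "\<dots> \<le> (\<Sum>n. ennreal (5 / m) * emeasure \<nu> (X 1 n))"
  proof (intro suminf_le summableI)
    fix n
    show "emeasure lborel (X 5 n) \<le> ennreal (5 / m) * emeasure \<nu> (X 1 n)"
    proof (cases "n \<in> e ` C")
      case True
      then obtain i where i: "i \<in> C" "n = e i" by blast
      hence d: "0 < \<delta> i" "2 * \<delta> i * m < Q (i + \<delta> i) - Q (i - \<delta> i)"
        using \<delta>[of i] C(2) intQ[of "i - \<delta> i" "i + \<delta> i"] by auto
      have "emeasure lborel (X 5 n) = ennreal (10 * \<delta> i)" using i d by (simp add: Xs cball_eq_atLeastAtMost)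
      also have "\<dots> \<le> ennreal (5 / m * (Q (i + \<delta> i) - Q (i - \<delta> i)))"
        using d m by (intro ennreal_leI) (simp add: field_simps)
      also have "\<dots> = ennreal (5 / m) * ennreal (Q (i + \<delta> i) - Q (i - \<delta> i))"
        by (rule ennreal_mult') (use m in simp)
      also have "\<dots> = ennreal (5 / m) * emeasure \<nu> (X 1 n)"
        using i d m by (simp add: Xs cball_eq_atLeastAtMost \<nu>)
      finally show ?thesis .
    qed (simp add: X0)
  qed
  also have "\<dots> = ennreal (5 / m) * (\<Sum>n. emeasure \<nu> (X 1 n))" by (rule ennreal_suminf_cmult)
  also have "(\<Sum>n. emeasure \<nu> (X 1 n)) = emeasure \<nu> (\<Union>n. X 1 n)"
    using Xm disj by (intro suminf_emeasure) (auto simp: \<nu>_def)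
  also have "\<dots> \<le> emeasure \<nu> {-pi..3*pi}"
  proof (rule emeasure_mono)
    show "(\<Union>n. X 1 n) \<subseteq> {-pi..3*pi}"
    proof
      fix x assume "x \<in> (\<Union>n. X 1 n)"
      then obtain i where i: "i \<in> C" "x \<in> cball i (1 * \<delta> i)" unfolding XU by blast
      hence "i \<in> S" using C(2) by blast
      hence "0 \<le> i" "i \<le> 2 * pi" "\<delta> i \<le> pi" using \<delta>[of i] by (auto simp: S_def)
      thus "x \<in> {-pi..3*pi}" using i(2) by (auto simp: cball_eq_atLeastAtMost)
    qed
  qed (simp add: \<nu>_def)
  also have "\<dots> = ennreal (Q (3 * pi) - Q (-pi))" by (intro \<nu>) simp
  also have "Q (3 * pi) - Q (-pi) = 2 * integral {0..2*pi} u"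
    using antiderivative_periodic[OF Q per, of "-pi"] antiderivative_periodic[OF Q per, of pi] intQ[of 0 "2*pi"] by simp
  finally have "emeasure lborel (\<Union>n. X 5 n) \<le> ennreal (5 / m) * ennreal (2 * integral {0..2*pi} u)"
    by (simp add: mult_left_mono)
  also have "\<dots> = ennreal (10 / m * integral {0..2*pi} u)"
    using m by (simp add: ennreal_mult'[symmetric])
  finally have "emeasure lborel (\<Union>n. X 5 n) \<le> ennreal (10 / m * integral {0..2*pi} u)" .
  moreover have "S \<subseteq> (\<Union>n. X 5 n)" using C(4) by (simp add: XU)
  ultimately show thesis using Xm by (intro that[of "\<Union>n. X 5 n"]) (auto simp: S_def)
qed

section \<open>Radial limits\<close>

lemma nn_integral_continuous_interval:
  fixes g :: "real \<Rightarrow> real"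
  assumes c: "continuous_on UNIV g" and nn: "\<And>x. g x \<ge> 0" and ab: "a \<le> b"
  shows "(\<integral>\<^sup>+x. ennreal (g x) * indicator {a..b} x \<partial>lborel) = ennreal (integral {a..b} g)"
proof -
  obtain Q where Q: "\<And>x. (Q has_real_derivative g x) (at x)" using continuous_antiderivative[OF c] by metis
  have "(\<integral>\<^sup>+x. ennreal (g x) * indicator {a..b} x \<partial>lborel) = ennreal (Q b - Q a)"
    using borel_measurable_continuous_onI[OF c] by (intro nn_integral_FTC_Icc ab Q nn) auto
  thus ?thesis using antiderivative_has_integral[OF Q ab] by (simp add: integral_unique)
qed

lemma harmonic_continuous_circle:
  assumes f: "harmonic_on f (ball 0 1)" and r: "0 \<le> r" "r < 1"
  shows "continuous_on X (\<lambda>\<theta>. f (polar r \<theta>))"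
  using poisson_repr_continuous[OF poisson_repr_dilation[OF f r]] .

text \<open>Fix \<open>s < 1\<close> near 1. Along a radius, \<open>f\<close> at
  \<open>s * x\<close> is continuous up to \<open>x = 1\<close>, and by the maximal inequality it
  differs from \<open>f\<close> at \<open>x\<close> by at most \<open>\<mu>\<close> for all
  \<open>x\<close>, outside a set of angles of measure at most \<open>\<epsilon>\<close>. Two such
  differences and one small oscillation stay within \<open>3 * \<mu>\<close>.\<close>

lemma harmonic_oscillation_negligible:
  assumes f: "harmonic_on f (ball 0 1)" and p: "p > 1"
    and bd: "\<And>r. 0 < r \<Longrightarrow> r < 1 \<Longrightarrow> circle_powr p r f \<le> B"
    and \<mu>: "\<mu> > 0"
  shows "negligible {\<theta>\<in>{0..2*pi}. \<forall>s<1. \<exists>r r'. s \<le> r \<and> r < 1 \<and> s \<le> r' \<and> r' < 1 \<and>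
     dist (f (polar r \<theta>)) (f (polar r' \<theta>)) > 3 * \<mu>}" (is "negligible ?N")
  unfolding negligible_outer_le
proof (intro allI impI)
  fix \<epsilon> :: real assume \<epsilon>: "\<epsilon> > 0"
  define m where "m = \<mu> powr p"
  have m: "m > 0" using \<mu> by (simp add: m_def)
  \<comment> \<open>Compensates the factor \<open>10 / m\<close> of the maximal inequality.\<close>
  define \<eta> where "\<eta> = \<epsilon> * m / 10"
  have \<eta>: "\<eta> > 0" using \<epsilon> m by (simp add: \<eta>_def)
  obtain s0 where s0: "0 < s0" "s0 < 1" "\<And>r \<rho>. s0 \<le> r \<Longrightarrow> r < 1 \<Longrightarrow> s0 \<le> \<rho> \<Longrightarrow> \<rho> < 1 \<Longrightarrow>
    integral {0..2*pi} (\<lambda>\<theta>. norm (f (polar r \<theta>) - f (polar \<rho> \<theta>)) powr p) \<le> \<eta>"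
    by (rule harmonic_Lp_Cauchy[OF f p _ \<eta>, where B = B]) (use bd that in blast)+
  define s where "s = (1 + s0) / 2"
  have s: "s0 < s" "s < 1" "0 < s" using s0 by (auto simp: s_def)
  \<comment> \<open>Radii increasing to 1 from \<open>s0 / s\<close>, so that
    \<open>\<rho> n\<close> and \<open>\<rho> n * s\<close> are both at least \<open>s0\<close>. The
    maximal inequality requires continuous boundary data and is therefore applied to the dilations
    \<open>h n\<close>, with a bound independent of \<open>n\<close>.\<close>
  define \<rho> where "\<rho> n = 1 - (1 - s0 / s) / real (Suc n)" for n
  have q: "0 < s0 / s" "s0 / s < 1" "s0 \<le> s0 / s"
    using s s0 mult_left_le[of s s0] by (auto simp: pos_le_divide_eq)
  have \<rho>: "s0 / s \<le> \<rho> n" "\<rho> n < 1" "0 < \<rho> n" "s0 \<le> \<rho> n" "s0 \<le> \<rho> n * s" "\<rho> n * s < 1" for n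
  proof -
    have "(1 - s0 / s) / real (Suc n) \<le> (1 - s0 / s) / 1" using q by (intro divide_left_mono) auto
    thus 1: "s0 / s \<le> \<rho> n" by (simp add: \<rho>_def)
    show 2: "\<rho> n < 1" using q by (simp add: \<rho>_def)
    show 3: "0 < \<rho> n" "s0 \<le> \<rho> n" using 1 q by auto
    show "s0 \<le> \<rho> n * s" using 1 s by (simp add: pos_divide_le_eq)
    show "\<rho> n * s < 1" using 2 3 s mult_strict_mono[of "\<rho> n" 1 s 1] by simp
  qed
  have \<rho>mono: "\<rho> n \<le> \<rho> n'" if "n \<le> n'" for n n'
    unfolding \<rho>_def using that q by (intro diff_left_mono divide_left_mono) auto
  have \<rho>lim: "\<exists>n. x < \<rho> n" if "x < 1" for x
  proof -
    obtain n where "(1 - s0 / s) / (1 - x) < real n" using reals_Archimedean2 by blast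
    hence "(1 - s0 / s) < real (Suc n) * (1 - x)" using that by (simp add: pos_divide_less_eq algebra_simps)
    hence "(1 - s0 / s) / real (Suc n) < 1 - x" by (simp add: pos_divide_less_eq mult.commute)
    thus ?thesis by (intro exI[of _ n]) (simp add: \<rho>_def)
  qed
  define h where "h n z = f (of_real (\<rho> n) * z) - f (of_real (\<rho> n * s) * z)" for n z
  have h: "poisson_repr (h n)" for n
    unfolding h_def using \<rho>[of n] s by (intro poisson_repr_diff poisson_repr_dilation[OF f]) auto
  define E where "E n = {\<theta>\<in>{0..2*pi}. \<exists>r. 0 \<le> r \<and> r < 1 \<and> norm (h n (polar r \<theta>)) > \<mu>}" for n
  have Em: "E n \<in> sets lborel" for n
  proof -
    have "continuous_on UNIV (\<lambda>\<theta>. h n (polar r \<theta>))" if "0 \<le> r" "r < 1" for r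
    proof -
      have "continuous_on UNIV (\<lambda>\<theta>. f (polar (\<rho> n * r) \<theta>) - f (polar (\<rho> n * s * r) \<theta>))"
        using \<rho>[of n] s that mult_strict_mono[of "\<rho> n" 1 r 1] mult_strict_mono[of "\<rho> n * s" 1 r 1]
        by (intro continuous_intros harmonic_continuous_circle[OF f]) auto
      thus ?thesis by (simp add: h_def mult.assoc)
    qed
    hence o: "open {\<theta>. norm (h n (polar r \<theta>)) > \<mu>}" if "0 \<le> r" "r < 1" for r
      using that by (intro open_Collect_less continuous_intros) auto
    have "open (\<Union>r\<in>{0..<1}. {\<theta>. norm (h n (polar r \<theta>)) > \<mu>})"
      by (intro open_UN ballI o) auto
    moreover have "E n = {0..2*pi} \<inter> (\<Union>r\<in>{0..<1}. {\<theta>. norm (h n (polar r \<theta>)) > \<mu>})"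
      unfolding E_def by auto
    ultimately show ?thesis by simp
  qed
  have Ele: "emeasure lborel (E n) \<le> ennreal \<epsilon>" for n
  proof -
    define u where "u \<theta> = norm (h n (cis \<theta>)) powr p" for \<theta>
    have cu: "continuous_on X u" for X
      unfolding u_def using p by (intro continuous_norm_powr poisson_repr_continuous[OF h]) auto
    have per: "u (x + 2 * pi) = u x" for x by (simp add: u_def cis_mult[symmetric])
    have unn: "u x \<ge> 0" for x by (simp add: u_def)
    obtain V where V: "V \<in> sets lborel" "{\<theta>\<in>{0..2*pi}. \<exists>r. 0 \<le> r \<and> r < 1 \<and> poisson_integral u (polar r \<theta>) > m} \<subseteq> V"
      "emeasure lborel V \<le> ennreal (10 / m * integral {0..2*pi} u)"
      by (rule poisson_maximal_weak_type[OF cu per unn m]) (rule that)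
    have "E n \<subseteq> V"
    proof
      fix \<theta> assume "\<theta> \<in> E n"
      then obtain r where r: "\<theta> \<in> {0..2*pi}" "0 \<le> r" "r < 1" "norm (h n (polar r \<theta>)) > \<mu>" by (auto simp: E_def)
      have "m < norm (h n (polar r \<theta>)) powr p" unfolding m_def using r \<mu> p by (intro powr_less_mono2) auto
      also have "\<dots> \<le> poisson_integral u (polar r \<theta>)"
        unfolding u_def using r p by (intro poisson_repr_norm_powr_le[OF h]) (auto simp: norm_mult)
      finally show "\<theta> \<in> V" using V(2) r by blast
    qed
    hence "emeasure lborel (E n) \<le> ennreal (10 / m * integral {0..2*pi} u)"
      using V by (meson emeasure_mono order_trans)
    also have "\<dots> \<le> ennreal \<epsilon>"
    proof (rule ennreal_leI)
      have "integral {0..2*pi} u \<le> \<eta>" using s0(3)[OF \<rho>(4)[of n] \<rho>(2)[of n] \<rho>(5)[of n] \<rho>(6)[of n]] by (simp add: u_def[abs_def] h_def)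
      hence "10 / m * integral {0..2*pi} u \<le> 10 / m * \<eta>" using m by (intro mult_left_mono) auto
      thus "10 / m * integral {0..2*pi} u \<le> \<epsilon>" using m by (simp add: \<eta>_def)
    qed
    finally show ?thesis .
  qed
  \<comment> \<open>In the original variable \<open>E n\<close> concerns the radii below
    \<open>\<rho> n\<close>, a range that grows with \<open>n\<close>. Monotonicity lets the union
    keep the bound \<open>\<epsilon>\<close>.\<close>
  have inc: "incseq E"
  proof (intro monoI subsetI)
    fix n n' :: nat and \<theta> assume le: "n \<le> n'" and "\<theta> \<in> E n"
    then obtain r where r: "\<theta> \<in> {0..2*pi}" "0 \<le> r" "r < 1" "norm (h n (polar r \<theta>)) > \<mu>" by (auto simp: E_def)
    define r' where "r' = \<rho> n * r / \<rho> n'"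
    have e: "\<rho> n' * r' = \<rho> n * r" using \<rho>(3)[of n'] by (simp add: r'_def)
    have "\<rho> n * r < \<rho> n * 1" using \<rho>(3)[of n] r by (intro mult_strict_left_mono)
    hence "\<rho> n * r < \<rho> n'" using \<rho>mono[OF le] by simp
    hence "0 \<le> r'" "r' < 1" using \<rho>(3)[of n] \<rho>(3)[of n'] r by (auto simp: r'_def pos_divide_less_eq)
    moreover have "h n' (polar r' \<theta>) = h n (polar r \<theta>)"
    proof -
      have "of_real (\<rho> n') * (polar r' \<theta>) = of_real (\<rho> n) * (polar r \<theta>)"
        unfolding mult.assoc[symmetric] of_real_mult[symmetric] e ..
      moreover have "of_real (\<rho> n' * s) * (polar r' \<theta>) = of_real (\<rho> n * s) * (polar r \<theta>)"
      proof -
        have "\<rho> n' * s * r' = \<rho> n * s * r" using e by (metis mult.commute mult.left_commute)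
        thus ?thesis unfolding mult.assoc[symmetric] of_real_mult[symmetric] by (simp only:)
      qed
      ultimately show ?thesis unfolding h_def by (simp only:)
    qed
    ultimately show "\<theta> \<in> E n'" using r unfolding E_def by (intro CollectI conjI exI[of _ r']) auto
  qed
  have "?N \<subseteq> (\<Union>n. E n)"
  proof
    fix \<theta> assume N: "\<theta> \<in> ?N"
    show "\<theta> \<in> (\<Union>n. E n)"
    proof (rule ccontr)
      assume "\<theta> \<notin> (\<Union>n. E n)"
      hence nE: "norm (h n (polar r \<theta>)) \<le> \<mu>" if "0 \<le> r" "r < 1" for n r
        using N that by (auto simp: E_def not_less[symmetric])
      have A: "dist (f (polar x \<theta>)) (f (polar (s * x) \<theta>)) \<le> \<mu>" if x: "0 \<le> x" "x < 1" for x
      proof -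
        obtain n where n: "x < \<rho> n" using \<rho>lim[OF x(2)] by blast
        have "norm (h n (polar (x / \<rho> n) \<theta>)) \<le> \<mu>" using n x \<rho>(3)[of n] by (intro nE) auto
        moreover have "h n (polar (x / \<rho> n) \<theta>) = f (polar x \<theta>) - f (polar (s * x) \<theta>)"
        proof -
          have "of_real (\<rho> n) * (polar (x / \<rho> n) \<theta>) = of_real x * cis \<theta>"
            "of_real (\<rho> n * s) * (polar (x / \<rho> n) \<theta>) = of_real (s * x) * cis \<theta>"
            using \<rho>(3)[of n] by auto
          thus ?thesis unfolding h_def by (simp only:)
        qed
        ultimately show ?thesis by (simp add: dist_norm)
      qed
      have "continuous_on {0..1} (\<lambda>x. f (polar (s * x) \<theta>))"
      proof (rule continuous_on_compose2[OF harmonic_imp_continuous[OF f]])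
        show "(\<lambda>x. of_real (s * x) * cis \<theta>) ` {0..1} \<subseteq> ball 0 1"
        proof -
          have "s * x < 1" if "x \<le> 1" for x using mult_left_le[OF that, of s] s by linarith
          thus ?thesis using s by (auto simp: norm_mult)
        qed
      qed (intro continuous_intros)
      then obtain d where d: "d > 0" "\<And>x. x \<in> {0..1} \<Longrightarrow> dist x 1 < d \<Longrightarrow> dist (f (polar (s * x) \<theta>)) (f (polar (s * 1) \<theta>)) < \<mu> / 2"
        using \<mu> unfolding continuous_on_iff by (metis atLeastAtMost_iff half_gt_zero order_refl zero_le_one)
      define s1 where "s1 = max 0 (1 - d / 2)"
      have "s1 < 1" using d by (auto simp: s1_def)
      then obtain r r' where r: "s1 \<le> r" "r < 1" "s1 \<le> r'" "r' < 1"
         "dist (f (polar r \<theta>)) (f (polar r' \<theta>)) > 3 * \<mu>" using N by blast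
      have "dist (f (polar (s * x) \<theta>)) (f (polar (s * 1) \<theta>)) < \<mu> / 2" if "s1 \<le> x" "x < 1" for x
        using that d(1) by (intro d(2)) (auto simp: s1_def dist_real_def)
      from this[OF r(1,2)] this[OF r(3,4)]
      have "dist (f (polar (s * r) \<theta>)) (f (polar (s * r') \<theta>)) < \<mu>"
        by (rule dist_triangle_half_l)
      moreover have "dist (f (polar r \<theta>)) (f (polar (s * r) \<theta>)) \<le> \<mu>"
        "dist (f (polar r' \<theta>)) (f (polar (s * r') \<theta>)) \<le> \<mu>"
        using r by (auto intro!: A simp del: of_real_mult simp: s1_def)
      ultimately show False using r(5)
        dist_triangle[of "f (polar r \<theta>)" "f (polar r' \<theta>)" "f (polar (s * r) \<theta>)"]
        dist_triangle[of "f (polar (s * r) \<theta>)" "f (polar r' \<theta>)" "f (polar (s * r') \<theta>)"]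
        dist_commute[of "f (polar (s * r') \<theta>)" "f (polar r' \<theta>)"] by linarith
    qed
  qed
  moreover have "(\<Union>n. E n) \<in> lmeasurable \<and> measure lebesgue (\<Union>n. E n) \<le> \<epsilon>"
  proof -
    have Um: "(\<Union>n. E n) \<in> sets lborel" using Em by blast
    have "emeasure lborel (\<Union>n. E n) = (SUP n. emeasure lborel (E n))"
      using Em inc by (intro SUP_emeasure_incseq[symmetric]) auto
    also have "\<dots> \<le> ennreal \<epsilon>" by (intro SUP_least Ele)
    finally have le: "emeasure lborel (\<Union>n. E n) \<le> ennreal \<epsilon>" .
    have "(\<Union>n. E n) \<in> sets lebesgue" using Um by (rule sets_completionI_sets)
    moreover have "emeasure lebesgue (\<Union>n. E n) < \<infinity>"
      using le Um by (simp add: emeasure_completion main_part_sets le_less_trans)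
    ultimately have "(\<Union>n. E n) \<in> lmeasurable" by (rule fmeasurableI)
    moreover have "measure lebesgue (\<Union>n. E n) = measure lborel (\<Union>n. E n)" using Um by (rule measure_completion)
    moreover have "measure lborel (\<Union>n. E n) \<le> \<epsilon>" unfolding measure_def using le \<epsilon> by (intro enn2real_leI) auto
    ultimately show ?thesis by simp
  qed
  ultimately show "\<exists>T. ?N \<subseteq> T \<and> T \<in> lmeasurable \<and> measure lebesgue T \<le> \<epsilon>" by blast
qed

text \<open>Off the negligible sets for \<open>\<mu> = 1 / (n + 1)\<close> the values along the
  radius satisfy a Cauchy condition. Completeness gives a limit along the sequence \<open>R\<close>,
  and the same condition extends it to all radii.\<close>

theorem Fatou_radial_limit:
  assumes f: "harmonic_on f (ball 0 1)" and p: "p > 1"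
    and bd: "\<And>r. 0 < r \<Longrightarrow> r < 1 \<Longrightarrow> circle_powr p r f \<le> B"
  shows "AE \<theta> in lborel. \<theta> \<in> {0..2*pi} \<longrightarrow> (\<exists>l. ((\<lambda>r. f (polar r \<theta>)) \<longlongrightarrow> l) (at_left 1))"
proof -
  define N where "N \<mu> = {\<theta>\<in>{0..2*pi}. \<forall>s<1. \<exists>r r'. s \<le> r \<and> r < 1 \<and> s \<le> r' \<and> r' < 1 \<and>
     dist (f (polar r \<theta>)) (f (polar r' \<theta>)) > 3 * \<mu>}" for \<mu> :: real
  have "negligible (\<Union>n::nat. N (1 / real (Suc n)))"
    unfolding N_def by (intro negligible_countable_Union negligible_Union_nat harmonic_oscillation_negligible[OF f p bd]) auto
  hence "AE \<theta> in lebesgue. \<theta> \<notin> (\<Union>n::nat. N (1 / real (Suc n)))"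
    unfolding negligible_iff_null_sets by (rule AE_not_in)
  hence "AE \<theta> in lborel. \<theta> \<notin> (\<Union>n::nat. N (1 / real (Suc n)))"
    by (simp only: AE_completion_iff)
  thus ?thesis
  proof (rule eventually_mono, intro impI)
    fix \<theta> assume nN: "\<theta> \<notin> (\<Union>n::nat. N (1 / real (Suc n)))" and \<theta>: "\<theta> \<in> {0..2*pi}"
    define g where "g r = f (polar r \<theta>)" for r
    have osc: "\<exists>s<1. \<forall>r r'. s \<le> r \<longrightarrow> r < 1 \<longrightarrow> s \<le> r' \<longrightarrow> r' < 1 \<longrightarrow> dist (g r) (g r') < e" if e: "e > 0" for e
    proof -
      obtain n :: nat where n: "3 / e < real n" using reals_Archimedean2 by blast
      have "3 * (1 / real (Suc n)) < e"
      proof -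
        have "3 < real (Suc n) * e" using n e by (simp add: pos_divide_less_eq algebra_simps)
        thus ?thesis by (simp add: pos_divide_less_eq mult.commute)
      qed
      moreover have "\<theta> \<notin> N (1 / real (Suc n))" using nN by blast
      then obtain s where "s < 1" "\<not> (\<exists>r r'. s \<le> r \<and> r < 1 \<and> s \<le> r' \<and> r' < 1 \<and> dist (g r) (g r') > 3 * (1 / real (Suc n)))"
        using \<theta> unfolding N_def g_def by blast
      then obtain s where "s < 1" "\<And>r r'. s \<le> r \<Longrightarrow> r < 1 \<Longrightarrow> s \<le> r' \<Longrightarrow> r' < 1 \<Longrightarrow> dist (g r) (g r') \<le> 3 * (1 / real (Suc n))"
        by (meson not_less)
      ultimately show ?thesis by (meson le_less_trans)
    qed
    define R where "R n = 1 - 1 / real (Suc n)" for n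
    have R1: "R n < 1" for n by (simp add: R_def)
    have Rlim: "R \<longlonglongrightarrow> 1"
      unfolding R_def using tendsto_diff[OF tendsto_const LIMSEQ_inverse_real_of_nat, of 1] by (simp add: inverse_eq_divide)
    have ev: "\<forall>\<^sub>F n in sequentially. s \<le> R n" if "s < 1" for s
      using order_tendstoD(1)[OF Rlim that] by (auto elim: eventually_mono)
    have "Cauchy (\<lambda>n. g (R n))"
    proof (rule metric_CauchyI)
      fix e :: real assume "e > 0"
      then obtain s where s: "s < 1" "\<And>r r'. s \<le> r \<Longrightarrow> r < 1 \<Longrightarrow> s \<le> r' \<Longrightarrow> r' < 1 \<Longrightarrow> dist (g r) (g r') < e" using osc by blast
      obtain M where "\<And>n. n \<ge> M \<Longrightarrow> s \<le> R n" using ev[OF s(1)] by (auto simp: eventually_sequentially)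
      thus "\<exists>M. \<forall>m\<ge>M. \<forall>n\<ge>M. dist (g (R m)) (g (R n)) < e" using s(2) R1 by blast
    qed
    then obtain l where l: "(\<lambda>n. g (R n)) \<longlonglongrightarrow> l" by (auto simp: Cauchy_convergent_iff convergent_def)
    have "(g \<longlongrightarrow> l) (at_left 1)"
    proof (rule tendstoI)
      fix e :: real assume e: "e > 0"
      obtain s where s: "s < 1" "\<And>r r'. s \<le> r \<Longrightarrow> r < 1 \<Longrightarrow> s \<le> r' \<Longrightarrow> r' < 1 \<Longrightarrow> dist (g r) (g r') < e / 2"
        using osc[of "e/2"] e by auto
      have "dist (g r) l < e" if "s < r" "r < 1" for r
      proof -
        have "dist (g r) l \<le> e / 2"
        proof (rule tendsto_upperbound)
          show "(\<lambda>n. dist (g r) (g (R n))) \<longlonglongrightarrow> dist (g r) l" by (intro tendsto_intros l)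
          show "\<forall>\<^sub>F n in sequentially. dist (g r) (g (R n)) \<le> e / 2"
            using ev[OF s(1)] by eventually_elim (use that s R1 in \<open>auto intro!: less_imp_le\<close>)
        qed simp
        thus ?thesis using e by simp
      qed
      thus "\<forall>\<^sub>F r in at_left 1. dist (g r) l < e"
        using s(1) by (auto simp: eventually_at_left)
    qed
    thus "\<exists>l. ((\<lambda>r. f (polar r \<theta>)) \<longlongrightarrow> l) (at_left 1)" unfolding g_def by blast
  qed
qed

section \<open>The inequality for convex curves\<close>

text \<open>The cases distinguish whether \<open>a - b\<close> is small relative to
  \<open>b\<close>. The factor of the main term can be brought close to 1 at the price of a large
  fixed factor on the error, which is made small first.\<close>

lemma norm_powr_add_le:
  fixes a b :: complex and p \<kappa> :: real
  assumes p: "p > 0" and \<kappa>: "\<kappa> > 0"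
  shows "norm a powr p \<le> (1 + \<kappa>) powr p * norm b powr p + (1 + 1 / \<kappa>) powr p * norm (a - b) powr p"
proof (cases "norm (a - b) \<le> \<kappa> * norm b")
  case True
  have "norm a \<le> norm b + norm (a - b)" using norm_triangle_ineq[of b "a - b"] by simp
  also have "\<dots> \<le> (1 + \<kappa>) * norm b" using True by (simp add: algebra_simps)
  finally have "norm a powr p \<le> ((1 + \<kappa>) * norm b) powr p" using p by (intro powr_mono2) auto
  thus ?thesis using \<kappa> by (simp add: powr_mult add_increasing2)
next
  case False
  have "norm a \<le> norm b + norm (a - b)" using norm_triangle_ineq[of b "a - b"] by simp
  also have "norm b \<le> 1 / \<kappa> * norm (a - b)" using False \<kappa> by (simp add: field_simps)
  finally have "norm a \<le> (1 + 1 / \<kappa>) * norm (a - b)" by (simp add: algebra_simps)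
  hence "norm a powr p \<le> ((1 + 1 / \<kappa>) * norm (a - b)) powr p" using p by (intro powr_mono2) auto
  thus ?thesis using \<kappa> by (simp add: powr_mult add_increasing)
qed

text \<open>The offset 2 makes all radii positive, starting at \<open>1 / 2\<close>.\<close>

lemma dilation_sequence_at_left:
  "filterlim (\<lambda>n. 1 - 1 / real (n + 2)) (at_left 1) sequentially"
proof -
  have "(\<lambda>n. 1 - 1 / real (n + 2)) \<longlonglongrightarrow> 1"
    using tendsto_diff[OF tendsto_const LIMSEQ_ignore_initial_segment[OF lim_const_over_n[of 1], of 2], of 1] by simp
  thus ?thesis unfolding filterlim_at by (auto simp: eventually_sequentially)
qed

text \<open>Fatou's lemma turns the Cauchy estimate between two radii into one between the circle of
  radius \<open>r\<close> and the radial limit; the split of \<open>norm_powr_add_le\<close> then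
  compares the integrals.\<close>

lemma integral_dilation_le_radial_limit:
  assumes f: "harmonic_on f (ball 0 1)" and p: "p > 1"
    and bd: "\<And>r. 0 < r \<Longrightarrow> r < 1 \<Longrightarrow> circle_powr p r f \<le> B"
    and \<kappa>: "\<kappa> > 0" and \<eta>: "\<eta> > 0"
  obtains s0 where "0 < s0" "s0 < 1" "\<And>r. s0 \<le> r \<Longrightarrow> r < 1 \<Longrightarrow>
    ennreal (circle_powr p r f)
      \<le> ennreal ((1 + \<kappa>) powr p) * circle_integral_powr p f + ennreal ((1 + 1 / \<kappa>) powr p * \<eta>)"
proof -
  obtain s0 where s0: "0 < s0" "s0 < 1" "\<And>r \<rho>. s0 \<le> r \<Longrightarrow> r < 1 \<Longrightarrow> s0 \<le> \<rho> \<Longrightarrow> \<rho> < 1 \<Longrightarrow>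
    integral {0..2*pi} (\<lambda>\<theta>. norm (f (polar r \<theta>) - f (polar \<rho> \<theta>)) powr p) \<le> \<eta>"
    by (rule harmonic_Lp_Cauchy[OF f p _ \<eta>, where B = B]) (use bd that in blast)+
  define R where "R n = 1 - 1 / real (n + 2)" for n :: nat
  have R: "0 < R n" "R n < 1" for n by (auto simp: R_def)
  have Rl: "filterlim R (at_left 1) sequentially" using dilation_sequence_at_left by (simp add: R_def[abs_def])
  define G where "G r \<theta> = f (polar r \<theta>)" for r \<theta>
  have cG: "continuous_on X (G r)" if "0 < r" "r < 1" for r X
    unfolding G_def using harmonic_continuous_circle[OF f, of r] that by simp
  have mG: "G r \<in> borel_measurable borel" if "0 < r" "r < 1" for r
    using cG[OF that] by (rule borel_measurable_continuous_onI)
  \<comment> \<open>A Borel measurable version of the radial limit, obtained along a sequence of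
    continuous functions; it agrees with \<open>radial_limit f\<close> at almost every angle of the
    interval.\<close>
  define F where "F \<theta> = lim (\<lambda>n. G (R n) \<theta>)" for \<theta>
  have mF: "F \<in> borel_measurable borel" unfolding F_def
    by (rule borel_measurable_lim_metric) (use mG R in auto)
  have ae: "AE \<theta> in lborel. \<theta> \<in> {0..2*pi} \<longrightarrow> (\<lambda>n. G (R n) \<theta>) \<longlonglongrightarrow> F \<theta> \<and> radial_limit f (cis \<theta>) = F \<theta>"
  proof -
    have "AE \<theta> in lborel. \<theta> \<in> {0..2*pi} \<longrightarrow> (\<exists>l. ((\<lambda>r. f (polar r \<theta>)) \<longlongrightarrow> l) (at_left 1))"
      by (rule Fatou_radial_limit[OF f p, where B = B]) (rule bd)
    thus ?thesis
    proof eventually_elim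
      case (elim \<theta>)
      show ?case
      proof
        assume "\<theta> \<in> {0..2*pi}"
        then obtain l where l: "((\<lambda>r. f (polar r \<theta>)) \<longlongrightarrow> l) (at_left 1)" using elim by blast
        have 1: "(\<lambda>n. G (R n) \<theta>) \<longlonglongrightarrow> l" unfolding G_def by (rule filterlim_compose[OF l Rl])
        hence "F \<theta> = l" unfolding F_def by (rule limI)
        moreover have "radial_limit f (cis \<theta>) = l" unfolding radial_limit_def using l by (intro tendsto_Lim) auto
        ultimately show "(\<lambda>n. G (R n) \<theta>) \<longlonglongrightarrow> F \<theta> \<and> radial_limit f (cis \<theta>) = F \<theta>" using 1 by simp
      qed
    qed
  qed
  define J where "J = {0..2*pi}"
  have Jm[measurable]: "J \<in> sets borel" by (simp add: J_def)
  have X: "circle_integral_powr p f = (\<integral>\<^sup>+\<theta>. ennreal (norm (F \<theta>) powr p) * indicator J \<theta> \<partial>lborel)"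
    unfolding circle_integral_powr_def J_def
    by (rule nn_integral_cong_AE) (use ae in \<open>auto elim!: eventually_mono simp: indicator_def\<close>)
  have main: "ennreal (integral {0..2*pi} (\<lambda>\<theta>. norm (G r \<theta>) powr p))
      \<le> ennreal ((1 + \<kappa>) powr p) * circle_integral_powr p f + ennreal ((1 + 1 / \<kappa>) powr p * \<eta>)"
    if r: "s0 \<le> r" "r < 1" for r
  proof -
    have r0: "0 < r" using r s0 by simp
    note mr[measurable] = mG[OF r0 r(2)] mF
    have cu: "continuous_on UNIV (\<lambda>\<theta>. norm (G r \<theta> - G (R n) \<theta>) powr p)" for n
      using p by (intro continuous_norm_powr continuous_intros cG r0 r R) auto
    have diff: "(\<integral>\<^sup>+\<theta>. ennreal (norm (G r \<theta> - F \<theta>) powr p) * indicator J \<theta> \<partial>lborel) \<le> ennreal \<eta>"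
    proof -
      have "(\<integral>\<^sup>+\<theta>. ennreal (norm (G r \<theta> - F \<theta>) powr p) * indicator J \<theta> \<partial>lborel)
        = (\<integral>\<^sup>+\<theta>. liminf (\<lambda>n. ennreal (norm (G r \<theta> - G (R n) \<theta>) powr p) * indicator J \<theta>) \<partial>lborel)"
      proof (rule nn_integral_cong_AE)
        show "AE \<theta> in lborel. ennreal (norm (G r \<theta> - F \<theta>) powr p) * indicator J \<theta> = liminf (\<lambda>n. ennreal (norm (G r \<theta> - G (R n) \<theta>) powr p) * indicator J \<theta>)"
          using ae
        proof eventually_elim
          case (elim \<theta>)
          show ?case
          proof (cases "\<theta> \<in> J")
            case True
            hence l: "(\<lambda>n. G (R n) \<theta>) \<longlonglongrightarrow> F \<theta>" using elim by (simp add: J_def)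
            have "(\<lambda>n. ennreal (norm (G r \<theta> - G (R n) \<theta>) powr p)) \<longlonglongrightarrow> ennreal (norm (G r \<theta> - F \<theta>) powr p)"
              using p by (intro tendsto_ennrealI tendsto_powr' tendsto_intros l) auto
            hence "liminf (\<lambda>n. ennreal (norm (G r \<theta> - G (R n) \<theta>) powr p)) = ennreal (norm (G r \<theta> - F \<theta>) powr p)"
              by (intro lim_imp_Liminf) auto
            thus ?thesis using True by simp
          qed (simp add: Liminf_const)
        qed
      qed
      also have "\<dots> \<le> liminf (\<lambda>n. \<integral>\<^sup>+\<theta>. ennreal (norm (G r \<theta> - G (R n) \<theta>) powr p) * indicator J \<theta> \<partial>lborel)"
      proof (rule nn_integral_liminf)
        fix n
        note mG[OF R[of n], measurable]
        show "(\<lambda>\<theta>. ennreal (norm (G r \<theta> - G (R n) \<theta>) powr p) * indicator J \<theta>) \<in> borel_measurable lborel"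
          by measurable
      qed
      also have "\<dots> \<le> ennreal \<eta>"
      proof (rule Liminf_le)
        have "\<forall>\<^sub>F n in sequentially. R n > s0"
          using filterlim_iff[THEN iffD1, OF Rl, rule_format, of "\<lambda>r. r > s0"] s0
          by (auto simp: eventually_at_left)
        thus "\<forall>\<^sub>F n in sequentially. (\<integral>\<^sup>+\<theta>. ennreal (norm (G r \<theta> - G (R n) \<theta>) powr p) * indicator J \<theta> \<partial>lborel) \<le> ennreal \<eta>"
        proof eventually_elim
          case (elim n)
          have "(\<integral>\<^sup>+\<theta>. ennreal (norm (G r \<theta> - G (R n) \<theta>) powr p) * indicator J \<theta> \<partial>lborel) = ennreal (integral {0..2*pi} (\<lambda>\<theta>. norm (G r \<theta> - G (R n) \<theta>) powr p))"
            unfolding J_def by (rule nn_integral_continuous_interval[OF cu]) auto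
          also have "\<dots> \<le> ennreal \<eta>"
            using s0(3)[OF r, of "R n"] elim R[of n] by (intro ennreal_leI) (simp add: G_def)
          finally show ?case .
        qed
      qed simp
      finally show ?thesis .
    qed
    have "ennreal (integral {0..2*pi} (\<lambda>\<theta>. norm (G r \<theta>) powr p)) = (\<integral>\<^sup>+\<theta>. ennreal (norm (G r \<theta>) powr p) * indicator J \<theta> \<partial>lborel)"
      unfolding J_def using p
      by (intro nn_integral_continuous_interval[symmetric] continuous_norm_powr cG r0 r) auto
    also have "\<dots> \<le> (\<integral>\<^sup>+\<theta>. ennreal ((1 + \<kappa>) powr p) * (ennreal (norm (F \<theta>) powr p) * indicator J \<theta>)
        + ennreal ((1 + 1 / \<kappa>) powr p) * (ennreal (norm (G r \<theta> - F \<theta>) powr p) * indicator J \<theta>) \<partial>lborel)"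
    proof (rule nn_integral_mono)
      fix \<theta>
      have "ennreal (norm (G r \<theta>) powr p) \<le> ennreal ((1 + \<kappa>) powr p * norm (F \<theta>) powr p + (1 + 1 / \<kappa>) powr p * norm (G r \<theta> - F \<theta>) powr p)"
        using p \<kappa> by (intro ennreal_leI norm_powr_add_le) auto
      also have "\<dots> = ennreal ((1 + \<kappa>) powr p) * ennreal (norm (F \<theta>) powr p) + ennreal ((1 + 1 / \<kappa>) powr p) * ennreal (norm (G r \<theta> - F \<theta>) powr p)"
        by (simp add: ennreal_plus ennreal_mult)
      finally show "ennreal (norm (G r \<theta>) powr p) * indicator J \<theta> \<le> ennreal ((1 + \<kappa>) powr p) * (ennreal (norm (F \<theta>) powr p) * indicator J \<theta>)
        + ennreal ((1 + 1 / \<kappa>) powr p) * (ennreal (norm (G r \<theta> - F \<theta>) powr p) * indicator J \<theta>)"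
        by (simp add: indicator_def)
    qed
    also have "\<dots> = ennreal ((1 + \<kappa>) powr p) * circle_integral_powr p f
        + ennreal ((1 + 1 / \<kappa>) powr p) * (\<integral>\<^sup>+\<theta>. ennreal (norm (G r \<theta> - F \<theta>) powr p) * indicator J \<theta> \<partial>lborel)"
      unfolding X by (subst nn_integral_add) (auto simp: nn_integral_cmult)
    also have "\<dots> \<le> ennreal ((1 + \<kappa>) powr p) * circle_integral_powr p f + ennreal ((1 + 1 / \<kappa>) powr p) * ennreal \<eta>"
      by (intro add_left_mono mult_left_mono diff) simp
    finally show ?thesis using \<eta> by (simp add: ennreal_mult)
  qed
  show thesis
    by (rule that[OF s0(1,2)]) (use main in \<open>simp add: G_def\<close>)
qed

lemma harmonic_hardyD:
  assumes "f \<in> harmonic_hardy p" "p > 1"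
  obtains B where "\<And>r. 0 < r \<Longrightarrow> r < 1 \<Longrightarrow> circle_powr p r f \<le> B"
proof -
  obtain b where b: "\<And>r. 0 < r \<Longrightarrow> r < 1 \<Longrightarrow> integral_mean p r f \<le> b"
    using assms(1) unfolding harmonic_hardy_def bdd_above_def by (force simp: ball_simps)
  show thesis
  proof (rule that)
    fix r :: real assume r: "0 < r" "r < 1"
    define I where "I = circle_powr p r f"
    have "continuous_on {0..2*pi} (\<lambda>\<theta>. f (polar r \<theta>))"
      using assms(1) r by (intro harmonic_continuous_circle) (auto simp: harmonic_hardy_def)
    hence "I \<ge> 0" unfolding I_def using assms(2)
      by (intro integral_nonneg integrable_continuous_interval continuous_norm_powr) auto
    have "((1 / (2 * pi) * I) powr (1 / p)) powr p \<le> b powr p"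
      using b[OF r] assms(2) by (intro powr_mono2) (auto simp: integral_mean_def I_def)
    hence "1 / (2 * pi) * I \<le> b powr p" using \<open>I \<ge> 0\<close> assms(2) by (simp add: powr_powr)
    thus "I \<le> 2 * pi * b powr p" by (simp add: field_simps)
  qed
qed

text \<open>By continuity of \<open>f\<close> inside the disc, Fatou's lemma bounds the curve
  integral by the lower limit of those of the dilations. These are controlled by circle means, and
  the comparison with the radial limits costs an additive error and a factor
  \<open>(1 + \<kappa>) powr p\<close>, removed in this order.\<close>

lemma curve_integral_powr_le:
  assumes f: "f \<in> harmonic_hardy (s * t)" and s: "s \<ge> 1" and t: "1 < t" "t \<le> 2"
    and C: "convex_curve \<gamma> A" "\<gamma> ` A \<subseteq> ball 0 1"
  shows "curve_integral_powr (s * t) \<gamma> A f \<le> ennreal (2 * (1 / cos (pi / (2 * t))) powr t) * circle_integral_powr (s * t) f"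
proof -
  define p where "p = s * t"
  define K where "K = 2 * (1 / cos (pi / (2 * t))) powr t"
  define X where "X = circle_integral_powr p f"
  define M where "M = arc_length_measure \<gamma> A"
  have "1 * t \<le> s * t" using s t by (intro mult_right_mono) auto
  hence p: "p > 1" using t(1) unfolding p_def by linarith
  have h: "harmonic_on f (ball 0 1)" using f by (simp add: harmonic_hardy_def)
  have "cos (pi / (2 * t)) > 0" using t pi_gt_zero by (intro cos_gt_zero) (auto simp: field_simps)
  hence K: "K > 0" by (simp add: K_def)
  obtain B where B: "\<And>r. 0 < r \<Longrightarrow> r < 1 \<Longrightarrow> circle_powr p r f \<le> B"
    using harmonic_hardyD[of f p] f p unfolding p_def by metis
  have A: "is_interval A" "continuous_on A \<gamma>" using C by (auto simp: convex_curve_def)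
  define R where "R n = 1 - 1 / real (n + 2)" for n :: nat
  have R: "0 < R n" "R n < 1" for n by (auto simp: R_def)
  have Rl: "filterlim R (at_left 1) sequentially" using dilation_sequence_at_left by (simp add: R_def[abs_def])
  have R1: "R \<longlonglongrightarrow> 1" using Rl by (rule filterlim_mono) (auto simp: at_within_le_nhds)
  have R2: "(R n)\<^sup>2 < 1" for n using R[of n] by (simp add: power_less_one_iff)
  have cf: "continuous_on (ball 0 1) f" by (rule harmonic_imp_continuous[OF h])
  have n: "norm (of_real ((R n)\<^sup>2) * \<gamma> u) < 1" if "u \<in> A" for n u
    using that C(2) R2[of n] mult_strict_mono[of "(R n)\<^sup>2" 1 "norm (\<gamma> u)" 1] by (force simp: norm_mult norm_power)
  define L where "L = curve_integral_powr p \<gamma> A f"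
  have Lle: "L \<le> liminf (\<lambda>n. \<integral>\<^sup>+u. ennreal (norm (f (of_real ((R n)\<^sup>2) * \<gamma> u)) powr p) \<partial>M)"
  proof -
    have "L = (\<integral>\<^sup>+u. liminf (\<lambda>n. ennreal (norm (f (of_real ((R n)\<^sup>2) * \<gamma> u)) powr p)) \<partial>M)"
      unfolding L_def curve_integral_powr_def M_def[symmetric]
    proof (rule nn_integral_cong)
      fix u assume "u \<in> space M"
      hence u: "\<gamma> u \<in> ball 0 1" using C(2) space_arc_length_measure[OF A(1)] by (auto simp: M_def)
      have "(\<lambda>n. of_real ((R n)\<^sup>2) * \<gamma> u) \<longlonglongrightarrow> of_real (1\<^sup>2) * \<gamma> u" by (intro tendsto_intros R1)
      hence l: "(\<lambda>n. of_real ((R n)\<^sup>2) * \<gamma> u) \<longlonglongrightarrow> \<gamma> u" by simp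
      have "isCont f (\<gamma> u)" using cf u by (simp add: continuous_on_eq_continuous_at)
      hence "(\<lambda>n. f (of_real ((R n)\<^sup>2) * \<gamma> u)) \<longlonglongrightarrow> f (\<gamma> u)" using l by (rule isCont_tendsto_compose)
      hence "(\<lambda>n. ennreal (norm (f (of_real ((R n)\<^sup>2) * \<gamma> u)) powr p)) \<longlonglongrightarrow> ennreal (norm (f (\<gamma> u)) powr p)"
        using p by (intro tendsto_ennrealI tendsto_powr' tendsto_intros) auto
      thus "ennreal (norm (f (\<gamma> u)) powr p) = liminf (\<lambda>n. ennreal (norm (f (of_real ((R n)\<^sup>2) * \<gamma> u)) powr p))"
        by (intro lim_imp_Liminf[symmetric]) auto
    qed
    also have "\<dots> \<le> liminf (\<lambda>n. \<integral>\<^sup>+u. ennreal (norm (f (of_real ((R n)\<^sup>2) * \<gamma> u)) powr p) \<partial>M)"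
    proof (rule nn_integral_liminf)
      fix k
      have "continuous_on A (\<lambda>u. f (of_real ((R k)\<^sup>2) * \<gamma> u))"
        by (rule continuous_on_compose2[OF cf]) (use n in \<open>auto intro!: continuous_intros A(2)\<close>)
      hence "continuous_on A (\<lambda>u. norm (f (of_real ((R k)\<^sup>2) * \<gamma> u)) powr p)"
        using p by (intro continuous_norm_powr) auto
      from borel_measurable_arc_length_measure[OF A(1) this]
      show "(\<lambda>u. ennreal (norm (f (of_real ((R k)\<^sup>2) * \<gamma> u)) powr p)) \<in> borel_measurable M"
        unfolding M_def by measurable
    qed
    finally show ?thesis .
  qed
  have step: "L \<le> ennreal (K * (1 + \<kappa>) powr p) * X" if \<kappa>: "\<kappa> > 0" for \<kappa>
  proof (rule ennreal_le_epsilon)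
    fix e :: real assume e: "e > 0"
    define c where "c = (1 + 1 / \<kappa>) powr p"
    have "1 + 1 / \<kappa> > 0" using \<kappa> by (simp add: add_pos_pos)
    hence c: "c > 0" by (simp add: c_def)
    \<comment> \<open>The error passes through the factors \<open>K\<close> and \<open>c\<close> and
      so ends up as exactly \<open>e\<close>.\<close>
    define \<eta> where "\<eta> = e / (K * c)"
    have \<eta>: "\<eta> > 0" using e K c by (simp add: \<eta>_def)
    obtain s0 where s0: "0 < s0" "s0 < 1" "\<And>r. s0 \<le> r \<Longrightarrow> r < 1 \<Longrightarrow>
      ennreal (circle_powr p r f) \<le> ennreal ((1 + \<kappa>) powr p) * X + ennreal (c * \<eta>)"
      unfolding X_def c_def
      by (rule integral_dilation_le_radial_limit[OF h p _ \<kappa> \<eta>, where B = B]) (use B that in blast)+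
    have "liminf (\<lambda>n. \<integral>\<^sup>+u. ennreal (norm (f (of_real ((R n)\<^sup>2) * \<gamma> u)) powr p) \<partial>M) \<le> ennreal (K * (1 + \<kappa>) powr p) * X + ennreal e"
    proof (rule Liminf_le)
      have "\<forall>\<^sub>F n in sequentially. R n > s0" using order_tendstoD(1)[OF R1 s0(2)] .
      thus "\<forall>\<^sub>F n in sequentially. (\<integral>\<^sup>+u. ennreal (norm (f (of_real ((R n)\<^sup>2) * \<gamma> u)) powr p) \<partial>M) \<le> ennreal (K * (1 + \<kappa>) powr p) * X + ennreal e"
      proof eventually_elim
        case (elim k)
        have "(\<integral>\<^sup>+u. ennreal (norm (f (of_real ((R k)\<^sup>2) * \<gamma> u)) powr p) \<partial>M) \<le> ennreal (K * circle_powr p (R k) f)"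
          unfolding M_def p_def K_def by (rule harmonic_curve_integral_le[OF h R s t C])
        also have "\<dots> = ennreal K * ennreal (circle_powr p (R k) f)"
          using K by (intro ennreal_mult') auto
        also have "\<dots> \<le> ennreal K * (ennreal ((1 + \<kappa>) powr p) * X + ennreal (c * \<eta>))"
          using elim R[of k] by (intro mult_left_mono s0(3)) auto
        also have "\<dots> = ennreal K * ennreal ((1 + \<kappa>) powr p) * X + ennreal K * ennreal (c * \<eta>)"
          by (simp only: distrib_left mult.assoc)
        also have "ennreal K * ennreal ((1 + \<kappa>) powr p) = ennreal (K * (1 + \<kappa>) powr p)"
          using K by (simp add: ennreal_mult)
        also have "ennreal K * ennreal (c * \<eta>) = ennreal (K * (c * \<eta>))"
          using K by (simp add: ennreal_mult')
        also have "K * (c * \<eta>) = e" using K c by (simp add: \<eta>_def)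
        finally show ?case .
      qed
    qed simp
    thus "L \<le> ennreal (K * (1 + \<kappa>) powr p) * X + ennreal e" using Lle by (rule order_trans[rotated])
  qed
  have "L \<le> ennreal K * X"
  proof (cases "X = top")
    \<comment> \<open>Since \<open>K > 0\<close>, an infinite boundary integral makes the right side
      infinite. Otherwise \<open>\<kappa>\<close> tends to 0 in an expression with real
      values.\<close>
    case True
    thus ?thesis using K by (simp add: ennreal_mult_eq_top_iff ennreal_mult_top)
  next
    case False
    then obtain x where x: "X = ennreal x" "x \<ge> 0" by (cases X) auto
    have "((\<lambda>\<kappa>. ennreal (K * (1 + \<kappa>) powr p * x)) \<longlongrightarrow> ennreal (K * (1 + 0) powr p * x)) (at_right 0)"
      by (intro tendsto_ennrealI tendsto_intros) auto
    moreover have "\<forall>\<^sub>F \<kappa> in at_right 0. L \<le> ennreal (K * (1 + \<kappa>) powr p * x)"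
    proof (rule eventually_at_rightI)
      fix \<kappa> :: real assume "\<kappa> \<in> {0<..<1}"
      thus "L \<le> ennreal (K * (1 + \<kappa>) powr p * x)"
        using step[of \<kappa>] K x by (simp add: ennreal_mult)
    qed simp
    ultimately have "L \<le> ennreal (K * (1 + 0) powr p * x)" by (rule tendsto_lowerbound) simp
    thus ?thesis using K x by (simp add: ennreal_mult)
  qed
  thus ?thesis by (simp add: L_def X_def K_def p_def)
qed

theorem theorem1:
  fixes p :: real and f :: "complex \<Rightarrow> complex"
    and \<gamma> :: "real \<Rightarrow> complex" and A :: "real set"
  assumes "p > 1" and "f \<in> harmonic_hardy p"
    and "convex_curve \<gamma> A" and "\<gamma> ` A \<subseteq> ball 0 1"
  shows "(p \<ge> 2 \<longrightarrow>
            curve_integral_powr p \<gamma> A f \<le> 4 * circle_integral_powr p f) \<and>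
         (p < 2 \<longrightarrow>
            curve_integral_powr p \<gamma> A f
              \<le> ennreal (2 * (1 / cos (pi / (2 * p))) powr p) * circle_integral_powr p f)"
proof (intro conjI impI)
  assume p: "p \<ge> 2"
  \<comment> \<open>The split \<open>p = (p / 2) * 2\<close> puts the trigonometric inequality at
    its upper end \<open>t = 2\<close>, where the squared secant of \<open>pi / 4\<close> doubles
    the factor 2.\<close>
  have "(1 / cos (pi / (2 * 2))) powr 2 = (2::real)"
    by (simp add: cos_45 powr_numeral power_divide)
  hence "ennreal (2 * (1 / cos (pi / (2 * 2))) powr 2) = 4" by simp
  moreover have "f \<in> harmonic_hardy (p / 2 * 2)" using assms(2) by simp
  ultimately show "curve_integral_powr p \<gamma> A f \<le> 4 * circle_integral_powr p f"
    using curve_integral_powr_le[of f "p / 2" 2 \<gamma> A] p assms(3,4) by simp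
next
  assume "p < 2"
  thus "curve_integral_powr p \<gamma> A f \<le> ennreal (2 * (1 / cos (pi / (2 * p))) powr p) * circle_integral_powr p f"
    using curve_integral_powr_le[of f 1 p \<gamma> A] assms by simp
qed

end
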